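(* Let $\mathbb{F}=\mathbb{F}_p$ be a prime field, $n\in\mathbb{N}$, and $\alpha:=\alpha(n)\in(0,1]$. Suppose there exists an algorithm $\mathsf{ALG}$ that, on input two matrices $A,B\in\mathbb{F}^{n\times n}$, runs in time $T(n)$ and satisfies $$\Pr[\mathsf{ALG}(A,B)=A\cdot B]\ge\alpha,$$ where the probability is over uniformly random inputs $A,B\in\mathbb{F}^{n\times n}$ and the internal randomness of $\mathsf{ALG}$. \begin{itemize} \item If $|\mathbb{F}|\le 2/\alpha$, then there exists a randomized algorithm $\mathsf{ALG}'$ that for every input $A,B\in\mathbb{F}^{n\times n}$ and every $\delta>0$ runs in time $\frac{\exp(O(\log^5(1/\alpha)))}{\delta}\cdot T(n)$ and outputs $AB$ with probability at least $1-\delta$. \item If $|\mathbb{F}|\ge 2/\alpha$, then there exists a randomized algorithm $\mathsf{ALG}'$ that for every input $A,B\in\mathbb{F}^{n\times n}$ and every $\delta>0$ runs in time $O\!\left(\frac{1}{\delta\cdot\alpha^4}\cdot T(n)\right)$ and outputs $AB$ with probability at least $1-\delta$. \end{itemize}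
   Context: $\mathsf{ALG}'$ may call $\mathsf{ALG}$ as a black box; running times count each call to $\mathsf{ALG}$ at its cost $T(n)$ plus field operations. *)

theory Defs
  imports
    "HOL-Probability.Probability_Mass_Function"
    "HOL-Number_Theory.Modular_Inverse"
    "Jordan_Normal_Form.Matrix"
begin

section \<open>Square matrices over a prime field\<close>

text \<open>
  The elements of the prime field with \<open>p\<close> elements are represented by the integers
  \<open>0, \<dots>, p - 1\<close>, with arithmetic modulo \<open>p\<close>.
\<close>

definition Fp_mats :: "nat \<Rightarrow> nat \<Rightarrow> int mat set" where
  "Fp_mats p n = {A \<in> carrier_mat n n. elements_mat A \<subseteq> {0..<int p}}"

definition Fp_mult :: "nat \<Rightarrow> int mat \<Rightarrow> int mat \<Rightarrow> int mat" where
  "Fp_mult p A B = map_mat (\<lambda>x. x mod int p) (A * B)"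

lemma finite_Fp_mats: "finite (Fp_mats p n)"
proof (rule finite_subset)
  let ?I = "{..<n} \<times> {..<n}"
  show "Fp_mats p n \<subseteq> mat n n ` (?I \<rightarrow>\<^sub>E {0..<int p})"
  proof
    fix A assume A: "A \<in> Fp_mats p n"
    have "A = mat n n (restrict (\<lambda>ij. A $$ ij) ?I)"
      using A by (intro eq_matI) (auto simp: Fp_mats_def)
    moreover have "restrict (\<lambda>ij. A $$ ij) ?I \<in> ?I \<rightarrow>\<^sub>E {0..<int p}"
      using A by (auto simp: Fp_mats_def subset_iff intro!: restrict_PiE_iff[THEN iffD2])
    ultimately show "A \<in> mat n n ` (?I \<rightarrow>\<^sub>E {0..<int p})" by blast
  qed
qed (auto intro!: finite_imageI finite_PiE)

lemma Fp_mats_nonempty: "0 < p \<Longrightarrow> Fp_mats p n \<noteq> {}"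
  using Fp_mats_def elements_mat_def by (auto intro!: exI[of _ "0\<^sub>m n n"])


section \<open>A randomized random access machine over a prime field\<close>

text \<open>
  A program is a finite piece of syntax that works for all matrix sizes.  The memory consists of
  \<^item> index registers and one-dimensional index arrays, which hold natural numbers;
  \<^item> two-dimensional arrays of field elements, whose cells are addressed by index registers;
  \<^item> a two-dimensional output area, whose cells are undefined until they are written.

  Every instruction and every evaluation of a guard has cost 1.  Field operations are
  unit-cost, but the only arithmetic on index registers is successor and predecessor.  With
  unit-cost addition or multiplication of unbounded integers one could pack whole rows of a
  matrix into a single register, and multiply matrices over small fields in (almost) quadratic
  time.  As output cells start undefined, an algorithm that outputs an \<open>n \<times> n\<close> matrix has cost
  at least \<open>n\<^sup>2\<close>.
\<close>

text \<open>A field cell \<open>(a, i, j)\<close>: entry of array \<open>a\<close> at the contents of index registers \<open>i\<close>, \<open>j\<close>.\<close>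

type_synonym loc = "nat \<times> nat \<times> nat"

datatype instr =
    IZero nat              \<comment> \<open>\<open>x := 0\<close>\<close>
  | ISucc nat              \<comment> \<open>\<open>x := x + 1\<close>\<close>
  | IPred nat              \<comment> \<open>\<open>x := x - 1\<close>, truncated at 0\<close>
  | ICopy nat nat          \<comment> \<open>\<open>x := y\<close>\<close>
  | ILoad nat nat nat      \<comment> \<open>\<open>x := a[y]\<close>\<close>
  | IStore nat nat nat     \<comment> \<open>\<open>a[x] := y\<close>\<close>
  | IFlip nat              \<comment> \<open>\<open>x :=\<close> a fair coin flip in \<open>{0, 1}\<close>\<close>
  | IOfF nat loc           \<comment> \<open>\<open>x :=\<close> the representative of a field element\<close>
  | FOfI loc nat           \<comment> \<open>residue class of an index\<close>
  | FCopy loc loc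
  | FAdd loc loc loc
  | FSub loc loc loc
  | FMul loc loc loc
  | FInv loc loc           \<comment> \<open>inverse, with 0 mapped to 0\<close>
  | FRand loc              \<comment> \<open>a uniformly random field element\<close>
  | Output nat nat loc
  | Call nat nat nat       \<comment> \<open>run the black box on arrays \<open>a\<close>, \<open>b\<close>, store the result in array \<open>c\<close>\<close>

datatype guard = ILess nat nat | FEq loc loc | GNot guard

datatype com =
    Skip
  | Do instr
  | Seq com com
  | Cond guard com com
  | While guard com

fun call_free :: "com \<Rightarrow> bool" where
  "call_free Skip = True"
| "call_free (Do i) = (\<forall>a b c. i \<noteq> Call a b c)"
| "call_free (Seq c d) = (call_free c \<and> call_free d)"
| "call_free (Cond g c d) = (call_free c \<and> call_free d)"
| "call_free (While g c) = call_free c"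

record state =
  ireg :: "nat \<Rightarrow> nat"
  iarr :: "nat \<Rightarrow> nat \<Rightarrow> nat"
  farr :: "nat \<Rightarrow> nat \<Rightarrow> nat \<Rightarrow> int"
  outp :: "nat \<Rightarrow> nat \<Rightarrow> int option"

text \<open>
  A black box maps two matrices to a distribution of outputs, where \<open>None\<close> stands for an
  output that is not a complete matrix.
\<close>

type_synonym black_box = "int mat \<Rightarrow> int mat \<Rightarrow> int mat option pmf"

definition set_ireg :: "nat \<Rightarrow> nat \<Rightarrow> state \<Rightarrow> state" where
  "set_ireg x v s = s\<lparr>ireg := (ireg s)(x := v)\<rparr>"

fun get_loc :: "state \<Rightarrow> loc \<Rightarrow> int" where
  "get_loc s (a, i, j) = farr s a (ireg s i) (ireg s j)"

fun set_loc :: "loc \<Rightarrow> int \<Rightarrow> state \<Rightarrow> state" where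
  "set_loc (a, i, j) v s =
     s\<lparr>farr := (farr s)(a := (farr s a)(ireg s i := (farr s a (ireg s i))(ireg s j := v)))\<rparr>"

definition get_mat :: "nat \<Rightarrow> nat \<Rightarrow> state \<Rightarrow> int mat" where
  "get_mat n a s = mat n n (\<lambda>(i, j). farr s a i j)"

definition arr_of_mat :: "int mat \<Rightarrow> nat \<Rightarrow> nat \<Rightarrow> int" where
  "arr_of_mat A i j = (if i < dim_row A \<and> j < dim_col A then A $$ (i, j) else 0)"

definition set_mat_arr :: "nat \<Rightarrow> int mat option \<Rightarrow> state \<Rightarrow> state" where
  "set_mat_arr c M s =
     s\<lparr>farr := (farr s)(c := (case M of None \<Rightarrow> (\<lambda>_ _. 0) | Some A \<Rightarrow> arr_of_mat A))\<rparr>"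

definition output_mat :: "nat \<Rightarrow> state \<Rightarrow> int mat option" where
  "output_mat n s =
     (if \<forall>i<n. \<forall>j<n. outp s i j \<noteq> None
      then Some (mat n n (\<lambda>(i, j). the (outp s i j))) else None)"

fun exec :: "nat \<Rightarrow> nat \<Rightarrow> black_box \<Rightarrow> instr \<Rightarrow> state \<Rightarrow> state pmf" where
  "exec p n orc (IZero x) s = return_pmf (set_ireg x 0 s)"
| "exec p n orc (ISucc x) s = return_pmf (set_ireg x (ireg s x + 1) s)"
| "exec p n orc (IPred x) s = return_pmf (set_ireg x (ireg s x - 1) s)"
| "exec p n orc (ICopy x y) s = return_pmf (set_ireg x (ireg s y) s)"
| "exec p n orc (ILoad x a y) s = return_pmf (set_ireg x (iarr s a (ireg s y)) s)"
| "exec p n orc (IStore a x y) s =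
     return_pmf (s\<lparr>iarr := (iarr s)(a := (iarr s a)(ireg s x := ireg s y))\<rparr>)"
| "exec p n orc (IFlip x) s = map_pmf (\<lambda>v. set_ireg x v s) (pmf_of_set {0, 1})"
| "exec p n orc (IOfF x u) s = return_pmf (set_ireg x (nat (get_loc s u)) s)"
| "exec p n orc (FOfI w x) s = return_pmf (set_loc w (int (ireg s x) mod int p) s)"
| "exec p n orc (FCopy w u) s = return_pmf (set_loc w (get_loc s u) s)"
| "exec p n orc (FAdd w u v) s = return_pmf (set_loc w ((get_loc s u + get_loc s v) mod int p) s)"
| "exec p n orc (FSub w u v) s = return_pmf (set_loc w ((get_loc s u - get_loc s v) mod int p) s)"
| "exec p n orc (FMul w u v) s = return_pmf (set_loc w ((get_loc s u * get_loc s v) mod int p) s)"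
| "exec p n orc (FInv w u) s = return_pmf (set_loc w (modular_inverse (int p) (get_loc s u)) s)"
| "exec p n orc (FRand w) s = map_pmf (\<lambda>v. set_loc w v s) (pmf_of_set {0..<int p})"
| "exec p n orc (Output x y u) s =
     return_pmf (s\<lparr>outp := (outp s)(ireg s x := (outp s (ireg s x))(ireg s y := Some (get_loc s u)))\<rparr>)"
| "exec p n orc (Call a b c) s =
     map_pmf (\<lambda>M. set_mat_arr c M s) (orc (get_mat n a s) (get_mat n b s))"

text \<open>The parameter \<open>tc\<close> is the cost charged for a black-box call.\<close>

fun cost :: "nat \<Rightarrow> instr \<Rightarrow> nat" where
  "cost tc (Call a b c) = tc"
| "cost tc _ = 1"

fun holds :: "guard \<Rightarrow> state \<Rightarrow> bool" where
  "holds (ILess x y) s = (ireg s x < ireg s y)"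
| "holds (FEq u v) s = (get_loc s u = get_loc s v)"
| "holds (GNot g) s = (\<not> holds g s)"

text \<open>
  A configuration consists of the commands that remain to be executed, the state, and the
  cost incurred so far; it is final when no command remains.
\<close>

type_synonym config = "com list \<times> state \<times> nat"

fun step :: "nat \<Rightarrow> nat \<Rightarrow> nat \<Rightarrow> black_box \<Rightarrow> config \<Rightarrow> config pmf" where
  "step p n tc orc ([], s, t) = return_pmf ([], s, t)"
| "step p n tc orc (Skip # cs, s, t) = return_pmf (cs, s, t)"
| "step p n tc orc (Do i # cs, s, t) = map_pmf (\<lambda>s'. (cs, s', t + cost tc i)) (exec p n orc i s)"
| "step p n tc orc (Seq c d # cs, s, t) = return_pmf (c # d # cs, s, t)"
| "step p n tc orc (Cond g c d # cs, s, t) =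
     return_pmf ((if holds g s then c else d) # cs, s, t + 1)"
| "step p n tc orc (While g c # cs, s, t) =
     return_pmf (if holds g s then c # While g c # cs else cs, s, t + 1)"

text \<open>
  The input matrices are in field arrays 0 and 1, and the numerical parameters \<open>xs\<close> in the first
  index registers.
\<close>

definition init_state :: "nat list \<Rightarrow> int mat \<Rightarrow> int mat \<Rightarrow> state" where
  "init_state xs A B =
     \<lparr>ireg = (\<lambda>x. if x < length xs then xs ! x else 0),
      iarr = (\<lambda>_ _. 0),
      farr = (\<lambda>_ _ _. 0)(0 := arr_of_mat A, 1 := arr_of_mat B),
      outp = (\<lambda>_ _. None)\<rparr>"

definition run :: "nat \<Rightarrow> nat \<Rightarrow> nat \<Rightarrow> black_box \<Rightarrow> com \<Rightarrow> state \<Rightarrow> nat \<Rightarrow> config pmf" where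
  "run p n tc orc c s N = ((\<lambda>D. bind_pmf D (step p n tc orc)) ^^ N) (return_pmf ([c], s, 0))"

text \<open>Worst case over all random choices (including those of the black box).\<close>

definition runs_in_time ::
  "nat \<Rightarrow> nat \<Rightarrow> nat \<Rightarrow> black_box \<Rightarrow> com \<Rightarrow> state \<Rightarrow> real \<Rightarrow> bool" where
  "runs_in_time p n tc orc c s \<tau> \<longleftrightarrow>
     (\<exists>N. \<forall>(cs, s', t) \<in> set_pmf (run p n tc orc c s N). cs = [] \<and> real t \<le> \<tau>)"

text \<open>
  Final configurations are fixed by \<open>step\<close>, so any sufficiently large number of steps gives the
  same distribution.  The definition is meaningful only for programs with \<open>runs_in_time\<close> for
  some bound.
\<close>

definition output_dist ::
  "nat \<Rightarrow> nat \<Rightarrow> nat \<Rightarrow> black_box \<Rightarrow> com \<Rightarrow> state \<Rightarrow> int mat option pmf" where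
  "output_dist p n tc orc c s =
     map_pmf (\<lambda>(cs, s', t). output_mat n s')
       (run p n tc orc c s
         (LEAST N. \<forall>(cs, s', t) \<in> set_pmf (run p n tc orc c s N). cs = []))"


section \<open>Average-case and worst-case algorithms for matrix multiplication\<close>

text \<open>For programs without black-box calls, the black box and its cost are irrelevant dummies.\<close>

definition no_box :: black_box where
  "no_box A B = return_pmf None"

definition alg_dist :: "nat \<Rightarrow> nat \<Rightarrow> com \<Rightarrow> black_box" where
  "alg_dist p n c A B = output_dist p n 0 no_box c (init_state [n, p] A B)"

definition average_case_mult :: "nat \<Rightarrow> nat \<Rightarrow> com \<Rightarrow> nat \<Rightarrow> real \<Rightarrow> bool" where
  "average_case_mult p n c \<tau> \<alpha> \<longleftrightarrow>
     call_free c \<and>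
     (\<forall>A \<in> Fp_mats p n. \<forall>B \<in> Fp_mats p n.
        runs_in_time p n 0 no_box c (init_state [n, p] A B) (real \<tau>)) \<and>
     measure_pmf.prob
       (do {
          A \<leftarrow> pmf_of_set (Fp_mats p n);
          B \<leftarrow> pmf_of_set (Fp_mats p n);
          M \<leftarrow> alg_dist p n c A B;
          return_pmf (M = Some (Fp_mult p A B))
        }) {True} \<ge> \<alpha>"

text \<open>
  The program \<open>c'\<close> may call \<open>c\<close>, at cost \<open>tc\<close> per call.  It receives the real parameters
  \<open>\<alpha>\<close> and \<open>\<delta>\<close> only through the integers obtained by rounding up \<open>1/\<alpha>\<close> and \<open>1/\<delta>\<close>.
\<close>

definition worst_case_mult ::
  "nat \<Rightarrow> nat \<Rightarrow> com \<Rightarrow> nat \<Rightarrow> com \<Rightarrow> real \<Rightarrow> real \<Rightarrow> real \<Rightarrow> bool" where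
  "worst_case_mult p n c tc c' \<alpha> \<delta> \<tau> \<longleftrightarrow>
     (\<forall>A \<in> Fp_mats p n. \<forall>B \<in> Fp_mats p n.
        let s = init_state [n, p, nat \<lceil>1 / \<alpha>\<rceil>, nat \<lceil>1 / \<delta>\<rceil>] A B in
          runs_in_time p n tc (alg_dist p n c) c' s \<tau> \<and>
          measure_pmf.prob (output_dist p n tc (alg_dist p n c) c' s) {Some (Fp_mult p A B)}
            \<ge> 1 - \<delta>)"

end

theory Submission
  imports Defs "HOL-Probability.Product_PMF"
begin

text \<open>
  One program serves both bounds; its overhead is polynomial in \<open>1/\<alpha>\<close>, with no dependence on \<open>p\<close>.
  Split the rows of \<open>A\<close> and the columns of \<open>B\<close> into \<open>K = O(log (1/(\<alpha>\<delta>)))\<close> groups of equal size; the fewer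
  than \<open>K\<close> remaining rows and columns are treated naively.  To multiply a row group \<open>x\<close> by a column group
  \<open>y\<close>, plant them as the \<open>i\<close>-th groups of two random matrices, call the black box, and verify its answer
  with Freivalds' test.

  Let \<open>H\<close> be the set of pairs \<open>(x, y)\<close> for which this succeeds with probability at most \<open>\<alpha>/(2K)\<close> at every
  position \<open>i\<close>.  The diagonal pairs of a random input are independent and uniform, so the black box
  succeeds on a random input with probability at most \<open>(1 - \<mu>(H))^K + K \<sqdot> \<alpha>/(2K)\<close>, and hence \<open>H\<close> has
  measure at most \<open>1/16\<close>.  A worst-case block product is the sum of four products of pairs that are
  individually uniform, obtained from \<open>x = x\<^sub>1 + x\<^sub>2\<close> and \<open>y = y\<^sub>1 + y\<^sub>2\<close> with random \<open>x\<^sub>1\<close>, \<open>y\<^sub>1\<close>; with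
  constant probability all four avoid \<open>H\<close>, and \<open>K\<close> repetitions suffice.
\<close>

section \<open>Coupling semantics of programs\<close>

text \<open>Groups keep the full inner dimension: \<open>x\<close> is \<open>m\<close> by
  \<open>n\<close> and \<open>y\<close> is \<open>n\<close> by \<open>m\<close>, so planting both at
  position \<open>i\<close> makes their product exactly the diagonal block \<open>(i, i)\<close> of
  the big product. The bound 1/16 comes from a union bound: a pair is lost with probability 1/16 for
  lying in \<open>H\<close> and at most 1/16 for bad luck in all repeated calls, and four such pairs
  lose at most 1/2. The good position of a pair is unknown, so all \<open>K\<close> positions are
  swept, \<open>K\<^sup>2 * \<lceil>1/\<alpha>\<rceil>\<close> times; the test recognises a success.
  The total is of order \<open>T * K\<^sup>7 / \<alpha>\<close>. As \<open>K\<close> is logarithmic,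
  \<open>K\<^sup>7\<close> is O(1/(\<alpha>\<delta>)), which gives
  \<open>O(T / (\<delta> * \<alpha>\<^sup>2))\<close>, below both stated bounds. Work of order
  \<open>n\<^sup>2\<close> is charged to the calls, since an algorithm that ever outputs a complete
  matrix needs \<open>n\<^sup>2\<close> steps. The machine can only increment and decrement indices.
  This is why \<open>K\<close>, the group size and the offsets are computed by counting, and why
  numbers of repetitions are realised as nested loops.\<close>

definition steps :: "nat \<Rightarrow> nat \<Rightarrow> nat \<Rightarrow> black_box \<Rightarrow> nat \<Rightarrow> config \<Rightarrow> config pmf" where
  "steps p n tc orc N cfg = ((\<lambda>D. bind_pmf D (step p n tc orc)) ^^ N) (return_pmf cfg)"

definition halted :: "config pmf \<Rightarrow> bool" where
  "halted D \<longleftrightarrow> (\<forall>x \<in> set_pmf D. fst x = [])"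

text \<open>\<open>run\<close> appends steps at the end, whereas inductions over programs split off
  the first one; pushing the iteration below the initial bind mediates between the two.\<close>

lemma funpow_bind_pmf:
  fixes f :: "'a \<Rightarrow> 'a pmf"
  shows "((\<lambda>D. bind_pmf D f) ^^ N) (bind_pmf D g) = bind_pmf D (\<lambda>x. ((\<lambda>D. bind_pmf D f) ^^ N) (g x))"
  by (induction N) (simp_all add: bind_assoc_pmf)

locale machine =
  fixes p n tc :: nat and orc :: black_box
  assumes p_pos: "0 < p" and finite_orc: "\<And>A B. finite (set_pmf (orc A B))"
begin

abbreviation st where "st \<equiv> step p n tc orc"
abbreviation rr where "rr \<equiv> steps p n tc orc"

lemma steps_0 [simp]: "rr 0 cfg = return_pmf cfg"
  by (simp add: steps_def)

lemma steps_Suc: "rr (Suc N) cfg = bind_pmf (st cfg) (rr N)"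
  using funpow_bind_pmf[of N st "st cfg" return_pmf]
  unfolding steps_def[abs_def] funpow_Suc_right
  by (simp add: bind_return_pmf' bind_return_pmf)

lemma steps_add: "rr (N + M) cfg = bind_pmf (rr N cfg) (rr M)"
  by (induction N arbitrary: cfg) (auto simp: steps_Suc bind_return_pmf bind_assoc_pmf intro!: bind_pmf_cong)

lemma step_halted: "fst x = [] \<Longrightarrow> st x = return_pmf x"
  by (cases x) auto

lemma steps_halted: "fst x = [] \<Longrightarrow> rr N x = return_pmf x"
  by (induction N) (simp_all add: steps_Suc step_halted bind_return_pmf)

lemma halted_stable: "halted (rr N cfg) \<Longrightarrow> N \<le> N' \<Longrightarrow> rr N' cfg = rr N cfg"
proof -
  assume h: "halted (rr N cfg)" and "N \<le> N'"
  then obtain k where "N' = N + k" using le_Suc_ex by blast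
  moreover have "bind_pmf (rr N cfg) (rr k) = bind_pmf (rr N cfg) return_pmf"
    using h by (intro bind_pmf_cong) (auto simp: halted_def steps_halted)
  ultimately show ?thesis by (simp add: steps_add bind_return_pmf')
qed

text \<open>Makes the number of steps at which a halted program is observed immaterial, so the least
  halting time in \<open>output_dist\<close> never has to be determined.\<close>

lemma halted_unique: "halted (rr N cfg) \<Longrightarrow> halted (rr N' cfg) \<Longrightarrow> rr N cfg = rr N' cfg"
  by (metis halted_stable nle_le)

text \<open>Programs cannot inspect the cost, so evaluation may always be taken to start at cost
  0.\<close>

lemma step_cost_shift:
  "st (cs, s, t + k) = map_pmf (\<lambda>(cs, s, t). (cs, s, t + k)) (st (cs, s, t))"
  by (cases "(p, n, tc, orc, (cs, s, t))" rule: step.cases) (auto simp: map_pmf_comp algebra_simps)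

lemma steps_cost_shift:
  "rr N (cs, s, t + k) = map_pmf (\<lambda>(cs, s, t). (cs, s, t + k)) (rr N (cs, s, t))"
proof (induction N arbitrary: cs s t)
  case (Suc N)
  have "bind_pmf (st (cs, s, t)) (\<lambda>x. rr N (case x of (cs, s, t) \<Rightarrow> (cs, s, t + k))) =
     bind_pmf (st (cs, s, t)) (\<lambda>x. map_pmf (\<lambda>(cs, s, t). (cs, s, t + k)) (rr N x))"
    by (intro bind_pmf_cong refl) (simp add: Suc split: prod.split)
  then show ?case
    unfolding steps_Suc step_cost_shift bind_map_pmf map_bind_pmf .
qed simp

lemma finite_exec: "0 < p \<Longrightarrow> finite (set_pmf (exec p n orc i s))"
  by (cases i) (auto simp: finite_orc set_pmf_of_set)

lemma finite_step: "finite (set_pmf (st cfg))"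
  by (cases "(p, n, tc, orc, cfg)" rule: step.cases) (auto simp: finite_exec p_pos)

text \<open>With finite support, the step bounds of the individual outcomes of a program have a
  maximum, which sequencing needs; it also makes the output distribution of the given algorithm an
  admissible black box.\<close>

lemma finite_rn: "finite (set_pmf (rr N cfg))"
  by (induction N arbitrary: cfg) (auto simp: steps_Suc finite_step)

lemma step_append: "ds \<noteq> [] \<Longrightarrow> st (ds @ cs, s, t) = map_pmf (\<lambda>(ds, s, t). (ds @ cs, s, t)) (st (ds, s, t))"
  by (cases "(p, n, tc, orc, (ds, s, t))" rule: step.cases) (auto simp: map_pmf_comp)

text \<open>Branches of \<open>ds\<close> may halt at different times, so \<open>cs\<close> starts
  late on some and early on others. As halted configurations are fixed points, the common count
  \<open>N + M\<close> serves all of them.\<close>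

lemma steps_append:
  assumes "halted (rr N (ds, s, t))"
    and "\<And>ds' s' t'. (ds', s', t') \<in> set_pmf (rr N (ds, s, t)) \<Longrightarrow> halted (rr M (cs, s', t'))"
  shows "rr (N + M) (ds @ cs, s, t) = bind_pmf (rr N (ds, s, t)) (\<lambda>(_, s', t'). rr M (cs, s', t'))"
  using assms
proof (induction N arbitrary: ds s t)
  case 0
  then show ?case by (simp add: halted_def bind_return_pmf)
next
  case (Suc N)
  show ?case
  proof (cases "ds = []")
    case True
    then have "halted (rr M (cs, s, t))"
      using Suc.prems(2)[of "[]" s t] steps_halted[of "([], s, t)" "Suc N"] by simp
    then have "rr (Suc N + M) (cs, s, t) = rr M (cs, s, t)"
      by (rule halted_stable) simp
    then show ?thesis
      using True steps_halted[of "([], s, t)" "Suc N"] by (simp add: bind_return_pmf)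
  next
    case False
    have "rr (Suc N + M) (ds @ cs, s, t)
        = bind_pmf (st (ds, s, t)) (\<lambda>(ds', s', t'). rr (N + M) (ds' @ cs, s', t'))"
      by (simp add: steps_Suc step_append[OF False] bind_map_pmf case_prod_unfold)
    also have "\<dots> = bind_pmf (st (ds, s, t)) (\<lambda>x. bind_pmf (rr N x) (\<lambda>(_, s', t'). rr M (cs, s', t')))"
    proof (intro bind_pmf_cong refl, clarify)
      fix ds' s' t' assume x: "(ds', s', t') \<in> set_pmf (st (ds, s, t))"
      show "rr (N + M) (ds' @ cs, s', t')
          = bind_pmf (rr N (ds', s', t')) (\<lambda>(_, s', t'). rr M (cs, s', t'))"
        using Suc.prems x by (intro Suc.IH) (force simp: halted_def steps_Suc)+
    qed
    finally show ?thesis unfolding steps_Suc[of N] bind_assoc_pmf .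
  qed
qed

definition evalb :: "nat \<Rightarrow> com list \<Rightarrow> state \<Rightarrow> (state \<times> nat) pmf \<Rightarrow> bool" where
  "evalb M cs s D \<longleftrightarrow> rr M (cs, s, 0) = map_pmf (Pair []) D"

lemma evalb_halted: "evalb M cs s D \<Longrightarrow> halted (rr M (cs, s, 0))"
  by (auto simp: evalb_def halted_def)

lemma evalb_unique:
  assumes "evalb M cs s D" "evalb M' cs s D'"
  shows "D = D'"
proof -
  have "map_pmf (Pair ([] :: com list)) D = map_pmf (Pair []) D'"
    using halted_unique[OF assms[THEN evalb_halted]] assms unfolding evalb_def by metis
  then have "map_pmf snd (map_pmf (Pair ([] :: com list)) D) = map_pmf snd (map_pmf (Pair ([] :: com list)) D')"
    by simp
  then show ?thesis by (simp add: map_pmf_comp)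
qed

lemma evalb_mono: "evalb M cs s D \<Longrightarrow> M \<le> M' \<Longrightarrow> evalb M' cs s D"
  using evalb_halted[of M cs s D] halted_stable[of M "(cs, s, 0)" M'] by (simp add: evalb_def)

lemma evalb_shift: "evalb M cs s D \<Longrightarrow> rr M (cs, s, t) = map_pmf (\<lambda>(s', t'). ([], s', t' + t)) D"
  using steps_cost_shift[of M cs s 0 t]
  by (simp add: evalb_def map_pmf_comp case_prod_unfold)

lemma evalb_append:
  assumes "evalb N ds s D" and "\<And>s' t'. (s', t') \<in> set_pmf D \<Longrightarrow> evalb M cs s' (E s')"
  shows "evalb (N + M) (ds @ cs) s
     (bind_pmf D (\<lambda>(s', t'). map_pmf (\<lambda>(s'', t''). (s'', t'' + t')) (E s')))"
proof -
  have "rr (N + M) (ds @ cs, s, 0) = bind_pmf (rr N (ds, s, 0)) (\<lambda>(_, s', t'). rr M (cs, s', t'))"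
  proof (rule steps_append)
    show "halted (rr N (ds, s, 0))" using assms(1) by (rule evalb_halted)
    fix ds' s' t' assume "(ds', s', t') \<in> set_pmf (rr N (ds, s, 0))"
    then have "(s', t') \<in> set_pmf D" using assms(1) by (auto simp: evalb_def)
    then have "evalb M cs s' (E s')" by (rule assms(2))
    then show "halted (rr M (cs, s', t'))"
      by (auto simp: halted_def evalb_shift)
  qed
  also have "\<dots> = bind_pmf D (\<lambda>(s', t'). map_pmf (\<lambda>(s'', t''). ([], s'', t'' + t')) (E s'))"
    using assms(1) unfolding evalb_def
    by (auto simp: bind_map_pmf evalb_shift[OF assms(2)] intro!: bind_pmf_cong)
  finally show ?thesis
    by (simp add: evalb_def map_bind_pmf map_pmf_comp case_prod_unfold)
qed

text \<open>
  A program is related to an abstract random value \<open>\<mu>\<close> by a coupling with its final state, so that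
  probabilities are only ever computed for \<open>\<mu>\<close>; the cost bound holds for every run.
\<close>

definition sim :: "com \<Rightarrow> state \<Rightarrow> nat \<Rightarrow> 'a pmf \<Rightarrow> ('a \<Rightarrow> state \<Rightarrow> bool) \<Rightarrow> bool" where
  "sim c s \<tau> \<mu> R \<longleftrightarrow> (\<exists>M D. evalb M [c] s D \<and> (\<forall>(s', t) \<in> set_pmf D. t \<le> \<tau>) \<and>
      rel_pmf R \<mu> (map_pmf fst D))"

lemma evalb_finite: "evalb M cs s D \<Longrightarrow> finite (set_pmf D)"
proof -
  assume "evalb M cs s D"
  then have "finite (Pair ([]::com list) ` set_pmf D)"
    using finite_rn[of M "(cs, s, 0)"] unfolding evalb_def by simp
  then show ?thesis by (rule finite_imageD) (auto intro: inj_onI)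
qed

lemma sim_mono:
  assumes "sim c s \<tau> \<mu> R" "\<tau> \<le> \<tau>'" "\<And>x s'. x \<in> set_pmf \<mu> \<Longrightarrow> R x s' \<Longrightarrow> R' x s'"
  shows "sim c s \<tau>' \<mu> R'"
proof -
  obtain M D where D: "evalb M [c] s D" "\<forall>(s', t) \<in> set_pmf D. t \<le> \<tau>" "rel_pmf R \<mu> (map_pmf fst D)"
    using assms(1) unfolding sim_def by blast
  have "rel_pmf R' \<mu> (map_pmf fst D)"
    using D(3) by (rule pmf.rel_mono_strong) (use assms(3) in blast)
  then show ?thesis
    unfolding sim_def using D(1,2) assms(2) by (intro exI[of _ M] exI[of _ D]) fastforce
qed

lemma sim_Skip: "R x s \<Longrightarrow> sim Skip s 0 (return_pmf x) R"
  unfolding sim_def evalb_def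
  by (rule exI[of _ 1], rule exI[of _ "return_pmf (s, 0)"])
    (simp add: steps_Suc bind_return_pmf)

lemma sim_Do:
  assumes "rel_pmf R \<mu> (exec p n orc i s)"
  shows "sim (Do i) s (cost tc i) \<mu> R"
proof -
  let ?D = "map_pmf (\<lambda>s'. (s', cost tc i)) (exec p n orc i s)"
  have "rr 1 ([Do i], s, 0) = map_pmf (Pair []) ?D"
    unfolding One_nat_def steps_Suc
    by (simp add: map_pmf_comp bind_return_pmf' steps_def[abs_def])
  then have "evalb 1 [Do i] s ?D" by (simp add: evalb_def)
  moreover have "rel_pmf R \<mu> (map_pmf fst ?D)" using assms by (simp add: map_pmf_comp)
  ultimately show ?thesis unfolding sim_def by fastforce
qed

end

text \<open>The abstract counterpart of a counting loop: \<open>sim_For\<close> relates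
  \<open>For\<close> to it.\<close>

fun foldM :: "('k \<Rightarrow> 'a \<Rightarrow> 'a pmf) \<Rightarrow> 'k list \<Rightarrow> 'a \<Rightarrow> 'a pmf" where
  "foldM f [] x = return_pmf x"
| "foldM f (k # ks) x = bind_pmf (f k x) (foldM f ks)"

lemma foldM_append: "foldM f (ks @ ls) x = bind_pmf (foldM f ks x) (foldM f ls)"
  by (induction ks arbitrary: x) (auto simp: bind_return_pmf bind_assoc_pmf intro!: bind_pmf_cong)

lemma foldM_return: "foldM (\<lambda>_. return_pmf) ks x = return_pmf x"
  by (induction ks) (simp_all add: bind_return_pmf)

lemma rel_pmf_conj_set:
  assumes "rel_pmf R \<mu> \<nu>" and "\<And>y. y \<in> set_pmf \<nu> \<Longrightarrow> P y"
  shows "rel_pmf (\<lambda>x y. R x y \<and> P y) \<mu> \<nu>"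
  using assms(1) by (rule pmf.rel_mono_strong) (use assms(2) in blast)

text \<open>Gives every reachable state an abstract partner, so that premises stated for related
  pairs apply to it.\<close>

lemma rel_pmf_witness:
  assumes "rel_pmf R \<mu> \<nu>" "y \<in> set_pmf \<nu>"
  obtains x where "x \<in> set_pmf \<mu>" "R x y"
  using assms rel_pmf_imp_rel_set[of R \<mu> \<nu>] unfolding rel_set_def
  by (metis rel_setD2 rel_pmf_imp_rel_set)

section \<open>Write sets of programs\<close>

fun loc_arr :: "loc \<Rightarrow> nat" where
  "loc_arr (a, i, j) = a"

fun wreg1 :: "instr \<Rightarrow> nat set" where
  "wreg1 (IZero x) = {x}"
| "wreg1 (ISucc x) = {x}"
| "wreg1 (IPred x) = {x}"
| "wreg1 (ICopy x y) = {x}"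
| "wreg1 (ILoad x a y) = {x}"
| "wreg1 (IFlip x) = {x}"
| "wreg1 (IOfF x u) = {x}"
| "wreg1 _ = {}"

fun wfar1 :: "instr \<Rightarrow> nat set" where
  "wfar1 (FOfI w x) = {loc_arr w}"
| "wfar1 (FCopy w u) = {loc_arr w}"
| "wfar1 (FAdd w u v) = {loc_arr w}"
| "wfar1 (FSub w u v) = {loc_arr w}"
| "wfar1 (FMul w u v) = {loc_arr w}"
| "wfar1 (FInv w u) = {loc_arr w}"
| "wfar1 (FRand w) = {loc_arr w}"
| "wfar1 (Call a b c) = {c}"
| "wfar1 _ = {}"

fun wiar1 :: "instr \<Rightarrow> nat set" where
  "wiar1 (IStore a x y) = {a}"
| "wiar1 _ = {}"

fun wreg :: "com \<Rightarrow> nat set" where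
  "wreg Skip = {}"
| "wreg (Do i) = wreg1 i"
| "wreg (Seq c d) = wreg c \<union> wreg d"
| "wreg (Cond g c d) = wreg c \<union> wreg d"
| "wreg (While g c) = wreg c"

fun wfar :: "com \<Rightarrow> nat set" where
  "wfar Skip = {}"
| "wfar (Do i) = wfar1 i"
| "wfar (Seq c d) = wfar c \<union> wfar d"
| "wfar (Cond g c d) = wfar c \<union> wfar d"
| "wfar (While g c) = wfar c"

fun wiar :: "com \<Rightarrow> nat set" where
  "wiar Skip = {}"
| "wiar (Do i) = wiar1 i"
| "wiar (Seq c d) = wiar c \<union> wiar d"
| "wiar (Cond g c d) = wiar c \<union> wiar d"
| "wiar (While g c) = wiar c"

text \<open>Write sets are syntactic, so facts about untouched memory come from the text of a
  subprogram and need not be threaded through postconditions. The output area is not tracked: only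
  the final printing loop writes to it.\<close>

definition frame :: "nat set \<Rightarrow> nat set \<Rightarrow> nat set \<Rightarrow> state \<Rightarrow> state \<Rightarrow> bool" where
  "frame X F J s s' \<longleftrightarrow> (\<forall>x. x \<notin> X \<longrightarrow> ireg s' x = ireg s x) \<and>
     (\<forall>a. a \<notin> F \<longrightarrow> farr s' a = farr s a) \<and> (\<forall>a. a \<notin> J \<longrightarrow> iarr s' a = iarr s a)"

abbreviation keeps :: "com \<Rightarrow> state \<Rightarrow> state \<Rightarrow> bool" where
  "keeps c \<equiv> frame (wreg c) (wfar c) (wiar c)"

lemma frame_refl [simp]: "frame X F J s s"
  by (simp add: frame_def)

lemma frame_trans: "frame X F J s s' \<Longrightarrow> frame X F J s' s'' \<Longrightarrow> frame X F J s s''"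
  by (simp add: frame_def)

lemma frame_mono: "frame X F J s s' \<Longrightarrow> X \<subseteq> X' \<Longrightarrow> F \<subseteq> F' \<Longrightarrow> J \<subseteq> J' \<Longrightarrow> frame X' F' J' s s'"
  by (auto simp: frame_def)

lemma frame_ireg: "frame X F J s s' \<Longrightarrow> x \<notin> X \<Longrightarrow> ireg s' x = ireg s x"
  and frame_farr: "frame X F J s s' \<Longrightarrow> a \<notin> F \<Longrightarrow> farr s' a = farr s a"
  and frame_iarr: "frame X F J s s' \<Longrightarrow> a \<notin> J \<Longrightarrow> iarr s' a = iarr s a"
  by (auto simp: frame_def)

context machine
begin

lemma exec_frame: "s' \<in> set_pmf (exec p n orc i s) \<Longrightarrow> frame (wreg1 i) (wfar1 i) (wiar1 i) s s'"
  by (cases i) (auto simp: frame_def set_ireg_def set_mat_arr_def)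

abbreviation wregs where "wregs cs \<equiv> \<Union>(wreg ` set cs)"
abbreviation wfars where "wfars cs \<equiv> \<Union>(wfar ` set cs)"
abbreviation wiars where "wiars cs \<equiv> \<Union>(wiar ` set cs)"

text \<open>The inclusions carry the induction over steps: unfolding a \<open>Seq\<close>,
  \<open>Cond\<close> or \<open>While\<close> never enlarges the write set of what remains.\<close>

lemma step_frame:
  assumes "(cs', s', t') \<in> set_pmf (st (cs, s, t))"
  shows "frame (wregs cs) (wfars cs) (wiars cs) s s' \<and>
     wregs cs' \<subseteq> wregs cs \<and> wfars cs' \<subseteq> wfars cs \<and> wiars cs' \<subseteq> wiars cs"
proof (cases cs)
  case Nil
  then show ?thesis using assms by simp
next
  case (Cons e es)
  show ?thesis
  proof (cases e)
    case (Do i)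
    then have "s' \<in> set_pmf (exec p n orc i s)" "cs' = es"
      using assms Cons by auto
    from frame_mono[OF exec_frame[OF this(1)]] show ?thesis
      using \<open>cs' = es\<close> Cons Do by auto
  qed (use assms Cons in \<open>auto split: if_splits\<close>)
qed

lemma steps_frame:
  "(cs', s', t') \<in> set_pmf (rr N (cs, s, t)) \<Longrightarrow> frame (wregs cs) (wfars cs) (wiars cs) s s'"
proof (induction N arbitrary: cs s t)
  case (Suc N)
  then obtain ds u v where 1: "(ds, u, v) \<in> set_pmf (st (cs, s, t))"
    and 2: "(cs', s', t') \<in> set_pmf (rr N (ds, u, v))"
    by (auto simp: steps_Suc)
  from step_frame[OF 1] frame_mono[OF Suc.IH[OF 2]] show ?case
    by (meson frame_trans)
qed simp

text \<open>Each subroutine is proved with its functional postcondition alone; the frame condition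
  is added where the subroutine is used.\<close>

lemma sim_frame:
  assumes "sim c s \<tau> \<mu> R"
  shows "sim c s \<tau> \<mu> (\<lambda>x s'. R x s' \<and> keeps c s s')"
proof -
  obtain M D where D: "evalb M [c] s D" "\<forall>(s', t) \<in> set_pmf D. t \<le> \<tau>" "rel_pmf R \<mu> (map_pmf fst D)"
    using assms unfolding sim_def by blast
  have "keeps c s s'" if "s' \<in> set_pmf (map_pmf fst D)" for s'
  proof -
    obtain t where "(s', t) \<in> set_pmf D" using \<open>s' \<in> _\<close> by auto
    then have "([], s', t) \<in> set_pmf (rr M ([c], s, 0))"
      using D(1) by (auto simp: evalb_def)
    from steps_frame[OF this] show ?thesis by simp
  qed
  then have "rel_pmf (\<lambda>x s'. R x s' \<and> keeps c s s') \<mu> (map_pmf fst D)"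
    using D(3) by (intro rel_pmf_conj_set)
  then show ?thesis unfolding sim_def using D(1,2) by blast
qed

section \<open>Composition rules for simulations\<close>

lemma evalb_prepend:
  assumes "st ([c], s, 0) = return_pmf (cs, s, k)" "evalb N cs s D"
  shows "evalb (Suc N) [c] s (map_pmf (\<lambda>(s, t). (s, t + k)) D)"
  using assms(1) evalb_shift[OF assms(2), of k]
  by (simp add: evalb_def steps_Suc bind_return_pmf map_pmf_comp case_prod_unfold)

lemma sim_prepend1:
  assumes "st ([c], s, 0) = return_pmf ([d], s, k)" "sim d s \<tau> \<mu> R"
  shows "sim c s (\<tau> + k) \<mu> R"
proof -
  obtain M D where D: "evalb M [d] s D" "\<forall>(s', t) \<in> set_pmf D. t \<le> \<tau>" "rel_pmf R \<mu> (map_pmf fst D)"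
    using assms(2) unfolding sim_def by blast
  show ?thesis
    unfolding sim_def
    by (rule exI, rule exI, rule conjI[OF evalb_prepend[OF assms(1) D(1)]])
      (use D(2,3) in \<open>auto simp: map_pmf_comp case_prod_unfold\<close>)
qed

lemma sim_Cond:
  assumes "sim (if holds g s then c else d) s \<tau> \<mu> R"
  shows "sim (Cond g c d) s (\<tau> + 1) \<mu> R"
  by (rule sim_prepend1[OF _ assms]) simp

text \<open>Common core of sequencing (\<open>k = 0\<close>) and of entering a loop body
  (\<open>k = 1\<close>): one deterministic step turns \<open>e\<close> into \<open>c\<close>
  followed by \<open>d\<close>.\<close>

lemma sim_prepend2:
  assumes "st ([e], s, 0) = return_pmf ([c, d], s, k)"
    and c: "sim c s \<tau>1 \<mu> R"
    and d: "\<And>x s'. x \<in> set_pmf \<mu> \<Longrightarrow> R x s' \<Longrightarrow> sim d s' \<tau>2 (\<nu> x) R'"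
  shows "sim e s (\<tau>1 + \<tau>2 + k) (bind_pmf \<mu> \<nu>) R'"
proof -
  obtain M D where D: "evalb M [c] s D" "\<forall>(s', t) \<in> set_pmf D. t \<le> \<tau>1" "rel_pmf R \<mu> (map_pmf fst D)"
    using c unfolding sim_def by blast
  have "\<exists>N E. evalb N [d] s' E \<and> (\<forall>(s', t) \<in> set_pmf E. t \<le> \<tau>2)"
    if "s' \<in> fst ` set_pmf D" for s'
  proof -
    from that have "s' \<in> set_pmf (map_pmf fst D)" by simp
    with D(3) obtain x where "x \<in> set_pmf \<mu>" "R x s'"
      by (rule rel_pmf_witness)
    from d[OF this] show ?thesis unfolding sim_def by blast
  qed
  then obtain NN E where E: "\<And>s'. s' \<in> fst ` set_pmf D \<Longrightarrow>
      evalb (NN s') [d] s' (E s') \<and> (\<forall>(s', t) \<in> set_pmf (E s'). t \<le> \<tau>2)"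
    by metis
  \<comment> \<open>Every intermediate state has its own step bound; finiteness of the support
    allows the maximum, after which shorter runs simply idle.\<close>
  define N where "N = Max (insert 0 (NN ` fst ` set_pmf D))"
  have fin: "finite (set_pmf D)" using D(1) by (rule evalb_finite)
  have EN: "evalb N [d] s' (E s')" if "(s', t) \<in> set_pmf D" for s' t
  proof -
    have s': "s' \<in> fst ` set_pmf D" using that by force
    then have "NN s' \<le> N" using fin unfolding N_def by (intro Max_ge) auto
    with E[OF s'] show ?thesis using evalb_mono by blast
  qed
  let ?B = "bind_pmf D (\<lambda>(s', t'). map_pmf (\<lambda>(s'', t''). (s'', t'' + t')) (E s'))"
  have 1: "evalb (M + N) ([c] @ [d]) s ?B"
    using D(1) EN by (rule evalb_append)
  then have 2: "evalb (Suc (M + N)) [e] s (map_pmf (\<lambda>(s, t). (s, t + k)) ?B)"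
    using assms(1) by (intro evalb_prepend) auto
  have 3: "\<forall>(s', t) \<in> set_pmf (map_pmf (\<lambda>(s, t). (s, t + k)) ?B). t \<le> \<tau>1 + \<tau>2 + k"
  proof (clarsimp)
    fix s' t s'' t'
    assume a: "(s'', t') \<in> set_pmf D" "(s', t) \<in> set_pmf (E s'')"
    then have "s'' \<in> fst ` set_pmf D" by force
    then have "t \<le> \<tau>2" "t' \<le> \<tau>1" using E a D(2) by fastforce+
    then show "t + t' \<le> \<tau>1 + \<tau>2" by simp
  qed
  have "rel_pmf R' (bind_pmf \<mu> \<nu>) (bind_pmf (map_pmf fst D) (\<lambda>s'. map_pmf fst (E s')))"
  proof (rule rel_pmf_bindI)
    show "rel_pmf (\<lambda>x s'. (R x s' \<and> x \<in> set_pmf \<mu>) \<and> s' \<in> fst ` set_pmf D) \<mu> (map_pmf fst D)"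
      by (rule pmf.rel_mono_strong[OF D(3)]) auto
    fix x s' assume a: "(R x s' \<and> x \<in> set_pmf \<mu>) \<and> s' \<in> fst ` set_pmf D"
    then obtain N' E' where e: "evalb N' [d] s' E'" "rel_pmf R' (\<nu> x) (map_pmf fst E')"
      using d[of x s'] unfolding sim_def by blast
    \<comment> \<open>The coupling for \<open>d\<close> was obtained from the abstract value
      \<open>x\<close>, but the distribution of final states depends on \<open>s'\<close>
      only.\<close>
    with E[of s'] a have "E' = E s'" using evalb_unique by blast
    with e show "rel_pmf R' (\<nu> x) (map_pmf fst (E s'))" by simp
  qed
  also have "bind_pmf (map_pmf fst D) (\<lambda>s'. map_pmf fst (E s'))
      = map_pmf fst (map_pmf (\<lambda>(s, t). (s, t + k)) ?B)"
    by (simp add: map_bind_pmf bind_map_pmf map_pmf_comp case_prod_unfold)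
  finally show ?thesis using 2 3 unfolding sim_def by blast
qed

lemma sim_Seq:
  assumes "sim c s \<tau>1 \<mu> R"
    and "\<And>x s'. x \<in> set_pmf \<mu> \<Longrightarrow> R x s' \<Longrightarrow> sim d s' \<tau>2 (\<nu> x) R'"
  shows "sim (Seq c d) s (\<tau>1 + \<tau>2) (bind_pmf \<mu> \<nu>) R'"
  using sim_prepend2[OF _ assms, of "Seq c d" 0] by simp

lemma sim_Seq_det:
  assumes "sim c s \<tau>1 (return_pmf ()) (\<lambda>_. Q)"
    and "\<And>s'. Q s' \<Longrightarrow> sim d s' \<tau>2 \<mu> R"
  shows "sim (Seq c d) s (\<tau>1 + \<tau>2) \<mu> R"
  using sim_Seq[of c s \<tau>1 "return_pmf ()" "\<lambda>_. Q" d \<tau>2 "\<lambda>_. \<mu>" R] assms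
  by (simp add: bind_return_pmf)

lemma sim_Seq_ret:
  assumes "sim c s \<tau>1 \<mu> R"
    and "\<And>x s'. x \<in> set_pmf \<mu> \<Longrightarrow> R x s' \<Longrightarrow> sim d s' \<tau>2 (return_pmf x) R'"
  shows "sim (Seq c d) s (\<tau>1 + \<tau>2) \<mu> R'"
  using sim_Seq[of c s \<tau>1 \<mu> R d \<tau>2 return_pmf R'] assms
  by (simp add: bind_return_pmf')

lemma sim_Do_det:
  assumes "exec p n orc i s = return_pmf s'" "cost tc i = 1" "R x s'"
  shows "sim (Do i) s 1 (return_pmf x) R"
  using sim_Do[of R "return_pmf x" i s] assms by simp

lemma sim_Do_Seq:
  assumes "exec p n orc i s = return_pmf s'" "cost tc i = 1" "sim d s' \<tau> \<mu> R"
  shows "sim (Seq (Do i) d) s (\<tau> + 1) \<mu> R"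
  using sim_Seq_det[OF sim_Do_det[OF assms(1,2), of "\<lambda>_ s''. s'' = s'" "()"], of d \<tau> \<mu> R] assms(3) by simp

lemma sim_While_False:
  assumes "\<not> holds g s" "R x s"
  shows "sim (While g c) s 1 (return_pmf x) R"
  unfolding sim_def evalb_def
  by (rule exI[of _ 1], rule exI[of _ "return_pmf (s, 1)"])
    (use assms in \<open>simp add: steps_Suc bind_return_pmf\<close>)

lemma sim_While_True:
  assumes "holds g s" and "sim c s \<tau>1 \<mu> R"
    and "\<And>x s'. x \<in> set_pmf \<mu> \<Longrightarrow> R x s' \<Longrightarrow> sim (While g c) s' \<tau>2 (\<nu> x) R'"
  shows "sim (While g c) s (\<tau>1 + \<tau>2 + 1) (bind_pmf \<mu> \<nu>) R'"
  using sim_prepend2[OF _ assms(2,3), of "While g c" 1] assms(1) by simp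

text \<open>In the invariant, \<open>k\<close> bounds the cost of the remaining iterations.\<close>

lemma sim_While_det:
  assumes "I k s"
    and "\<And>k s. I k s \<Longrightarrow> holds g s \<Longrightarrow>
      \<exists>\<tau> k'. sim c s \<tau> (return_pmf ()) (\<lambda>_. I k') \<and> k' + \<tau> + 1 \<le> k"
    and "\<And>k s. I k s \<Longrightarrow> \<not> holds g s \<Longrightarrow> 1 \<le> k \<and> Q s"
  shows "sim (While g c) s k (return_pmf ()) (\<lambda>_. Q)"
  using assms(1)
proof (induction k arbitrary: s rule: less_induct)
  case (less k)
  show ?case
  proof (cases "holds g s")
    case True
    then obtain \<tau> k' where "sim c s \<tau> (return_pmf ()) (\<lambda>_. I k')" "k' + \<tau> + 1 \<le> k"
      using assms(2) less.prems by blast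
    then have "sim (While g c) s (\<tau> + k' + 1) (bind_pmf (return_pmf ()) (\<lambda>_. return_pmf ())) (\<lambda>_. Q)"
      using True less.IH by (intro sim_While_True[where R="\<lambda>_. I k'"]) auto
    then show ?thesis
      using \<open>k' + \<tau> + 1 \<le> k\<close> by (auto simp: bind_return_pmf elim: sim_mono)
  next
    case False
    then show ?thesis
      using assms(3)[OF less.prems False] sim_While_False[OF False, of "\<lambda>_. Q" "()" c]
      by (auto elim: sim_mono)
  qed
qed

end

section \<open>Counting loops, from zero or from the current value of the counter\<close>

definition ForL :: "nat \<Rightarrow> nat \<Rightarrow> com \<Rightarrow> com" where
  "ForL x y c = While (ILess x y) (Seq c (Do (ISucc x)))"

definition For :: "nat \<Rightarrow> nat \<Rightarrow> com \<Rightarrow> com" where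
  "For x y c = Seq (Do (IZero x)) (ForL x y c)"

lemma write_sets_For [simp]:
  "wreg (ForL x y c) = insert x (wreg c)" "wreg (For x y c) = insert x (wreg c)"
  "wfar (ForL x y c) = wfar c" "wfar (For x y c) = wfar c"
  "wiar (ForL x y c) = wiar c" "wiar (For x y c) = wiar c"
  by (auto simp: ForL_def For_def)

lemma set_ireg_simps [simp]:
  "ireg (set_ireg x v s) = (ireg s)(x := v)" "iarr (set_ireg x v s) = iarr s"
  "farr (set_ireg x v s) = farr s" "outp (set_ireg x v s) = outp s"
  by (simp_all add: set_ireg_def)

lemma frame_set_ireg: "frame X F J s s' \<Longrightarrow> x \<in> X \<Longrightarrow> frame X F J s (set_ireg x v s')"
  and frame_set_ireg': "frame X F J (set_ireg x v s) s' \<Longrightarrow> x \<in> X \<Longrightarrow> frame X F J s s'"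
  by (auto simp: frame_def)

context machine
begin

text \<open>Induction on the number \<open>b - j\<close> of remaining rounds. The body establishes
  \<open>R (Suc j)\<close> before the counter is incremented, hence the premise that
  \<open>R\<close> ignores the counter; its value, and everything untouched since the start of the
  loop, reach the body as separate facts. A round costs \<open>\<tau>\<close> plus guard and
  increment, and the failing guard adds 1.\<close>

lemma sim_ForL:
  assumes xy: "x \<noteq> y" "x \<notin> wreg c" "y \<notin> wreg c"
    and "ireg s x = k" "ireg s y = b" "k \<le> b" "R k v s"
    and insens: "\<And>j v s u. R j v s \<Longrightarrow> R j v (set_ireg x u s)"
    and body: "\<And>j v s'. k \<le> j \<Longrightarrow> j < b \<Longrightarrow> R j v s' \<Longrightarrow> ireg s' x = j \<Longrightarrow> ireg s' y = b \<Longrightarrow>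
      keeps (ForL x y c) s s' \<Longrightarrow> sim c s' \<tau> (f j v) (R (Suc j))"
  shows "sim (ForL x y c) s ((\<tau> + 2) * (b - k) + 1) (foldM f [k..<b] v) (R b)"
proof -
  have "sim (ForL x y c) s' ((\<tau> + 2) * (b - j) + 1) (foldM f [j..<b] v) (R b)"
    if "k \<le> j" "j \<le> b" "R j v s'" "ireg s' x = j" "ireg s' y = b" "keeps (ForL x y c) s s'" for j v s'
    using that
  proof (induction "b - j" arbitrary: j v s')
    case 0
    then show ?case
      unfolding ForL_def using sim_While_False[of "ILess x y" s' "R b" v "Seq c (Do (ISucc x))"] by simp
  next
    case (Suc d)
    then have jb: "j < b" by simp
    have 1: "sim c s' \<tau> (f j v) (\<lambda>v' s''. R (Suc j) v' s'' \<and> keeps c s' s'')"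
      using Suc jb by (intro sim_frame body) auto
    have "sim (Seq c (Do (ISucc x))) s' (\<tau> + 1) (f j v)
       (\<lambda>v' s''. R (Suc j) v' s'' \<and> ireg s'' x = Suc j \<and> ireg s'' y = b \<and> keeps (ForL x y c) s s'')"
    proof (rule sim_Seq_ret[OF 1])
      fix v' s''
      assume a: "R (Suc j) v' s'' \<and> keeps c s' s''"
      then have "ireg s'' x = j" "ireg s'' y = b"
        using Suc.prems xy frame_ireg by metis+
      moreover have "keeps (ForL x y c) s s''"
        using a Suc.prems(6) by (auto intro: frame_trans frame_mono)
      ultimately show "sim (Do (ISucc x)) s'' 1 (return_pmf v')
        (\<lambda>v' s''. R (Suc j) v' s'' \<and> ireg s'' x = Suc j \<and> ireg s'' y = b \<and> keeps (ForL x y c) s s'')"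
        using a xy insens by (intro sim_Do_det) (auto intro: frame_set_ireg)
    qed
    then have "sim (ForL x y c) s' ((\<tau> + 1) + ((\<tau> + 2) * (b - Suc j) + 1) + 1)
        (bind_pmf (f j v) (foldM f [Suc j..<b])) (R b)"
      unfolding ForL_def
    proof (rule sim_While_True[rotated])
      show "holds (ILess x y) s'" using Suc.prems jb by simp
    next
      fix v' s''
      assume "R (Suc j) v' s'' \<and> ireg s'' x = Suc j \<and> ireg s'' y = b \<and>
        keeps (While (ILess x y) (Seq c (Do (ISucc x)))) s s''"
      then show "sim (While (ILess x y) (Seq c (Do (ISucc x)))) s'' ((\<tau> + 2) * (b - Suc j) + 1)
          (foldM f [Suc j..<b] v') (R b)"
        using Suc.hyps jb Suc.prems unfolding ForL_def[symmetric] by (intro Suc.hyps(1)) auto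
    qed
    moreover have "(\<tau> + 1) + ((\<tau> + 2) * (b - Suc j) + 1) + 1 = (\<tau> + 2) * (b - j) + 1"
      using jb by (simp add: Suc_diff_Suc[symmetric])
    ultimately show ?case
      using jb by (simp add: upt_conv_Cons)
  qed
  then show ?thesis using assms by auto
qed

lemma sim_For:
  assumes xy: "x \<noteq> y" "x \<notin> wreg c" "y \<notin> wreg c"
    and "ireg s y = b" "R 0 v s"
    and insens: "\<And>j v s u. R j v s \<Longrightarrow> R j v (set_ireg x u s)"
    and body: "\<And>j v s'. j < b \<Longrightarrow> R j v s' \<Longrightarrow> ireg s' x = j \<Longrightarrow> ireg s' y = b \<Longrightarrow>
      keeps (For x y c) s s' \<Longrightarrow> sim c s' \<tau> (f j v) (R (Suc j))"
  shows "sim (For x y c) s ((\<tau> + 2) * b + 2) (foldM f [0..<b] v) (R b)"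
proof -
  have "sim (ForL x y c) (set_ireg x 0 s) ((\<tau> + 2) * (b - 0) + 1) (foldM f [0..<b] v) (R b)"
    using assms by (intro sim_ForL body) (auto dest: frame_set_ireg')
  then have "sim (For x y c) s (((\<tau> + 2) * (b - 0) + 1) + 1) (foldM f [0..<b] v) (R b)"
    unfolding For_def by (intro sim_Do_Seq) simp_all
  then show ?thesis by simp
qed

lemma sim_For_det:
  assumes xy: "x \<noteq> y" "x \<notin> wreg c" "y \<notin> wreg c"
    and "ireg s y = b" "R 0 s"
    and "\<And>j s u. R j s \<Longrightarrow> R j (set_ireg x u s)"
    and "\<And>j s'. j < b \<Longrightarrow> R j s' \<Longrightarrow> ireg s' x = j \<Longrightarrow> ireg s' y = b \<Longrightarrow>
      keeps (For x y c) s s' \<Longrightarrow> sim c s' \<tau> (return_pmf ()) (\<lambda>_. R (Suc j))"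
  shows "sim (For x y c) s ((\<tau> + 2) * b + 2) (return_pmf ()) (\<lambda>_. R b)"
  using sim_For[of x y c s b "\<lambda>j _. R j" "()" \<tau> "\<lambda>_. return_pmf"] assms
  by (simp add: foldM_return)

lemma sim_ForL_det:
  assumes "x \<noteq> y" "x \<notin> wreg c" "y \<notin> wreg c"
    and "ireg s x = k" "ireg s y = b" "k \<le> b" "R k s"
    and "\<And>j s u. R j s \<Longrightarrow> R j (set_ireg x u s)"
    and "\<And>j s'. k \<le> j \<Longrightarrow> j < b \<Longrightarrow> R j s' \<Longrightarrow> ireg s' x = j \<Longrightarrow> ireg s' y = b \<Longrightarrow>
      keeps (ForL x y c) s s' \<Longrightarrow> sim c s' \<tau> (return_pmf ()) (\<lambda>_. R (Suc j))"
  shows "sim (ForL x y c) s ((\<tau> + 2) * (b - k) + 1) (return_pmf ()) (\<lambda>_. R b)"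
  using sim_ForL[of x y c s k b "\<lambda>j _. R j" "()" \<tau> "\<lambda>_. return_pmf"] assms
  by (simp add: foldM_return)

section \<open>From simulations to running time and success probability\<close>

lemma run_eq_steps: "run p n tc orc c s N = rr N ([c], s, 0)"
  by (simp add: run_def steps_def)

lemma halted_iff: "halted D \<longleftrightarrow> (\<forall>(cs, s', t) \<in> set_pmf D. cs = [])"
  by (auto simp: halted_def)

lemma output_dist_halted:
  assumes "halted (rr N ([c], s, 0))"
  shows "output_dist p n tc orc c s = map_pmf (\<lambda>(cs, s', t). output_mat n s') (rr N ([c], s, 0))"
proof -
  define N0 where "N0 = (LEAST N. halted (rr N ([c], s, 0)))"
  have "halted (rr N0 ([c], s, 0))"
    unfolding N0_def using assms by (rule LeastI)
  with assms have "rr N0 ([c], s, 0) = rr N ([c], s, 0)"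
    by (intro halted_unique)
  then show ?thesis
    unfolding output_dist_def run_eq_steps halted_iff[symmetric] N0_def[symmetric] by simp
qed

text \<open>The only place where a coupling becomes a probability. Only a lower bound on success is
  wanted, so it is enough that the abstract flag implies a correct output.\<close>

lemma sim_output:
  assumes "sim c s \<tau> \<mu> (\<lambda>b s'. b \<longrightarrow> output_mat n s' = Some C)"
  shows "runs_in_time p n tc orc c s (real \<tau>)"
    and "pmf \<mu> True \<le> measure_pmf.prob (output_dist p n tc orc c s) {Some C}"
proof -
  obtain M D where D: "evalb M [c] s D" "\<forall>(s', t) \<in> set_pmf D. t \<le> \<tau>"
      "rel_pmf (\<lambda>b s'. b \<longrightarrow> output_mat n s' = Some C) \<mu> (map_pmf fst D)"
    using assms unfolding sim_def by blast
  show "runs_in_time p n tc orc c s (real \<tau>)"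
    unfolding runs_in_time_def run_eq_steps
    by (rule exI[of _ M]) (use D(1,2) in \<open>auto simp: evalb_def\<close>)
  have "output_dist p n tc orc c s = map_pmf (output_mat n) (map_pmf fst D)"
    using output_dist_halted[OF evalb_halted[OF D(1)]] D(1)
    by (simp add: evalb_def map_pmf_comp case_prod_unfold)
  moreover have "pmf \<mu> True \<le> measure_pmf.prob (map_pmf fst D) {s'. output_mat n s' = Some C}"
  proof -
    have "{s'. \<exists>b\<in>{True}. b \<longrightarrow> output_mat n s' = Some C} = {s'. output_mat n s' = Some C}" by blast
    then show ?thesis using rel_pmf_measureD[OF D(3), of "{True}"] by (simp only: pmf.rep_eq)
  qed
  ultimately show "pmf \<mu> True \<le> measure_pmf.prob (output_dist p n tc orc c s) {Some C}"
    by (simp add: vimage_def)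
qed

end

section \<open>Uniform sampling\<close>

lemma foldM_map: "foldM f (map h ks) x = foldM (\<lambda>k. f (h k)) ks x"
  by (induction ks arbitrary: x) (auto intro!: bind_pmf_cong)

text \<open>Flattens a double loop into one loop over pairs, for sampling a matrix entry by entry
  and for the union bound over all blocks.\<close>

lemma foldM_product:
  "foldM (\<lambda>i. foldM (\<lambda>j. g (i, j)) js) is x = foldM g (List.product is js) x"
  by (induction "is" arbitrary: x) (auto simp: foldM_append foldM_map intro!: bind_pmf_cong)

text \<open>Filling distinct cells one by one with independent samples yields a product
  distribution; this identifies the filling loops with \<open>Uvec\<close> and
  \<open>Umat\<close>.\<close>

lemma foldM_sample:
  "distinct ks \<Longrightarrow> foldM (\<lambda>k X. map_pmf (\<lambda>v. X(k := v)) U) ks X0 =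
     map_pmf (\<lambda>Y k. if k \<in> set ks then Y k else X0 k) (Pi_pmf (set ks) d (\<lambda>_. U))"
proof (induction ks arbitrary: X0)
  case (Cons k ks)
  have "foldM (\<lambda>k X. map_pmf (\<lambda>v. X(k := v)) U) (k # ks) X0 = bind_pmf U (\<lambda>v.
      map_pmf (\<lambda>Y l. if l \<in> set ks then Y l else (X0(k := v)) l) (Pi_pmf (set ks) d (\<lambda>_. U)))"
    unfolding foldM.simps bind_map_pmf using Cons.prems by (intro bind_pmf_cong refl Cons.IH) simp
  also have "\<dots> = bind_pmf U (\<lambda>v. map_pmf (\<lambda>Y l. if l \<in> set (k # ks) then (Y(k := v)) l else X0 l)
      (Pi_pmf (set ks) d (\<lambda>_. U)))"
    using Cons.prems by (intro bind_pmf_cong refl pmf.map_cong) auto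
  also have "\<dots> = map_pmf (\<lambda>Y l. if l \<in> set (k # ks) then Y l else X0 l) (Pi_pmf (set (k # ks)) d (\<lambda>_. U))"
    using Cons.prems by (simp add: Pi_pmf_insert' map_bind_pmf map_pmf_def bind_assoc_pmf bind_return_pmf)
  finally show ?case .
qed (simp)

section \<open>Elementary subroutines\<close>

abbreviation seqs :: "com \<Rightarrow> com \<Rightarrow> com" (infixr ";;" 60) where
  "c ;; d \<equiv> Seq c d"

definition fill :: "nat \<Rightarrow> com" where
  "fill b = For 20 0 (For 21 0 (Do (FRand (b, 20, 21))))"

definition fill_vec :: com where
  "fill_vec = For 21 0 (Do (FRand (12, 4, 21)))"

definition subtract :: "nat \<Rightarrow> nat \<Rightarrow> nat \<Rightarrow> com" where
  "subtract c a b = For 20 0 (For 21 0 (Do (FSub (c, 20, 21) (a, 20, 21) (b, 20, 21))))"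

text \<open>Register 22 is the running index of the inner product; register 4 always contains 0.\<close>

definition dot :: "loc \<Rightarrow> loc \<Rightarrow> com" where
  "dot u v = Do (FOfI (30, 4, 4) 4) ;;
     For 22 0 (Do (FMul (31, 4, 4) u v) ;; Do (FAdd (30, 4, 4) (30, 4, 4) (31, 4, 4)))"

text \<open>Arrays 5, 6 and 7 hold the factors and the claimed product, array 12 the random vector
  and array 13 its image under the right factor. Cell 32 saves one side of the comparison while cell
  30 is reused for the other. The flag in register 23 is only ever cleared, so repeating the test
  computes a conjunction.\<close>

definition check_once :: com where
  "check_once =
     fill_vec ;;
     For 20 0 (dot (6, 20, 22) (12, 4, 22) ;; Do (FCopy (13, 4, 20) (30, 4, 4))) ;;
     For 20 0 (dot (5, 20, 22) (13, 4, 22) ;; Do (FCopy (32, 4, 4) (30, 4, 4)) ;;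
       dot (7, 20, 22) (12, 4, 22) ;; Cond (FEq (30, 4, 4) (32, 4, 4)) Skip (Do (IZero 23)))"

definition check :: com where
  "check = Do (IZero 23) ;; Do (ISucc 23) ;; For 24 5 check_once"

lemma write_sets_check [simp]:
  "wreg (fill b) = {20, 21}" "wfar (fill b) = {b}" "wiar (fill b) = {}"
  "wreg fill_vec = {21}" "wfar fill_vec = {12}" "wiar fill_vec = {}"
  "wreg (subtract c a b) = {20, 21}" "wfar (subtract c a b) = {c}" "wiar (subtract c a b) = {}"
  "wreg (dot u v) = {22}" "wfar (dot u v) = {30, 31}" "wiar (dot u v) = {}"
  "wreg check_once = {20, 21, 22, 23}" "wfar check_once = {12, 13, 30, 31, 32}" "wiar check_once = {}"
  "wreg check = {20, 21, 22, 23, 24}" "wfar check = {12, 13, 30, 31, 32}" "wiar check = {}"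
  by (auto simp: fill_def fill_vec_def subtract_def dot_def check_once_def check_def)

text \<open>The operands of an inner product move with its running index: reading such an operand
  later amounts to reading the old state at the new index.\<close>

lemma frame_get_loc:
  assumes "frame {x} F J s s'" "loc_arr u \<notin> F"
  shows "get_loc s' u = get_loc (set_ireg x (ireg s' x) s) u"
proof -
  obtain a i j where u: "u = (a, i, j)" by (cases u)
  show ?thesis
    by (cases "i = x"; cases "j = x") (use assms in \<open>auto simp: u frame_def\<close>)
qed

lemma set_loc_simps [simp]:
  "ireg (set_loc w v s) = ireg s" "iarr (set_loc w v s) = iarr s" "outp (set_loc w v s) = outp s"
  "farr (set_loc (a, i, j) v s) = (farr s)(a := (farr s a)(ireg s i := (farr s a (ireg s i))(ireg s j := v)))"
  by (cases w; simp)+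

locale check_algo = machine +
  fixes K :: nat
  assumes n_pos: "1 \<le> n" and K_pos: "1 \<le> K"
begin

definition unif :: "int pmf" where
  "unif = pmf_of_set {0..<int p}"

text \<open>Random matrices are functions on index pairs with default 0 outside the range; thus
  product distributions apply and equality of matrices is equality of functions.\<close>

definition Umat :: "nat \<Rightarrow> (nat \<times> nat \<Rightarrow> int) pmf" where
  "Umat r = Pi_pmf ({..<r} \<times> {..<n}) 0 (\<lambda>_. unif)"

definition Uvec :: "(nat \<Rightarrow> int) pmf" where
  "Uvec = Pi_pmf {..<n} 0 (\<lambda>_. unif)"

definition holds_mat :: "nat \<Rightarrow> (nat \<times> nat \<Rightarrow> int) \<Rightarrow> state \<Rightarrow> bool" where
  "holds_mat b X s \<longleftrightarrow> (\<forall>i<n. \<forall>j<n. farr s b i j = X (i, j))"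

lemma n_square: "n \<le> n * n" "1 \<le> n * n"
  using n_pos by auto

lemma sim_Skip': "R x s \<Longrightarrow> sim Skip s \<tau> (return_pmf x) R"
  using sim_mono[OF sim_Skip[of R x s]] by simp

lemma holds_mat_frame: "holds_mat b X s \<Longrightarrow> frame W F J s s' \<Longrightarrow> b \<notin> F \<Longrightarrow> holds_mat b X s'"
  by (simp add: holds_mat_def frame_def)

lemma sim_FRand:
  "sim (Do (FRand w)) s 1 unif (\<lambda>v s'. s' = set_loc w v s)"
  using sim_Do[of "\<lambda>v s'. s' = set_loc w v s" unif "FRand w" s]
  by (simp add: unif_def pmf.rel_map pmf.rel_refl)

lemma sim_map: "sim c s \<tau> \<mu> (\<lambda>x. R (f x)) \<Longrightarrow> sim c s \<tau> (map_pmf f \<mu>) R"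
  by (auto simp: sim_def pmf.rel_map)

lemma sim_fill_vec:
  assumes "ireg s 0 = n" "ireg s 4 = 0"
  shows "sim fill_vec s (3 * n + 2) Uvec (\<lambda>v s'. \<forall>j<n. farr s' 12 0 j = v j)"
proof -
  have "sim fill_vec s ((1 + 2) * n + 2) (foldM (\<lambda>j X. map_pmf (\<lambda>v. X(j := v)) unif) [0..<n] (\<lambda>_. 0))
      (\<lambda>v s'. \<forall>j<n. farr s' 12 0 j = v j)"
    unfolding fill_vec_def
  proof (rule sim_For[where R="\<lambda>j v s'. \<forall>j'<j. farr s' 12 0 j' = v j'"])
    fix j v s'
    assume "\<forall>j'<j. farr s' 12 0 j' = v j'" "ireg s' 21 = j" "keeps (For 21 0 (Do (FRand (12, 4, 21)))) s s'"
    moreover from this have "ireg s' 4 = 0" using frame_ireg[of _ _ _ s s' 4] assms by simp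
    ultimately show "sim (Do (FRand (12, 4, 21))) s' 1 (map_pmf (\<lambda>x. v(j := x)) unif)
        (\<lambda>v s'. \<forall>j'<Suc j. farr s' 12 0 j' = v j')"
      by (intro sim_map sim_mono[OF sim_FRand]) (auto simp: less_Suc_eq)
  qed (use assms in auto)
  moreover have "map_pmf (\<lambda>Y k. if k \<in> {..<n} then Y k else 0) Uvec = Uvec"
    unfolding Uvec_def by (intro map_pmf_idI) (auto simp: set_Pi_pmf PiE_dflt_def)
  moreover have "foldM (\<lambda>j X. map_pmf (\<lambda>v. X(j := v)) unif) [0..<n] (\<lambda>_. 0) =
      map_pmf (\<lambda>Y k. if k \<in> {..<n} then Y k else 0) Uvec"
    unfolding Uvec_def using foldM_sample[of "[0..<n]" unif "\<lambda>_. 0" 0] by (simp add: atLeast0LessThan)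
  ultimately show ?thesis by (auto elim: sim_mono)
qed

lemma sim_fill:
  assumes "ireg s 0 = n"
  shows "sim (fill b) s (8 * n\<^sup>2 + 2) (Umat n) (\<lambda>X s'. holds_mat b X s')"
proof -
  let ?f = "\<lambda>i j X. map_pmf (\<lambda>v. X((i, j) := v)) unif"
  have "sim (fill b) s ((((1 + 2) * n + 2) + 2) * n + 2) (foldM (\<lambda>i. foldM (?f i) [0..<n]) [0..<n] (\<lambda>_. 0))
      (\<lambda>X s'. \<forall>i<n. \<forall>j<n. farr s' b i j = X (i, j))"
    unfolding fill_def
  proof (rule sim_For[where R="\<lambda>i X s'. \<forall>i'<i. \<forall>j<n. farr s' b i' j = X (i', j)"])
    fix i v and s1 :: state
    assume 1: "\<forall>i'<i. \<forall>j<n. farr s1 b i' j = v (i', j)" "ireg s1 20 = i" "ireg s1 0 = n"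
    have "sim (For 21 0 (Do (FRand (b, 20, 21)))) s1 ((1 + 2) * n + 2) (foldM (?f i) [0..<n] v)
        (\<lambda>X s'. (\<forall>i'<i. \<forall>j<n. farr s' b i' j = X (i', j)) \<and> (\<forall>j<n. farr s' b i j = X (i, j)))"
    proof (rule sim_For[where R="\<lambda>j' X s'. (\<forall>i'<i. \<forall>j<n. farr s' b i' j = X (i', j)) \<and>
        (\<forall>j<j'. farr s' b i j = X (i, j))"])
      fix j v s'
      assume a: "(\<forall>i'<i. \<forall>j<n. farr s' b i' j = v (i', j)) \<and> (\<forall>j'<j. farr s' b i j' = v (i, j'))"
         "ireg s' 21 = j" "keeps (For 21 0 (Do (FRand (b, 20, 21)))) s1 s'"
      moreover from this have "ireg s' 20 = i" using frame_ireg[of _ _ _ s1 s' 20] 1 by simp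
      ultimately show "sim (Do (FRand (b, 20, 21))) s' 1 (?f i j v)
          (\<lambda>X s'. (\<forall>i'<i. \<forall>j<n. farr s' b i' j = X (i', j)) \<and> (\<forall>j'<Suc j. farr s' b i j' = X (i, j')))"
        by (intro sim_map sim_mono[OF sim_FRand]) (auto simp: less_Suc_eq)
    qed (use 1 in auto)
    then show "sim (For 21 0 (Do (FRand (b, 20, 21)))) s1 ((1 + 2) * n + 2) (foldM (?f i) [0..<n] v)
        (\<lambda>X s'. \<forall>i'<Suc i. \<forall>j<n. farr s' b i' j = X (i', j))"
      by (rule sim_mono) (auto simp: less_Suc_eq)
  qed (use assms in auto)
  moreover have "foldM (\<lambda>i. foldM (?f i) [0..<n]) [0..<n] (\<lambda>_. 0) = Umat n"
  proof -
    have "foldM (\<lambda>i. foldM (?f i) [0..<n]) [0..<n] (\<lambda>_. 0) =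
        map_pmf (\<lambda>Y k. if k \<in> {..<n} \<times> {..<n} then Y k else 0) (Umat n)"
      using foldM_product[of "\<lambda>k X. map_pmf (\<lambda>v. X(k := v)) unif" "[0..<n]" "[0..<n]"]
        foldM_sample[of "List.product [0..<n] [0..<n]" unif "\<lambda>_. 0" 0]
      unfolding Umat_def by (simp add: distinct_product atLeast0LessThan)
    also have "\<dots> = Umat n"
      unfolding Umat_def by (intro map_pmf_idI) (auto simp: set_Pi_pmf PiE_dflt_def)
    finally show ?thesis .
  qed
  moreover have "((((1 + 2) * n + 2) + 2) * n + 2) \<le> 8 * n\<^sup>2 + 2"
  proof -
    have "((((1 + 2) * n + 2) + 2) * n + 2) = 3 * (n * n) + 4 * n + 2" by (simp add: algebra_simps)
    then show ?thesis using n_square unfolding power2_eq_square by linarith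
  qed
  ultimately show ?thesis unfolding holds_mat_def by (auto elim: sim_mono)
qed

lemma sim_subtract:
  assumes "ireg s 0 = n" "c \<noteq> a" "c \<noteq> b"
  shows "sim (subtract c a b) s (8 * n\<^sup>2 + 2) (return_pmf ())
     (\<lambda>_. holds_mat c (\<lambda>(i, j). (farr s a i j - farr s b i j) mod int p))"
proof -
  let ?g = "\<lambda>i j. (farr s a i j - farr s b i j) mod int p"
  have "sim (subtract c a b) s ((((1 + 2) * n + 2) + 2) * n + 2) (return_pmf ())
      (\<lambda>_ s'. \<forall>i<n. \<forall>j<n. farr s' c i j = ?g i j)"
    unfolding subtract_def
  proof (rule sim_For_det[where R="\<lambda>i s'. \<forall>i'<i. \<forall>j<n. farr s' c i' j = ?g i' j"])
    let ?b = "Do (FSub (c, 20, 21) (a, 20, 21) (b, 20, 21))"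
    fix i and s1 :: state
    assume 1: "\<forall>i'<i. \<forall>j<n. farr s1 c i' j = ?g i' j" "ireg s1 20 = i" "ireg s1 0 = n"
      and f1: "keeps (For 20 0 (For 21 0 ?b)) s s1"
    have "sim (For 21 0 ?b) s1 ((1 + 2) * n + 2) (return_pmf ())
        (\<lambda>_ s'. (\<forall>i'<i. \<forall>j<n. farr s' c i' j = ?g i' j) \<and> (\<forall>j<n. farr s' c i j = ?g i j))"
    proof (rule sim_For_det[where R="\<lambda>j' s'. (\<forall>i'<i. \<forall>j<n. farr s' c i' j = ?g i' j) \<and>
        (\<forall>j<j'. farr s' c i j = ?g i j)"])
      fix j s'
      assume a: "(\<forall>i'<i. \<forall>j<n. farr s' c i' j = ?g i' j) \<and> (\<forall>j'<j. farr s' c i j' = ?g i j')"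
         "ireg s' 21 = j" "keeps (For 21 0 ?b) s1 s'"
      have "ireg s' 20 = i" using frame_ireg[OF a(3), of 20] 1 by simp
      moreover have "farr s' a = farr s a" "farr s' b = farr s b"
        using frame_farr[OF a(3)] frame_farr[OF f1] assms by auto
      ultimately show "sim ?b s' 1 (return_pmf ()) (\<lambda>_ s'. (\<forall>i'<i. \<forall>j<n. farr s' c i' j = ?g i' j) \<and>
          (\<forall>j'<Suc j. farr s' c i j' = ?g i j'))"
        using a by (intro sim_Do_det) (auto simp: less_Suc_eq)
    qed (use 1 in auto)
    then show "sim (For 21 0 ?b) s1 ((1 + 2) * n + 2) (return_pmf ())
        (\<lambda>_ s'. \<forall>i'<Suc i. \<forall>j<n. farr s' c i' j = ?g i' j)"
      by (rule sim_mono) (auto simp: less_Suc_eq)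
  qed (use assms in auto)
  moreover have "((((1 + 2) * n + 2) + 2) * n + 2) \<le> 8 * n\<^sup>2 + 2"
  proof -
    have "((((1 + 2) * n + 2) + 2) * n + 2) = 3 * (n * n) + 4 * n + 2" by (simp add: algebra_simps)
    then show ?thesis using n_square unfolding power2_eq_square by linarith
  qed
  ultimately show ?thesis unfolding holds_mat_def by (auto elim: sim_mono)
qed

lemma sim_dot:
  assumes "ireg s 0 = n" "ireg s 4 = 0" "loc_arr u \<notin> {30, 31}" "loc_arr v \<notin> {30, 31}"
  shows "sim (dot u v) s (4 * n + 3) (return_pmf ()) (\<lambda>_ s'. farr s' 30 0 0 =
     (\<Sum>l<n. get_loc (set_ireg 22 l s) u * get_loc (set_ireg 22 l s) v) mod int p)"
proof -
  let ?t = "\<lambda>l. get_loc (set_ireg 22 l s) u * get_loc (set_ireg 22 l s) v"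
  let ?b = "Do (FMul (31, 4, 4) u v) ;; Do (FAdd (30, 4, 4) (30, 4, 4) (31, 4, 4))"
  let ?s1 = "set_loc (30, 4, 4) 0 s"
  have "sim (For 22 0 ?b) ?s1 ((2 + 2) * n + 2) (return_pmf ())
      (\<lambda>_ s'. farr s' 30 0 0 = (\<Sum>l<n. ?t l) mod int p)"
  proof (rule sim_For_det[where R="\<lambda>k s'. farr s' 30 0 0 = (\<Sum>l<k. ?t l) mod int p"])
    fix j s'
    assume 1: "farr s' 30 0 0 = (\<Sum>l<j. ?t l) mod int p" "ireg s' 22 = j" "keeps (For 22 0 ?b) ?s1 s'"
    have f: "frame {22} {30, 31} {} s s'"
      using 1(3) by (auto simp: frame_def)
    have 4: "ireg s' 4 = 0" using frame_ireg[OF f, of 4] assms by simp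
    have "get_loc s' u * get_loc s' v = ?t j"
      using frame_get_loc[OF f] assms 1 by simp
    then have "sim ?b s' (1 + 1) (return_pmf ()) (\<lambda>_ s'. farr s' 30 0 0 = (\<Sum>l<Suc j. ?t l) mod int p)"
      using 4 1 by (intro sim_Do_Seq sim_Do_det) (auto simp: mod_simps algebra_simps)
    then show "sim ?b s' 2 (return_pmf ()) (\<lambda>_ s'. farr s' 30 0 0 = (\<Sum>l<Suc j. ?t l) mod int p)"
      by (simp add: numeral_2_eq_2)
  qed (use assms in auto)
  then have "sim (dot u v) s ((2 + 2) * n + 2 + 1) (return_pmf ())
      (\<lambda>_ s'. farr s' 30 0 0 = (\<Sum>l<n. ?t l) mod int p)"
    unfolding dot_def using assms by (intro sim_Do_Seq) auto
  then show ?thesis by (rule sim_mono) auto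
qed

text \<open>Row \<open>i\<close> of Freivalds' test of \<open>X Y = Z\<close> with the vector \<open>v\<close>.\<close>

definition passes :: "(nat \<times> nat \<Rightarrow> int) \<Rightarrow> (nat \<times> nat \<Rightarrow> int) \<Rightarrow> (nat \<times> nat \<Rightarrow> int) \<Rightarrow> (nat \<Rightarrow> int) \<Rightarrow> nat \<Rightarrow> bool" where
  "passes X Y Z v i \<longleftrightarrow> (\<Sum>l<n. X (i, l) * ((\<Sum>j<n. Y (l, j) * v j) mod int p)) mod int p =
     (\<Sum>j<n. Z (i, j) * v j) mod int p"

definition check_pmf :: "(nat \<times> nat \<Rightarrow> int) \<Rightarrow> (nat \<times> nat \<Rightarrow> int) \<Rightarrow> (nat \<times> nat \<Rightarrow> int) \<Rightarrow> bool pmf" where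
  "check_pmf X Y Z = foldM (\<lambda>_ ok. map_pmf (\<lambda>v. ok \<and> (\<forall>i<n. passes X Y Z v i)) Uvec) [0..<K] True"

lemma sim_check_once:
  assumes s: "ireg s 0 = n" "ireg s 4 = 0" "ireg s 23 = of_bool ok"
    and X: "holds_mat 5 X s" and Y: "holds_mat 6 Y s" and Z: "holds_mat 7 Z s"
  shows "sim check_once s (40 * n\<^sup>2) (map_pmf (\<lambda>v. ok \<and> (\<forall>i<n. passes X Y Z v i)) Uvec)
     (\<lambda>ok s'. ireg s' 23 = of_bool ok)"
proof -
  let ?b1 = "dot (6, 20, 22) (12, 4, 22) ;; Do (FCopy (13, 4, 20) (30, 4, 4))"
  let ?b2 = "dot (5, 20, 22) (13, 4, 22) ;; Do (FCopy (32, 4, 4) (30, 4, 4)) ;;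
       dot (7, 20, 22) (12, 4, 22) ;; Cond (FEq (30, 4, 4) (32, 4, 4)) Skip (Do (IZero 23))"
  have "sim check_once s ((3 * n + 2) + ((((4 * n + 3 + 1) + 2) * n + 2) + (((4 * n + 3) + ((4 * n + 3) + 2 + 1) + 2) * n + 2)))
     (bind_pmf Uvec (\<lambda>v. return_pmf (ok \<and> (\<forall>i<n. passes X Y Z v i))))
     (\<lambda>ok s'. ireg s' 23 = of_bool ok)"
    unfolding check_once_def
  proof (rule sim_Seq[OF sim_frame[OF sim_fill_vec]])
    fix v s1
    assume a1: "(\<forall>j<n. farr s1 12 0 j = v j) \<and> keeps fill_vec s s1"
    then have f1: "keeps fill_vec s s1" by simp
    note r1 = frame_ireg[OF f1] frame_farr[OF f1]
    let ?w = "\<lambda>i. (\<Sum>j<n. Y (i, j) * v j) mod int p"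
    have "sim (For 20 0 ?b1) s1 (((4 * n + 3 + 1) + 2) * n + 2) (return_pmf ()) (\<lambda>_ s'. \<forall>i<n. farr s' 13 0 i = ?w i)"
    proof (rule sim_For_det[where R="\<lambda>k s'. \<forall>i<k. farr s' 13 0 i = ?w i"])
      fix i s2
      assume i: "i < n" and a2: "\<forall>i'<i. farr s2 13 0 i' = ?w i'" "ireg s2 20 = i" "ireg s2 0 = n"
        and f2: "keeps (For 20 0 ?b1) s1 s2"
      note r2 = frame_ireg[OF f2] frame_farr[OF f2]
      show "sim ?b1 s2 (4 * n + 3 + 1) (return_pmf ()) (\<lambda>_ s'. \<forall>i'<Suc i. farr s' 13 0 i' = ?w i')"
      proof (rule sim_Seq_det[OF sim_frame[OF sim_dot]])
        fix s3
        assume a3: "farr s3 30 0 0 = (\<Sum>l<n. get_loc (set_ireg 22 l s2) (6, 20, 22) *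
             get_loc (set_ireg 22 l s2) (12, 4, 22)) mod int p \<and> keeps (dot (6, 20, 22) (12, 4, 22)) s2 s3"
        then have f3: "keeps (dot (6, 20, 22) (12, 4, 22)) s2 s3" by simp
        note r3 = frame_ireg[OF f3] frame_farr[OF f3]
        have "farr s3 30 0 0 = ?w i"
          using a3 r2 r1 a2 s Y i a1 by (auto simp: holds_mat_def intro!: arg_cong[where f="\<lambda>x. x mod int p"] sum.cong)
        then show "sim (Do (FCopy (13, 4, 20) (30, 4, 4))) s3 1 (return_pmf ()) (\<lambda>_ s'. \<forall>i'<Suc i. farr s' 13 0 i' = ?w i')"
          using a2 s r1 r2 r3 by (intro sim_Do_det) (auto simp: less_Suc_eq)
      qed (use a2 s r1 r2 in auto)
    qed (use s r1 in auto)
    note W = sim_frame[OF this]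
    show "sim (For 20 0 ?b1 ;; For 20 0 ?b2) s1
       ((((4 * n + 3 + 1) + 2) * n + 2) + (((4 * n + 3) + ((4 * n + 3) + 2 + 1) + 2) * n + 2))
       (return_pmf (ok \<and> (\<forall>i<n. passes X Y Z v i))) (\<lambda>ok s'. ireg s' 23 = of_bool ok)"
    proof (rule sim_Seq_det[OF W])
      fix s2
      assume a2: "(\<forall>i<n. farr s2 13 0 i = ?w i) \<and> keeps (For 20 0 ?b1) s1 s2"
      then have f2: "keeps (For 20 0 ?b1) s1 s2" by simp
      note r2 = frame_ireg[OF f2] frame_farr[OF f2]
      have "sim (For 20 0 ?b2) s2 (((4 * n + 3) + ((4 * n + 3) + 2 + 1) + 2) * n + 2) (return_pmf ())
         (\<lambda>_ s'. ireg s' 23 = of_bool (ok \<and> (\<forall>i<n. passes X Y Z v i)))"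
      proof (rule sim_For_det[where R="\<lambda>k s'. ireg s' 23 = of_bool (ok \<and> (\<forall>i<k. passes X Y Z v i))"])
        fix i s3
        assume i: "i < n" and a3: "ireg s3 23 = of_bool (ok \<and> (\<forall>i'<i. passes X Y Z v i'))"
          "ireg s3 20 = i" "ireg s3 0 = n" and f3: "keeps (For 20 0 ?b2) s2 s3"
        note r3 = frame_ireg[OF f3] frame_farr[OF f3]
        show "sim ?b2 s3 ((4 * n + 3) + ((4 * n + 3) + 2 + 1)) (return_pmf ())
           (\<lambda>_ s'. ireg s' 23 = of_bool (ok \<and> (\<forall>i'<Suc i. passes X Y Z v i')))"
        proof (rule sim_Seq_det[OF sim_frame[OF sim_dot]])
          fix s4
          assume a4: "farr s4 30 0 0 = (\<Sum>l<n. get_loc (set_ireg 22 l s3) (5, 20, 22) *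
             get_loc (set_ireg 22 l s3) (13, 4, 22)) mod int p \<and> keeps (dot (5, 20, 22) (13, 4, 22)) s3 s4"
          then have f4: "keeps (dot (5, 20, 22) (13, 4, 22)) s3 s4" by simp
          note r4 = frame_ireg[OF f4] frame_farr[OF f4]
          have e4: "farr s4 30 0 0 = (\<Sum>l<n. X (i, l) * ?w l) mod int p"
            using a4 r3 r2 r1 a3 s X i a2 by (auto simp: holds_mat_def intro!: arg_cong[where f="\<lambda>x. x mod int p"] sum.cong)
          let ?s5 = "set_loc (32, 4, 4) (farr s4 30 0 0) s4"
          have "sim (dot (7, 20, 22) (12, 4, 22) ;; Cond (FEq (30, 4, 4) (32, 4, 4)) Skip (Do (IZero 23))) ?s5
              ((4 * n + 3) + 2) (return_pmf ()) (\<lambda>_ s'. ireg s' 23 = of_bool (ok \<and> (\<forall>i'<Suc i. passes X Y Z v i')))"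
          proof (rule sim_Seq_det[OF sim_frame[OF sim_dot]])
            fix s6
            assume a6: "farr s6 30 0 0 = (\<Sum>l<n. get_loc (set_ireg 22 l ?s5) (7, 20, 22) *
             get_loc (set_ireg 22 l ?s5) (12, 4, 22)) mod int p \<and> keeps (dot (7, 20, 22) (12, 4, 22)) ?s5 s6"
            then have f6: "keeps (dot (7, 20, 22) (12, 4, 22)) ?s5 s6" by simp
            note r6 = frame_ireg[OF f6] frame_farr[OF f6]
            have e6: "farr s6 30 0 0 = (\<Sum>j<n. Z (i, j) * v j) mod int p"
              using a6 r4 r3 r2 r1 a3 s Z i a1 by (auto simp: holds_mat_def intro!: arg_cong[where f="\<lambda>x. x mod int p"] sum.cong)
            have e6': "farr s6 32 0 0 = (\<Sum>l<n. X (i, l) * ?w l) mod int p"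
              using e4 r6 r4 r3 r2 r1 s by simp
            have z: "ireg s6 4 = 0" "ireg s6 23 = of_bool (ok \<and> (\<forall>i'<i. passes X Y Z v i'))"
              using r6 r4 r3 r2 r1 s a3 by simp_all
            have g: "holds (FEq (30, 4, 4) (32, 4, 4)) s6 \<longleftrightarrow> passes X Y Z v i"
              using e6 e6' z by (auto simp: passes_def)
            have "sim (Cond (FEq (30, 4, 4) (32, 4, 4)) Skip (Do (IZero 23))) s6 (1 + 1) (return_pmf ())
               (\<lambda>_ s'. ireg s' 23 = of_bool (ok \<and> (\<forall>i'<Suc i. passes X Y Z v i')))"
            proof (rule sim_Cond, cases "passes X Y Z v i")
              case True
              then show "sim (if holds (FEq (30, 4, 4) (32, 4, 4)) s6 then Skip else Do (IZero 23)) s6 1 (return_pmf ())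
                 (\<lambda>_ s'. ireg s' 23 = of_bool (ok \<and> (\<forall>i'<Suc i. passes X Y Z v i')))"
                unfolding g using z by (simp only: if_True) (rule sim_Skip', auto simp: less_Suc_eq)
            next
              case False
              then show "sim (if holds (FEq (30, 4, 4) (32, 4, 4)) s6 then Skip else Do (IZero 23)) s6 1 (return_pmf ())
                 (\<lambda>_ s'. ireg s' 23 = of_bool (ok \<and> (\<forall>i'<Suc i. passes X Y Z v i')))"
                unfolding g by (simp only: if_False) (rule sim_Do_det, auto)
            qed
            then show "sim (Cond (FEq (30, 4, 4) (32, 4, 4)) Skip (Do (IZero 23))) s6 2 (return_pmf ())
               (\<lambda>_ s'. ireg s' 23 = of_bool (ok \<and> (\<forall>i'<Suc i. passes X Y Z v i')))"
              by (simp only: one_add_one)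
          qed (use r4 r3 r2 r1 s a3 in auto)
          then show "sim (Do (FCopy (32, 4, 4) (30, 4, 4)) ;; dot (7, 20, 22) (12, 4, 22) ;;
               Cond (FEq (30, 4, 4) (32, 4, 4)) Skip (Do (IZero 23))) s4
              ((4 * n + 3) + 2 + 1) (return_pmf ()) (\<lambda>_ s'. ireg s' 23 = of_bool (ok \<and> (\<forall>i'<Suc i. passes X Y Z v i')))"
            using r4 r3 r2 r1 s by (intro sim_Do_Seq) auto
        qed (use r3 r2 r1 s a3 in auto)
      qed (use r2 r1 s in auto)
      then show "sim (For 20 0 ?b2) s2 (((4 * n + 3) + ((4 * n + 3) + 2 + 1) + 2) * n + 2)
         (return_pmf (ok \<and> (\<forall>i<n. passes X Y Z v i))) (\<lambda>ok s'. ireg s' 23 = of_bool ok)"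
        using sim_map[of _ _ _ "return_pmf ()" "\<lambda>ok s'. ireg s' 23 = of_bool ok"
            "\<lambda>_. ok \<and> (\<forall>i<n. passes X Y Z v i)"] by simp
    qed
  qed (use s in auto)
  moreover have "(3 * n + 2) + ((((4 * n + 3 + 1) + 2) * n + 2) + (((4 * n + 3) + ((4 * n + 3) + 2 + 1) + 2) * n + 2)) \<le> 40 * n\<^sup>2"
  proof -
    have "(3 * n + 2) + ((((4 * n + 3 + 1) + 2) * n + 2) + (((4 * n + 3) + ((4 * n + 3) + 2 + 1) + 2) * n + 2))
        = 12 * (n * n) + 20 * n + 6" by (simp add: algebra_simps)
    then show ?thesis using n_square unfolding power2_eq_square by linarith
  qed
  ultimately show ?thesis by (auto simp: map_pmf_def elim: sim_mono)
qed

lemma sim_check: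
  assumes s: "ireg s 0 = n" "ireg s 4 = 0" "ireg s 5 = K"
    and X: "holds_mat 5 X s" and Y: "holds_mat 6 Y s" and Z: "holds_mat 7 Z s"
  shows "sim check s (50 * K * n\<^sup>2) (check_pmf X Y Z) (\<lambda>ok s'. ireg s' 23 = of_bool ok)"
proof -
  let ?s1 = "set_ireg 23 0 s"
  let ?s2 = "set_ireg 23 1 ?s1"
  have "sim (For 24 5 check_once) ?s2 ((40 * n\<^sup>2 + 2) * K + 2) (check_pmf X Y Z) (\<lambda>ok s'. ireg s' 23 = of_bool ok)"
    unfolding check_pmf_def
  proof (rule sim_For[where R="\<lambda>_ ok s'. ireg s' 23 = of_bool ok"])
    fix j ok s'
    assume a: "ireg s' 23 = of_bool ok" and f: "keeps (For 24 5 check_once) ?s2 s'"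
    have f': "frame {20,21,22,23,24} {12, 13, 30, 31, 32} {} s s'"
      using f by (auto simp: frame_def)
    show "sim check_once s' (40 * n\<^sup>2) (map_pmf (\<lambda>v. ok \<and> (\<forall>i<n. passes X Y Z v i)) Uvec) (\<lambda>ok s'. ireg s' 23 = of_bool ok)"
      by (rule sim_check_once) (use a s frame_ireg[OF f'] holds_mat_frame[OF X f'] holds_mat_frame[OF Y f']
          holds_mat_frame[OF Z f'] in auto)
  qed (use s in auto)
  then have "sim check s ((40 * n\<^sup>2 + 2) * K + 2 + 1 + 1) (check_pmf X Y Z) (\<lambda>ok s'. ireg s' 23 = of_bool ok)"
    unfolding check_def
    by (intro sim_Do_Seq[where s'="?s1" and i="IZero 23"] sim_Do_Seq[where s'="?s2" and i="ISucc 23"]) simp_all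
  moreover have "(40 * n\<^sup>2 + 2) * K + 2 + 1 + 1 \<le> 50 * K * n\<^sup>2"
  proof -
    have "1 \<le> n\<^sup>2" using n_square by (simp add: power2_eq_square)
    then have "K \<le> K * n\<^sup>2" "1 \<le> K * n\<^sup>2" using K_pos mult_le_mono[of 1 K 1 "n\<^sup>2"] by auto
    moreover have "(40 * n\<^sup>2 + 2) * K + 2 + 1 + 1 = 40 * (K * n\<^sup>2) + 2 * K + 4" by (simp add: algebra_simps)
    ultimately show ?thesis by linarith
  qed
  ultimately show ?thesis by (auto elim: sim_mono)
qed

end

section \<open>One call of the black box\<close>

text \<open>
  Conventions: registers 0, 2, 4, 5, 6 hold \<open>n\<close>, \<open>\<lceil>1/\<alpha>\<rceil>\<close>, 0, the number \<open>K\<close> of groups and the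
  group size \<open>m\<close>; registers 10 and 11 hold the block indices \<open>I\<close>, \<open>J\<close> and register 13 the position
  \<open>i\<close>; index array 0 contains the offsets \<open>t * m\<close>.
\<close>

definition oriented :: "bool \<Rightarrow> nat \<Rightarrow> nat \<Rightarrow> nat \<Rightarrow> loc" where
  "oriented q b i j = (if q then (b, i, j) else (b, j, i))"

text \<open>Swapping the two addresses via \<open>oriented\<close> lets one routine plant row groups
  of the left and column groups of the right factor. Both offsets are looked up, as indices cannot
  be multiplied; registers 25 and 26 then run through source and target in step.\<close>

definition plant_block :: "bool \<Rightarrow> nat \<Rightarrow> nat \<Rightarrow> nat \<Rightarrow> com" where
  "plant_block q dst blk src = Do (ILoad 25 0 blk) ;; Do (ILoad 26 0 13) ;;
     For 20 6 (For 21 0 (Do (FCopy (oriented q dst 26 21) (oriented q src 25 21))) ;;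
       Do (ISucc 25) ;; Do (ISucc 26))"

abbreviation plant_rows :: "nat \<Rightarrow> com" where
  "plant_rows \<equiv> plant_block True 5 10"

abbreviation plant_cols :: "nat \<Rightarrow> com" where
  "plant_cols \<equiv> plant_block False 6 11"

definition copy_block :: "nat \<Rightarrow> com" where
  "copy_block b = Do (ILoad 26 0 13) ;;
     For 20 6 (Do (ILoad 27 0 13) ;;
       For 21 6 (Do (FCopy (b, 20, 21) (7, 26, 27)) ;; Do (ISucc 27)) ;; Do (ISucc 26))"

text \<open>An accepted answer overwrites array \<open>d\<close>, so the last accepted one survives;
  \<open>upd\<close> models exactly this.\<close>

definition attempt :: "nat \<Rightarrow> nat \<Rightarrow> nat \<Rightarrow> nat \<Rightarrow> com" where
  "attempt a b d g = fill 5 ;; fill 6 ;; plant_rows a ;; plant_cols b ;; Do (Call 5 6 7) ;; check ;;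
     Cond (ILess 4 23) (copy_block d ;; Do (IZero g) ;; Do (ISucc g)) Skip"

text \<open>The innermost loop sweeps all positions, since the good one is unknown. The outer three
  produce \<open>a * K * K\<close> sweeps without multiplying: a sweep on a good pair succeeds with
  probability more than \<open>\<alpha> / (2 * K)\<close>, so a constant failure probability is
  reached with room to spare.\<close>

definition find :: "nat \<Rightarrow> nat \<Rightarrow> nat \<Rightarrow> nat \<Rightarrow> com" where
  "find a b d g = Do (IZero g) ;; For 14 2 (For 15 5 (For 16 5 (For 13 5 (attempt a b d g))))"

lemma write_sets_find [simp]:
  "wreg (plant_block q dst blk a) = {20, 21, 25, 26}" "wfar (plant_block q dst blk a) = {dst}"
  "wiar (plant_block q dst blk a) = {}"
  "wreg (copy_block d) = {20, 21, 26, 27}" "wfar (copy_block d) = {d}" "wiar (copy_block d) = {}"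
  "wreg (attempt a b d g) = {20, 21, 22, 23, 24, 25, 26, 27, g}"
  "wfar (attempt a b d g) = {5, 6, 7, 12, 13, 30, 31, 32, d}" "wiar (attempt a b d g) = {}"
  "wreg (find a b d g) = {13, 14, 15, 16, 20, 21, 22, 23, 24, 25, 26, 27, g}"
  "wfar (find a b d g) = {5, 6, 7, 12, 13, 30, 31, 32, d}" "wiar (find a b d g) = {}"
  by (auto simp: plant_block_def oriented_def copy_block_def attempt_def find_def)

definition transp :: "(nat \<times> nat \<Rightarrow> int) \<Rightarrow> nat \<times> nat \<Rightarrow> int" where
  "transp X = (\<lambda>(i, j). X (j, i))"

lemma transp_apply [simp]: "transp X (i, j) = X (j, i)"
  by (simp add: transp_def)

lemma transp_transp [simp]: "transp (transp X) = X"
  by (auto simp: transp_def)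

definition oriented_mat :: "bool \<Rightarrow> (nat \<times> nat \<Rightarrow> int) \<Rightarrow> nat \<times> nat \<Rightarrow> int" where
  "oriented_mat q X = (if q then X else transp X)"

text \<open>
  Outcomes of trials are abstracted to \<open>None\<close> (nothing was accepted) or \<open>Some b\<close>, where \<open>b\<close> tells whether
  the accepted result is correct; the program does not know \<open>b\<close>.
\<close>

fun upd :: "bool option \<Rightarrow> bool option \<Rightarrow> bool option" where
  "upd e None = e"
| "upd e (Some b) = Some b"

text \<open>The assumption \<open>tc_ge\<close> is later discharged by the lower bound on the
  running time; it allows planting, copying and testing to be charged to the call.\<close>

locale block_algo = check_algo +
  fixes a :: nat
  assumes a_pos: "1 \<le> a" and tc_ge: "n\<^sup>2 \<le> tc"
begin

text \<open>If \<open>K\<close> exceeds \<open>n\<close>, the groups are empty and the naive loops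
  compute the whole product.\<close>

definition m :: nat where
  "m = n div K"

lemma m_le: "m \<le> n"
  by (simp add: m_def)

lemma block_le: "I < K \<Longrightarrow> I * m + m \<le> n"
proof -
  assume "I < K"
  then have "Suc I * m \<le> K * m" by (intro mult_le_mono1) simp
  also have "\<dots> \<le> n" by (simp add: m_def)
  finally show ?thesis by simp
qed

lemma block_less: "I < K \<Longrightarrow> u < m \<Longrightarrow> I * m + u < n"
  using block_le[of I] by simp

text \<open>Column groups are represented as row groups of the transpose, so that blocks of both
  factors have the same shape \<open>m\<close> by \<open>n\<close> and the same default 0 as samples
  of \<open>Umat m\<close>.\<close>

definition ext :: "nat \<Rightarrow> (nat \<times> nat \<Rightarrow> int) \<Rightarrow> nat \<times> nat \<Rightarrow> int" where
  "ext i X = (\<lambda>(u, c). if u < m \<and> c < n then X (i * m + u, c) else 0)"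

definition plant :: "nat \<Rightarrow> (nat \<times> nat \<Rightarrow> int) \<Rightarrow> (nat \<times> nat \<Rightarrow> int) \<Rightarrow> nat \<times> nat \<Rightarrow> int" where
  "plant i x X = (\<lambda>(r, c). if i * m \<le> r \<and> r < i * m + m \<and> c < n then x (r - i * m, c) else X (r, c))"

definition base :: "state \<Rightarrow> bool" where
  "base s \<longleftrightarrow> ireg s 0 = n \<and> ireg s 2 = a \<and> ireg s 4 = 0 \<and> ireg s 5 = K \<and> ireg s 6 = m \<and>
     (\<forall>t<K. iarr s 0 t = t * m)"

lemma base_frame:
  "base s \<Longrightarrow> frame W F J s s' \<Longrightarrow> 0 \<notin> W \<Longrightarrow> 2 \<notin> W \<Longrightarrow> 4 \<notin> W \<Longrightarrow> 5 \<notin> W \<Longrightarrow> 6 \<notin> W \<Longrightarrow> 0 \<notin> J \<Longrightarrow> base s'"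
  by (auto simp: base_def frame_def)

lemma baseD:
  assumes "base s"
  shows "ireg s 0 = n" "ireg s 2 = a" "ireg s 4 = 0" "ireg s 5 = K" "ireg s 6 = m"
    "t < K \<Longrightarrow> iarr s 0 t = t * m"
  using assms by (auto simp: base_def)

lemma sim_plant_block:
  assumes s: "base s" "ireg s blk = I" "ireg s 13 = i" "I < K" "i < K" "b \<noteq> dst"
    and A: "holds_mat b A s" and X: "holds_mat dst X s"
  shows "sim (plant_block q dst blk b) s (20 * n\<^sup>2) (return_pmf ())
     (\<lambda>_. holds_mat dst (oriented_mat q (plant i (ext I (oriented_mat q A)) (oriented_mat q X))))"
proof -
  let ?s1 = "set_ireg 25 (I * m) s"
  let ?s2 = "set_ireg 26 (i * m) ?s1"
  let ?c = "For 21 0 (Do (FCopy (oriented q dst 26 21) (oriented q b 25 21)))"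
  let ?b = "?c ;; Do (ISucc 25) ;; Do (ISucc 26)"
  let ?D = "\<lambda>s' r c. if q then farr s' dst r c else farr s' dst c r"
  let ?P = "\<lambda>k s'. \<forall>r<n. \<forall>c<n. ?D s' r c =
     (if i * m \<le> r \<and> r < i * m + k then oriented_mat q A (I * m + (r - i * m), c) else oriented_mat q X (r, c))"
  let ?regs = "\<lambda>k s'. ireg s' 25 = I * m + k \<and> ireg s' 26 = i * m + k"
  have w: "wreg ?b = {21, 25, 26}" "wfar ?b = {dst}" "wiar ?b = {}"
    by (auto simp: oriented_def)
  have L: "sim (For 20 6 ?b) ?s2 ((((1 + 2) * n + 2) + (1 + 1) + 2) * m + 2) (return_pmf ())
     (\<lambda>_ s'. ?P m s' \<and> ?regs m s')"
  proof (rule sim_For_det[where R="\<lambda>k s'. ?P k s' \<and> ?regs k s'"])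
    fix k s1
    assume k: "k < m" and 1: "?P k s1 \<and> ?regs k s1" and f1: "keeps (For 20 6 ?b) ?s2 s1"
    note r1 = frame_ireg[OF f1, unfolded write_sets_For w] frame_farr[OF f1, unfolded write_sets_For w]
    have n1: "ireg s1 0 = n" using r1 baseD[OF s(1)] by simp
    have b1: "farr s1 b = farr s b" using r1 s(6) by simp
    have in_n: "I * m + k < n" "i * m + k < n" using block_less s k by auto
    let ?Q = "\<lambda>j s'. (\<forall>r<n. \<forall>c<n. ?D s' r c = (if r = i * m + k \<and> c < j then oriented_mat q A (I * m + k, c) else
           ?D s1 r c)) \<and> ?regs k s'"
    have "sim ?c s1 ((1 + 2) * n + 2) (return_pmf ()) (\<lambda>_. ?Q n)"
    proof (rule sim_For_det[where R="?Q"])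
      fix j s2
      assume j: "j < n" and 2: "?Q j s2" and 3: "ireg s2 21 = j" and f2: "keeps ?c s1 s2"
      have "farr s2 b = farr s b" using frame_farr[OF f2, of b] b1 s(6) by (simp add: oriented_def)
      then have "get_loc s2 (oriented q b 25 21) = oriented_mat q A (I * m + k, j)"
        using A j in_n 2 3 by (simp add: holds_mat_def oriented_def oriented_mat_def)
      then show "sim (Do (FCopy (oriented q dst 26 21) (oriented q b 25 21))) s2 1 (return_pmf ()) (\<lambda>_. ?Q (Suc j))"
        using 2 3 by (intro sim_Do_det, simp, simp) (auto simp: less_Suc_eq oriented_def)
    qed (use n1 1 in \<open>auto simp: oriented_def\<close>)
    then show "sim ?b s1 (((1 + 2) * n + 2) + (1 + 1)) (return_pmf ()) (\<lambda>_ s'. ?P (Suc k) s' \<and> ?regs (Suc k) s')"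
    proof (rule sim_Seq_det)
      fix s2 :: state
      assume 2: "?Q n s2"
      have 3: "?P (Suc k) s2"
      proof (intro allI impI)
        fix r c assume "r < n" "c < n"
        then show "?D s2 r c = (if i * m \<le> r \<and> r < i * m + Suc k then oriented_mat q A (I * m + (r - i * m), c) else oriented_mat q X (r, c))"
          using conjunct1[OF 1] conjunct1[OF 2] by (cases "r = i * m + k") auto
      qed
      let ?s3 = "set_ireg 25 (I * m + Suc k) s2"
      let ?s4 = "set_ireg 26 (i * m + Suc k) ?s3"
      have "?P (Suc k) ?s4" using 3 by (simp only: set_ireg_simps)
      moreover have "?regs (Suc k) ?s4" by simp
      ultimately have 4: "?P (Suc k) ?s4 \<and> ?regs (Suc k) ?s4" ..
      show "sim (Do (ISucc 25) ;; Do (ISucc 26)) s2 (1 + 1) (return_pmf ()) (\<lambda>_ s'. ?P (Suc k) s' \<and> ?regs (Suc k) s')"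
        by (rule sim_Do_Seq[where s'="?s3"], use 2 in simp, simp, rule sim_Do_det[where s'="?s4"], use 2 in simp, simp, rule 4)
    qed
  qed (use X baseD[OF s(1)] in \<open>auto simp: holds_mat_def oriented_mat_def oriented_def\<close>)
  have "sim (plant_block q dst blk b) s ((((1 + 2) * n + 2) + (1 + 1) + 2) * m + 2 + 1 + 1) (return_pmf ())
     (\<lambda>_ s'. ?P m s' \<and> ?regs m s')"
    unfolding plant_block_def
    by (rule sim_Do_Seq[where s'="?s1", OF _ _ sim_Do_Seq[OF _ _ L]]) (use s baseD[OF s(1)] in simp_all)
  moreover have "(((1 + 2) * n + 2) + (1 + 1) + 2) * m + 2 + 1 + 1 \<le> 20 * n\<^sup>2"
  proof -
    have "(((1 + 2) * n + 2) + (1 + 1) + 2) * m \<le> (((1 + 2) * n + 2) + (1 + 1) + 2) * n"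
      using m_le by (rule mult_le_mono2)
    also have "\<dots> = 3 * (n * n) + 6 * n" by (simp add: algebra_simps)
    finally show ?thesis using n_square unfolding power2_eq_square by linarith
  qed
  ultimately show ?thesis
    by (rule sim_mono) (auto simp: holds_mat_def plant_def ext_def oriented_mat_def)
qed

lemmas sim_plant_rows = sim_plant_block[of _ 10 _ _ _ 5 _ _ True, unfolded oriented_mat_def if_True]
lemmas sim_plant_cols = sim_plant_block[of _ 11 _ _ _ 6 _ _ False, unfolded oriented_mat_def if_False]

lemma sim_copy_block:
  assumes s: "base s" "ireg s 13 = i" "i < K" "d \<noteq> 7"
  shows "sim (copy_block d) s (20 * n\<^sup>2) (return_pmf ())
     (\<lambda>_ s'. \<forall>u<m. \<forall>v<m. farr s' d u v = farr s 7 (i * m + u) (i * m + v))"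
proof -
  let ?s1 = "set_ireg 26 (i * m) s"
  let ?c = "Do (FCopy (d, 20, 21) (7, 26, 27)) ;; Do (ISucc 27)"
  let ?b = "Do (ILoad 27 0 13) ;; For 21 6 ?c ;; Do (ISucc 26)"
  let ?P = "\<lambda>k s'. \<forall>u<k. \<forall>v<m. farr s' d u v = farr s 7 (i * m + u) (i * m + v)"
  have "sim (For 20 6 ?b) ?s1 (((((1 + 1) + 2) * m + 2) + 1 + 1 + 2) * m + 2) (return_pmf ())
     (\<lambda>_ s'. ?P m s' \<and> ireg s' 26 = i * m + m)"
  proof (rule sim_For_det[where R="\<lambda>k s'. ?P k s' \<and> ireg s' 26 = i * m + k"])
    fix k s1
    assume k: "k < m" and 1: "?P k s1 \<and> ireg s1 26 = i * m + k" "ireg s1 20 = k"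
      and f1: "keeps (For 20 6 ?b) ?s1 s1"
    note r1 = frame_ireg[OF f1] frame_farr[OF f1] frame_iarr[OF f1]
    let ?s2 = "set_ireg 27 (i * m) s1"
    let ?Q = "\<lambda>j s'. (\<forall>u<k. \<forall>v<m. farr s' d u v = farr s 7 (i * m + u) (i * m + v)) \<and>
        (\<forall>v<j. farr s' d k v = farr s 7 (i * m + k) (i * m + v)) \<and> ireg s' 26 = i * m + k \<and> ireg s' 27 = i * m + j"
    have "sim (For 21 6 ?c) ?s2 (((1 + 1) + 2) * m + 2) (return_pmf ()) (\<lambda>_. ?Q m)"
    proof (rule sim_For_det[where R="?Q"])
      fix j s2
      assume j: "j < m" and 2: "?Q j s2" and 3: "ireg s2 21 = j" and f2: "keeps (For 21 6 ?c) ?s2 s2"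
      note r2 = frame_ireg[OF f2] frame_farr[OF f2]
      have 4: "farr s2 7 = farr s 7" "ireg s2 20 = k" using r2 r1 s 1 by simp_all
      show "sim ?c s2 (1 + 1) (return_pmf ()) (\<lambda>_. ?Q (Suc j))"
        by (rule sim_Do_Seq[where s'="set_loc (d, 20, 21) (farr s 7 (i * m + k) (i * m + j)) s2"],
            use 2 3 4 in simp, simp, rule sim_Do_det)
          (use 2 3 4 s(4) in \<open>auto simp: less_Suc_eq\<close>)
    qed (use 1 r1 baseD[OF s(1)] in auto)
    then have "sim (For 21 6 ?c ;; Do (ISucc 26)) ?s2 ((((1 + 1) + 2) * m + 2) + 1) (return_pmf ())
        (\<lambda>_ s'. ?P (Suc k) s' \<and> ireg s' 26 = i * m + Suc k)"
      by (rule sim_Seq_det) (rule sim_Do_det, auto simp: less_Suc_eq)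
    then show "sim ?b s1 ((((1 + 1) + 2) * m + 2) + 1 + 1) (return_pmf ())
        (\<lambda>_ s'. ?P (Suc k) s' \<and> ireg s' 26 = i * m + Suc k)"
      by (rule sim_Do_Seq[rotated 2]) (use r1 s baseD[OF s(1)] in simp_all)
  qed (use baseD[OF s(1)] in auto)
  then have "sim (copy_block d) s (((((1 + 1) + 2) * m + 2) + 1 + 1 + 2) * m + 2 + 1) (return_pmf ())
     (\<lambda>_ s'. ?P m s' \<and> ireg s' 26 = i * m + m)"
    unfolding copy_block_def
    by (rule sim_Do_Seq[rotated 2]) (use s baseD[OF s(1)] in simp_all)
  moreover have "((((1 + 1) + 2) * m + 2) + 1 + 1 + 2) * m + 2 + 1 \<le> 20 * n\<^sup>2"
  proof -
    have "((((1 + 1) + 2) * m + 2) + 1 + 1 + 2) * m \<le> ((((1 + 1) + 2) * n + 2) + 1 + 1 + 2) * n"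
      using m_le by (intro mult_le_mono) auto
    also have "\<dots> = 4 * (n * n) + 6 * n" by (simp add: algebra_simps)
    finally show ?thesis using n_square unfolding power2_eq_square by linarith
  qed
  ultimately show ?thesis
    by (rule sim_mono) auto
qed

definition result :: "int mat option \<Rightarrow> nat \<times> nat \<Rightarrow> int" where
  "result M = (\<lambda>(i, j). case M of None \<Rightarrow> 0 | Some A \<Rightarrow> arr_of_mat A i j)"

text \<open>A congruence, not an equation: the entries returned by an arbitrary black box need not
  be reduced, and the test cannot tell the difference. The later additions reduce them.\<close>

definition correct :: "(nat \<times> nat \<Rightarrow> int) \<Rightarrow> (nat \<times> nat \<Rightarrow> int) \<Rightarrow> (nat \<times> nat \<Rightarrow> int) \<Rightarrow> bool" where
  "correct X Y Z \<longleftrightarrow> (\<forall>i<n. \<forall>j<n. Z (i, j) mod int p = (\<Sum>l<n. X (i, l) * Y (l, j)) mod int p)"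

definition trial :: "(nat \<times> nat \<Rightarrow> int) \<Rightarrow> (nat \<times> nat \<Rightarrow> int) \<Rightarrow> bool option pmf" where
  "trial X Y = bind_pmf (orc (mat n n X) (mat n n Y)) (\<lambda>M.
     map_pmf (\<lambda>ok. if ok then Some (correct X Y (result M)) else None) (check_pmf X Y (result M)))"

definition attempt_pmf :: "nat \<Rightarrow> (nat \<times> nat \<Rightarrow> int) \<Rightarrow> (nat \<times> nat \<Rightarrow> int) \<Rightarrow> bool option pmf" where
  "attempt_pmf i x y = bind_pmf (Umat n) (\<lambda>X. bind_pmf (Umat n) (\<lambda>Y.
     trial (plant i x X) (transp (plant i y (transp Y)))))"

definition find_pmf :: "(nat \<times> nat \<Rightarrow> int) \<Rightarrow> (nat \<times> nat \<Rightarrow> int) \<Rightarrow> bool option pmf" where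
  "find_pmf x y = foldM (\<lambda>_. foldM (\<lambda>_. foldM (\<lambda>_. foldM (\<lambda>i e. map_pmf (upd e) (attempt_pmf i x y))
      [0..<K]) [0..<K]) [0..<K]) [0..<a] None"

text \<open>Nothing is claimed for \<open>Some False\<close>, not even about the flag: accepted
  wrong answers are dealt with only in the abstract distribution, where they are improbable.\<close>

definition found :: "nat \<Rightarrow> nat \<Rightarrow> (nat \<times> nat \<Rightarrow> int) \<Rightarrow> (nat \<times> nat \<Rightarrow> int) \<Rightarrow> bool option \<Rightarrow> state \<Rightarrow> bool" where
  "found d g x y e s \<longleftrightarrow> (e = None \<longrightarrow> ireg s g = 0) \<and> (e = Some True \<longrightarrow> ireg s g = 1 \<and>
     (\<forall>u<m. \<forall>v<m. farr s d u v mod int p = (\<Sum>l<n. x (u, l) * y (v, l)) mod int p))"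

lemma found_frame:
  "found d g x y e s \<Longrightarrow> frame W F J s s' \<Longrightarrow> d \<notin> F \<Longrightarrow> g \<notin> W \<Longrightarrow> found d g x y e s'"
  by (auto simp: found_def frame_def)

lemma sim_Call:
  assumes "holds_mat 5 X s" "holds_mat 6 Y s"
  shows "sim (Do (Call 5 6 7)) s tc (orc (mat n n X) (mat n n Y)) (\<lambda>M s'. holds_mat 7 (result M) s')"
proof -
  have "get_mat n 5 s = mat n n X" "get_mat n 6 s = mat n n Y"
    using assms by (auto simp: get_mat_def holds_mat_def intro!: cong_mat)
  moreover have "holds_mat 7 (result M) (set_mat_arr 7 M s)" for M
    by (auto simp: holds_mat_def result_def set_mat_arr_def split: option.split)
  ultimately show ?thesis
    using sim_Do[of "\<lambda>M s'. holds_mat 7 (result M) s'" "orc (mat n n X) (mat n n Y)" "Call 5 6 7" s]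
    by (simp add: pmf.rel_map rel_pmf_reflI)
qed

lemma sim_cond_skip:
  assumes "ireg s 4 = 0" "0 < ireg s g \<Longrightarrow> sim c s \<tau> (return_pmf x) R" "ireg s g = 0 \<Longrightarrow> R x s"
  shows "sim (Cond (ILess 4 g) c Skip) s (\<tau> + 1) (return_pmf x) R"
proof (rule sim_Cond)
  show "sim (if holds (ILess 4 g) s then c else Skip) s \<tau> (return_pmf x) R"
    using assms by (cases "ireg s g = 0") (auto intro: sim_Skip')
qed

lemma sim_attempt:
  assumes s: "base s" "ireg s 10 = I" "ireg s 11 = J" "ireg s 13 = i" "I < K" "J < K" "i < K"
    and fresh: "50 \<le> b" "50 \<le> c" "50 \<le> d" "50 \<le> g"
    and A: "holds_mat b A s" and B: "holds_mat c B s"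
    and e: "found d g (ext I A) (ext J (transp B)) e s"
  shows "sim (attempt b c d g) s (151 * (K * tc))
     (map_pmf (upd e) (attempt_pmf i (ext I A) (ext J (transp B))))
     (found d g (ext I A) (ext J (transp B)))"
proof -
  let ?x = "ext I A" and ?y = "ext J (transp B)"
  let ?cond = "Cond (ILess 4 23) (copy_block d ;; Do (IZero g) ;; Do (ISucc g)) Skip"
  let ?R = "found d g ?x ?y"
  have "sim (attempt b c d g) s ((8 * n\<^sup>2 + 2) + ((8 * n\<^sup>2 + 2) + (20 * n\<^sup>2 + (20 * n\<^sup>2 + (tc + (50 * K * n\<^sup>2 +
       (20 * n\<^sup>2 + (1 + 1) + 1)))))))
     (bind_pmf (Umat n) (\<lambda>X. bind_pmf (Umat n) (\<lambda>Y.
        let X' = plant i ?x X; Y' = transp (plant i ?y (transp Y)) in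
        bind_pmf (orc (mat n n X') (mat n n Y')) (\<lambda>M.
          bind_pmf (check_pmf X' Y' (result M)) (\<lambda>ok.
            return_pmf (upd e (if ok then Some (correct X' Y' (result M)) else None)))))))
     ?R"
    unfolding attempt_def Let_def
  proof (rule sim_Seq[OF sim_frame[OF sim_fill]])
    fix X s1 assume 1: "holds_mat 5 X s1 \<and> keeps (fill 5) s s1"
    then have f1: "frame {20,21} {5} {} s s1" by simp
    note b1 = base_frame[OF s(1) f1, simplified] and r1 = frame_ireg[OF f1]
    show "sim (fill 6 ;; plant_rows b ;; plant_cols c ;; Do (Call 5 6 7) ;; check ;; ?cond) s1
      ((8 * n\<^sup>2 + 2) + (20 * n\<^sup>2 + (20 * n\<^sup>2 + (tc + (50 * K * n\<^sup>2 + (20 * n\<^sup>2 + (1 + 1) + 1))))))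
      (bind_pmf (Umat n) (\<lambda>Y.
        bind_pmf (orc (mat n n (plant i ?x X)) (mat n n (transp (plant i ?y (transp Y))))) (\<lambda>M.
          bind_pmf (check_pmf (plant i ?x X) (transp (plant i ?y (transp Y))) (result M)) (\<lambda>ok.
            return_pmf (upd e (if ok then Some (correct (plant i ?x X) (transp (plant i ?y (transp Y)))
               (result M)) else None)))))) ?R"
    proof (rule sim_Seq[OF sim_frame[OF sim_fill]])
      fix Y s2 assume 2: "holds_mat 6 Y s2 \<and> keeps (fill 6) s1 s2"
      then have f2: "frame {20,21} {6} {} s1 s2" by simp
      note b2 = base_frame[OF b1 f2, simplified] and r2 = frame_ireg[OF f2]
      let ?X = "plant i ?x X" and ?Y = "transp (plant i ?y (transp Y))"
      have f02: "frame {20,21} {5,6} {} s s2" using f1 f2 by (auto intro: frame_trans frame_mono)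
      show "sim (plant_rows b ;; plant_cols c ;; Do (Call 5 6 7) ;; check ;; ?cond) s2
        (20 * n\<^sup>2 + (20 * n\<^sup>2 + (tc + (50 * K * n\<^sup>2 + (20 * n\<^sup>2 + (1 + 1) + 1)))))
        (bind_pmf (orc (mat n n ?X) (mat n n ?Y)) (\<lambda>M.
          bind_pmf (check_pmf ?X ?Y (result M)) (\<lambda>ok.
            return_pmf (upd e (if ok then Some (correct ?X ?Y (result M)) else None))))) ?R"
      proof (rule sim_Seq_det[OF sim_frame[OF sim_plant_rows]])
        fix s3 assume 3: "holds_mat 5 ?X s3 \<and> keeps (plant_rows b) s2 s3"
        then have f3: "frame {20,21,25,26} {5} {} s2 s3" by simp
        note b3 = base_frame[OF b2 f3, simplified] and r3 = frame_ireg[OF f3]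
        have f03: "frame {20,21,25,26} {5,6} {} s s3" using f02 f3 by (auto intro: frame_trans frame_mono)
        show "sim (plant_cols c ;; Do (Call 5 6 7) ;; check ;; ?cond) s3
          (20 * n\<^sup>2 + (tc + (50 * K * n\<^sup>2 + (20 * n\<^sup>2 + (1 + 1) + 1))))
          (bind_pmf (orc (mat n n ?X) (mat n n ?Y)) (\<lambda>M.
            bind_pmf (check_pmf ?X ?Y (result M)) (\<lambda>ok.
              return_pmf (upd e (if ok then Some (correct ?X ?Y (result M)) else None))))) ?R"
        proof (rule sim_Seq_det[OF sim_frame[OF sim_plant_cols]])
          fix s4 assume 4: "holds_mat 6 ?Y s4 \<and> keeps (plant_cols c) s3 s4"
          then have f4: "frame {20,21,25,26} {6} {} s3 s4" by simp
          note b4 = base_frame[OF b3 f4, simplified]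
          have X4: "holds_mat 5 ?X s4" using 3 holds_mat_frame[OF _ f4] by auto
          have f04: "frame {20,21,25,26} {5,6} {} s s4" using f03 f4 by (auto intro: frame_trans frame_mono)
          show "sim (Do (Call 5 6 7) ;; check ;; ?cond) s4
            (tc + (50 * K * n\<^sup>2 + (20 * n\<^sup>2 + (1 + 1) + 1)))
            (bind_pmf (orc (mat n n ?X) (mat n n ?Y)) (\<lambda>M.
              bind_pmf (check_pmf ?X ?Y (result M)) (\<lambda>ok.
                return_pmf (upd e (if ok then Some (correct ?X ?Y (result M)) else None))))) ?R"
          proof (rule sim_Seq[OF sim_frame[OF sim_Call]])
            fix M s5 assume 5: "holds_mat 7 (result M) s5 \<and> keeps (Do (Call 5 6 7)) s4 s5"
            then have f5: "frame {} {7} {} s4 s5" by simp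
            note b5 = base_frame[OF b4 f5, simplified]
            have f05: "frame {20,21,25,26} {5,6,7} {} s s5" using f04 f5 by (auto intro: frame_trans frame_mono)
            have X5: "holds_mat 5 ?X s5" "holds_mat 6 ?Y s5" using X4 4 holds_mat_frame[OF _ f5] by auto
            show "sim (check ;; ?cond) s5 (50 * K * n\<^sup>2 + (20 * n\<^sup>2 + (1 + 1) + 1))
              (bind_pmf (check_pmf ?X ?Y (result M)) (\<lambda>ok.
                return_pmf (upd e (if ok then Some (correct ?X ?Y (result M)) else None)))) ?R"
            proof (rule sim_Seq[OF sim_frame[OF sim_check]])
              fix ok s6 assume 6: "ireg s6 23 = of_bool ok \<and> keeps check s5 s6"
              then have f6: "frame {20,21,22,23,24} {12,13,30,31,32} {} s5 s6" by simp
              note b6 = base_frame[OF b5 f6, simplified]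
              have f06: "frame {20,21,22,23,24,25,26} {5,6,7,12,13,30,31,32} {} s s6"
                using f05 f6 by (auto intro: frame_trans frame_mono)
              have i6: "ireg s6 13 = i" using frame_ireg[OF f06] s by simp
              have Z6: "holds_mat 7 (result M) s6" using 5 holds_mat_frame[OF _ f6] by auto
              show "sim ?cond s6 (20 * n\<^sup>2 + (1 + 1) + 1)
                (return_pmf (upd e (if ok then Some (correct ?X ?Y (result M)) else None))) ?R"
              proof (rule sim_cond_skip)
                show "ireg s6 4 = 0" using baseD[OF b6] by simp
              next
                assume "ireg s6 23 = 0"
                then have "\<not> ok" using 6 by simp
                moreover have "?R e s6" using e f06 fresh by (auto intro: found_frame)
                ultimately show "?R (upd e (if ok then Some (correct ?X ?Y (result M)) else None)) s6"
                  by simp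
              next
                assume "0 < ireg s6 23"
                then have ok: "ok" using 6 by (cases ok) auto
                have dd: "d \<noteq> 7" using fresh by simp
                show "sim (copy_block d ;; Do (IZero g) ;; Do (ISucc g)) s6 (20 * n\<^sup>2 + (1 + 1))
                  (return_pmf (upd e (if ok then Some (correct ?X ?Y (result M)) else None))) ?R"
                proof (rule sim_Seq_det[OF sim_copy_block[OF b6 i6 s(7) dd]])
                  fix s7 :: state assume 7: "\<forall>u<m. \<forall>v<m. farr s7 d u v = farr s6 7 (i * m + u) (i * m + v)"
                  have "farr s7 d u v mod int p = (\<Sum>l<n. ?x (u, l) * ?y (v, l)) mod int p"
                    if "u < m" "v < m" "correct ?X ?Y (result M)" for u v
                  proof -
                    have "farr s7 d u v mod int p = (\<Sum>l<n. ?X (i * m + u, l) * ?Y (l, i * m + v)) mod int p"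
                      using that 7 Z6 block_less[OF s(7)] by (simp add: holds_mat_def correct_def)
                    \<comment> \<open>Row \<open>i * m + u\<close> and column
                      \<open>i * m + v\<close> both lie entirely in the planted groups, so the
                      random remainder of the two matrices does not enter this entry.\<close>
                    also have "(\<Sum>l<n. ?X (i * m + u, l) * ?Y (l, i * m + v)) = (\<Sum>l<n. ?x (u, l) * ?y (v, l))"
                      using that by (intro sum.cong) (auto simp: plant_def)
                    finally show ?thesis .
                  qed
                  then have R: "?R (Some (correct ?X ?Y (result M))) (set_ireg g 1 (set_ireg g 0 s7))"
                    by (auto simp: found_def)
                  show "sim (Do (IZero g) ;; Do (ISucc g)) s7 (1 + 1)
                    (return_pmf (upd e (if ok then Some (correct ?X ?Y (result M)) else None))) ?R"
                    by (intro sim_Do_Seq[where s'="set_ireg g 0 s7"] sim_Do_det[where s'="set_ireg g 1 (set_ireg g 0 s7)"])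
                      (use R ok in simp_all)
                qed
              qed
            qed (use X5 5 baseD[OF b5] in auto)
          qed (use X4 4 in auto)
        qed (use frame_ireg[OF f03] holds_mat_frame[OF B f03] s b3 2 holds_mat_frame[OF _ f3] fresh in auto)
      qed (use frame_ireg[OF f02] holds_mat_frame[OF A f02] s b2 1 holds_mat_frame[OF _ f2] fresh in auto)
    qed (use baseD[OF b1] in auto)
  qed (use baseD[OF s(1)] in auto)
  moreover have "(bind_pmf (Umat n) (\<lambda>X. bind_pmf (Umat n) (\<lambda>Y.
        let X' = plant i ?x X; Y' = transp (plant i ?y (transp Y)) in
        bind_pmf (orc (mat n n X') (mat n n Y')) (\<lambda>M.
          bind_pmf (check_pmf X' Y' (result M)) (\<lambda>ok.
            return_pmf (upd e (if ok then Some (correct X' Y' (result M)) else None)))))))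
      = map_pmf (upd e) (attempt_pmf i ?x ?y)"
    by (simp add: attempt_pmf_def trial_def Let_def map_pmf_def bind_assoc_pmf bind_return_pmf)
  moreover have "(8 * n\<^sup>2 + 2) + ((8 * n\<^sup>2 + 2) + (20 * n\<^sup>2 + (20 * n\<^sup>2 + (tc + (50 * K * n\<^sup>2 +
       (20 * n\<^sup>2 + (1 + 1) + 1)))))) \<le> 151 * (K * tc)"
  proof -
    have "1 \<le> n\<^sup>2" using n_square by (simp add: power2_eq_square)
    moreover have "K * n\<^sup>2 \<le> K * tc" using tc_ge by simp
    moreover have "tc \<le> K * tc" using K_pos by simp
    moreover have "50 * K * n\<^sup>2 = 50 * (K * n\<^sup>2)" by simp
    ultimately show ?thesis using tc_ge by linarith
  qed
  ultimately show ?thesis by (auto elim: sim_mono)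
qed

text \<open>Applied once per nesting level: loop overhead is absorbed into the product of the trip
  counts by adding 4 to the constant. Four levels turn the 151 of \<open>sim_attempt\<close> into
  167, and one initialisation makes it 168; three levels turn the 800 of \<open>sim_round\<close>
  into 812.\<close>

lemma loop_cost:
  assumes "(\<tau> :: nat) \<le> c * B" "1 \<le> B" "1 \<le> b"
  shows "(\<tau> + 2) * b + 2 \<le> (c + 4) * (B * b)"
proof -
  have "1 \<le> B * b" using assms by (simp add: Suc_le_eq)
  moreover have "b \<le> B * b" using assms by simp
  moreover have "\<tau> * b \<le> c * (B * b)" using assms(1) by (metis mult.assoc mult_le_mono1)
  moreover have "(\<tau> + 2) * b + 2 = \<tau> * b + 2 * b + 2" by simp
  moreover have "(c + 4) * (B * b) = c * (B * b) + 4 * (B * b)" by (rule distrib_right)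
  ultimately show ?thesis by linarith
qed

lemma tc_pos: "1 \<le> tc"
  using order.trans[OF n_square(2) tc_ge[unfolded power2_eq_square]] .

end

section \<open>Products of blocks\<close>

definition add_block :: com where
  "add_block = Do (ILoad 25 0 10) ;;
     For 20 6 (Do (ILoad 26 0 11) ;;
       For 21 6 (Do (FAdd (2, 25, 26) (54, 20, 21) (55, 20, 21)) ;;
         Do (FAdd (2, 25, 26) (2, 25, 26) (56, 20, 21)) ;;
         Do (FAdd (2, 25, 26) (2, 25, 26) (57, 20, 21)) ;; Do (ISucc 26)) ;;
       Do (ISucc 25))"

text \<open>Arrays 50 and 51 split the left input at random, 52 and 53 the right one; 54 to 57
  receive the four cross products. Splitting whole matrices keeps these loops free of offsets at a
  cost of order \<open>n\<^sup>2\<close>. The split is drawn afresh in each round, which makes the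
  rounds independent.\<close>

definition round :: com where
  "round = fill 50 ;; subtract 51 0 50 ;; fill 52 ;; subtract 53 1 52 ;;
     find 50 52 54 50 ;; find 50 53 55 51 ;; find 51 52 56 52 ;; find 51 53 57 53 ;;
     Cond (ILess 4 50) (Cond (ILess 4 51) (Cond (ILess 4 52) (Cond (ILess 4 53)
       add_block Skip) Skip) Skip) Skip"

definition all_blocks :: com where
  "all_blocks = For 10 5 (For 11 5 (For 12 5 round))"

lemma write_sets_all_blocks [simp]:
  "wreg add_block = {20, 21, 25, 26}" "wfar add_block = {2}" "wiar add_block = {}"
  "wreg round = {13, 14, 15, 16, 20, 21, 22, 23, 24, 25, 26, 27, 50, 51, 52, 53}"
  "wfar round = {2, 5, 6, 7, 12, 13, 30, 31, 32, 50, 51, 52, 53, 54, 55, 56, 57}" "wiar round = {}"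
  "wreg all_blocks = {10, 11, 12, 13, 14, 15, 16, 20, 21, 22, 23, 24, 25, 26, 27, 50, 51, 52, 53}"
  "wfar all_blocks = {2, 5, 6, 7, 12, 13, 30, 31, 32, 50, 51, 52, 53, 54, 55, 56, 57}" "wiar all_blocks = {}"
  by (auto simp: add_block_def round_def all_blocks_def)

fun combine :: "bool option \<Rightarrow> bool option \<Rightarrow> bool option \<Rightarrow> bool option \<Rightarrow> bool option" where
  "combine (Some b1) (Some b2) (Some b3) (Some b4) = Some (b1 \<and> b2 \<and> b3 \<and> b4)"
| "combine _ _ _ _ = None"

lemma combine_eq_None: "combine e1 e2 e3 e4 = None \<longleftrightarrow> e1 = None \<or> e2 = None \<or> e3 = None \<or> e4 = None"
  by (cases "(e1, e2, e3, e4)" rule: combine.cases) auto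

lemma combine_eq_True: "combine e1 e2 e3 e4 = Some True \<longleftrightarrow>
    e1 = Some True \<and> e2 = Some True \<and> e3 = Some True \<and> e4 = Some True"
  by (cases "(e1, e2, e3, e4)" rule: combine.cases) auto

text \<open>Bilinearity for entries known only modulo \<open>q\<close>; the nested
  \<open>mod\<close> mirror the three additions of \<open>add_block\<close>.\<close>

lemma block_product_split:
  fixes q :: int
  assumes "\<And>l. l < n \<Longrightarrow> (a l + a' l) mod q = A l mod q" "\<And>l. l < n \<Longrightarrow> (b l + b' l) mod q = B l mod q"
    and "d1 mod q = (\<Sum>l<n. a l * b l) mod q" "d2 mod q = (\<Sum>l<n. a l * b' l) mod q"
    and "d3 mod q = (\<Sum>l<n. a' l * b l) mod q" "d4 mod q = (\<Sum>l<n. a' l * b' l) mod q"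
  shows "(((d1 + d2) mod q + d3) mod q + d4) mod q = (\<Sum>l<(n::nat). A l * B l) mod q"
proof -
  have "(((d1 + d2) mod q + d3) mod q + d4) mod q = (d1 + d2 + d3 + d4) mod q"
    by (simp only: mod_add_left_eq)
  also have "\<dots> = ((\<Sum>l<n. a l * b l) + (\<Sum>l<n. a l * b' l) + (\<Sum>l<n. a' l * b l) + (\<Sum>l<n. a' l * b' l)) mod q"
    by (intro mod_add_cong assms)
  also have "\<dots> = (\<Sum>l<n. (a l + a' l) * (b l + b' l)) mod q"
    by (simp add: sum.distrib[symmetric] algebra_simps)
  also have "\<dots> = (\<Sum>l<n. ((a l + a' l) * (b l + b' l)) mod q) mod q"
    by (rule mod_sum_eq[symmetric])
  also have "\<dots> = (\<Sum>l<n. (A l * B l) mod q) mod q"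
    by (simp add: mod_mult_cong[OF assms(1,2)] cong: sum.cong_simp)
  also have "\<dots> = (\<Sum>l<n. A l * B l) mod q"
    by (rule mod_sum_eq)
  finally show ?thesis .
qed

context machine
begin

text \<open>For nests of loops: all levels are compared with one outer state \<open>s0\<close> and
  one write set, and the invariant does not mention the counter.\<close>

lemma sim_For_frame:
  assumes "x \<noteq> y" "x \<in> W" "wreg c \<subseteq> W" "y \<notin> W" "wfar c \<subseteq> F" "wiar c = {}"
    and "ireg s0 y = b" "frame W F {} s0 s" "R v s"
    and "\<And>e s u. R e s \<Longrightarrow> R e (set_ireg x u s)"
    and body: "\<And>s' e i. i < b \<Longrightarrow> frame W F {} s0 s' \<Longrightarrow> ireg s' x = i \<Longrightarrow> R e s' \<Longrightarrow> sim c s' \<tau> (f i e) R"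
    and xc: "x \<notin> wreg c"
  shows "sim (For x y c) s ((\<tau> + 2) * b + 2) (foldM f [0..<b] v) R"
proof (rule sim_For)
  show "ireg s y = b" using assms frame_ireg by metis
  fix j e s'
  assume "j < b" "R e s'" "ireg s' x = j" and f: "keeps (For x y c) s s'"
  moreover have "frame W F {} s0 s'"
    using assms(2,3,5,6) by (intro frame_trans[OF assms(8)] frame_mono[OF f]) auto
  ultimately show "sim c s' \<tau> (f j e) R" by (intro body)
qed (use assms in auto)

end

context block_algo
begin

text \<open>Three of the factors \<open>K\<close> and the factor \<open>a\<close> come from the
  loops of \<open>find\<close>, the remaining \<open>K\<close> from the repetitions of Freivalds'
  test.\<close>

definition find_cost :: nat where
  "find_cost = tc * K * K * K * K * a"

lemma sim_find:
  assumes s: "base s" "ireg s 10 = I" "ireg s 11 = J" "I < K" "J < K"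
    and fresh: "50 \<le> b" "50 \<le> c" "50 \<le> d" "50 \<le> g" "d \<noteq> b" "d \<noteq> c"
    and A: "holds_mat b A s" and B: "holds_mat c B s"
  shows "sim (find b c d g) s (168 * find_cost) (find_pmf (ext I A) (ext J (transp B)))
     (found d g (ext I A) (ext J (transp B)))"
proof -
  let ?x = "ext I A" and ?y = "ext J (transp B)"
  let ?R = "found d g ?x ?y"
  let ?s = "set_ireg g 0 s"
  let ?W = "{13, 14, 15, 16, 20, 21, 22, 23, 24, 25, 26, 27, g}" and ?F = "{5, 6, 7, 12, 13, 30, 31, 32, d}"
  let ?\<tau> = "151 * (K * tc)"
  have ins: "?R e (set_ireg x u s)" if "?R e s" "x < 50" for e s u x
    using that fresh by (auto simp: found_def)
  have b0: "base ?s" using s(1) fresh by (auto simp: base_def)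
  have "sim (For 14 2 (For 15 5 (For 16 5 (For 13 5 (attempt b c d g))))) ?s
     ((((((((?\<tau> + 2) * K + 2) + 2) * K + 2) + 2) * K + 2) + 2) * a + 2) (find_pmf ?x ?y) ?R"
    unfolding find_pmf_def
  proof (rule sim_For_frame[where W="?W" and F="?F" and ?s0.0="?s"])
    fix s1 e i assume f1: "frame ?W ?F {} ?s s1" "?R e s1"
    show "sim (For 15 5 (For 16 5 (For 13 5 (attempt b c d g)))) s1
      ((((((?\<tau> + 2) * K + 2) + 2) * K + 2) + 2) * K + 2)
      (foldM (\<lambda>_. foldM (\<lambda>_. foldM (\<lambda>i e. map_pmf (upd e) (attempt_pmf i ?x ?y)) [0..<K]) [0..<K]) [0..<K] e) ?R"
    proof (rule sim_For_frame[where W="?W" and F="?F" and ?s0.0="?s"])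
      fix s2 e i assume f2: "frame ?W ?F {} ?s s2" "?R e s2"
      show "sim (For 16 5 (For 13 5 (attempt b c d g))) s2
        ((((?\<tau> + 2) * K + 2) + 2) * K + 2)
        (foldM (\<lambda>_. foldM (\<lambda>i e. map_pmf (upd e) (attempt_pmf i ?x ?y)) [0..<K]) [0..<K] e) ?R"
      proof (rule sim_For_frame[where W="?W" and F="?F" and ?s0.0="?s"])
        fix s3 e i assume f3: "frame ?W ?F {} ?s s3" "?R e s3"
        show "sim (For 13 5 (attempt b c d g)) s3 ((?\<tau> + 2) * K + 2)
          (foldM (\<lambda>i e. map_pmf (upd e) (attempt_pmf i ?x ?y)) [0..<K] e) ?R"
        proof (rule sim_For_frame[where W="?W" and F="?F" and ?s0.0="?s"])
          fix s4 e i assume "i < K" and f4: "frame ?W ?F {} ?s s4" "?R e s4" "ireg s4 13 = i"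
          have b4: "base s4" by (rule base_frame[OF b0 f4(1)]) (use fresh in auto)
          have f04: "frame ?W ?F {} s s4" by (rule frame_set_ireg'[OF f4(1)]) simp
          show "sim (attempt b c d g) s4 ?\<tau> (map_pmf (upd e) (attempt_pmf i ?x ?y)) ?R"
            by (rule sim_attempt[OF b4])
              (use s \<open>i < K\<close> f4 fresh frame_ireg[OF f04] holds_mat_frame[OF A f04] holds_mat_frame[OF B f04] in auto)
        qed (use f3 ins baseD[OF b0] fresh in auto)
      qed (use f2 ins baseD[OF b0] fresh in auto)
    qed (use f1 ins baseD[OF b0] fresh in auto)
  qed (use ins baseD[OF b0] fresh in \<open>auto simp: found_def\<close>)
  then have "sim (find b c d g) s ((((((((?\<tau> + 2) * K + 2) + 2) * K + 2) + 2) * K + 2) + 2) * a + 2 + 1) (find_pmf ?x ?y) ?R"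
    unfolding find_def by (intro sim_Do_Seq[where s'="?s"]) simp_all
  moreover have "(((((((?\<tau> + 2) * K + 2) + 2) * K + 2) + 2) * K + 2) + 2) * a + 2 + 1 \<le> 168 * find_cost"
  proof -
    have 1: "?\<tau> \<le> 151 * (K * tc)" "1 \<le> K * tc" using K_pos tc_pos by (auto simp: Suc_le_eq)
    have 2: "1 \<le> K * tc * K" "1 \<le> K * tc * K * K" "1 \<le> K * tc * K * K * K" "1 \<le> find_cost"
      using K_pos tc_pos a_pos by (auto simp: find_cost_def Suc_le_eq)
    note l1 = loop_cost[OF 1 K_pos]
    note l2 = loop_cost[OF l1 2(1) K_pos]
    note l3 = loop_cost[OF l2 2(2) K_pos]
    note l4 = loop_cost[OF l3 2(3) a_pos]
    have "K * tc * K * K * K * a = find_cost" by (simp add: find_cost_def mult_ac)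
    then show ?thesis using l4 2(4) by simp
  qed
  ultimately show ?thesis by (auto elim: sim_mono)
qed

definition block_ok :: "(nat \<times> nat \<Rightarrow> int) \<Rightarrow> (nat \<times> nat \<Rightarrow> int) \<Rightarrow> nat \<Rightarrow> nat \<Rightarrow> state \<Rightarrow> bool" where
  "block_ok A B I J s \<longleftrightarrow> (\<forall>u<m. \<forall>v<m. farr s 2 (I * m + u) (J * m + v) =
     (\<Sum>l<n. A (I * m + u, l) * B (l, J * m + v)) mod int p)"

text \<open>All blocks of the result share array 2, so \<open>frame\<close> cannot protect finished
  blocks; this is the finer frame condition within that array.\<close>

definition outside :: "nat \<Rightarrow> nat \<Rightarrow> state \<Rightarrow> state \<Rightarrow> bool" where
  "outside I J s s' \<longleftrightarrow> (\<forall>r c. \<not> (I * m \<le> r \<and> r < I * m + m \<and> J * m \<le> c \<and> c < J * m + m) \<longrightarrow>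
     farr s' 2 r c = farr s 2 r c)"

lemma outside_set_ireg [simp]:
  "outside I J s (set_ireg x u s') = outside I J s s'"
  "outside I J (set_ireg x u s) s' = outside I J s s'"
  by (simp_all add: outside_def)

lemma outside_refl [simp]: "outside I J s s"
  by (simp add: outside_def)

lemma sim_add_block:
  assumes s: "base s" "ireg s 10 = I" "ireg s 11 = J" "I < K" "J < K"
  shows "sim add_block s (40 * n\<^sup>2) (return_pmf ()) (\<lambda>_ s'. outside I J s s' \<and>
     (\<forall>u<m. \<forall>v<m. farr s' 2 (I * m + u) (J * m + v) =
       (((farr s 54 u v + farr s 55 u v) mod int p + farr s 56 u v) mod int p + farr s 57 u v) mod int p))"
proof -
  let ?g = "\<lambda>u v. (((farr s 54 u v + farr s 55 u v) mod int p + farr s 56 u v) mod int p + farr s 57 u v) mod int p"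
  let ?s1 = "set_ireg 25 (I * m) s"
  let ?c = "Do (FAdd (2, 25, 26) (54, 20, 21) (55, 20, 21)) ;;
         Do (FAdd (2, 25, 26) (2, 25, 26) (56, 20, 21)) ;;
         Do (FAdd (2, 25, 26) (2, 25, 26) (57, 20, 21)) ;; Do (ISucc 26)"
  let ?b = "Do (ILoad 26 0 11) ;; For 21 6 ?c ;; Do (ISucc 25)"
  let ?P = "\<lambda>k s'. \<forall>u<k. \<forall>v<m. farr s' 2 (I * m + u) (J * m + v) = ?g u v"
  let ?\<tau> = "(1 + 1 + 1 + 1 + 2) * m + 2"
  have L1: "sim (For 20 6 ?b) ?s1 ((?\<tau> + 1 + 1 + 2) * m + 2) (return_pmf ())
     (\<lambda>_ s'. outside I J s s' \<and> ?P m s' \<and> ireg s' 25 = I * m + m)"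
  proof (rule sim_For_det[where R="\<lambda>k s'. outside I J s s' \<and> ?P k s' \<and> ireg s' 25 = I * m + k"])
    fix k s1
    assume k: "k < m" and 1: "outside I J s s1 \<and> ?P k s1 \<and> ireg s1 25 = I * m + k" "ireg s1 20 = k"
      and f1: "keeps (For 20 6 ?b) ?s1 s1"
    note r1 = frame_ireg[OF f1] frame_farr[OF f1] frame_iarr[OF f1]
    let ?s2 = "set_ireg 26 (J * m) s1"
    let ?Q = "\<lambda>j s'. outside I J s s' \<and> ?P k s' \<and>
        (\<forall>v<j. farr s' 2 (I * m + k) (J * m + v) = ?g k v) \<and> ireg s' 25 = I * m + k \<and> ireg s' 26 = J * m + j"
    have "sim (For 21 6 ?c) ?s2 ?\<tau> (return_pmf ()) (\<lambda>_. ?Q m)"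
    proof (rule sim_For_det[where R="?Q"])
      fix j s2
      assume j: "j < m" and 2: "?Q j s2" and 3: "ireg s2 21 = j" and f2: "keeps (For 21 6 ?c) ?s2 s2"
      note r2 = frame_ireg[OF f2] frame_farr[OF f2]
      have 4: "farr s2 54 = farr s 54" "farr s2 55 = farr s 55" "farr s2 56 = farr s 56"
        "farr s2 57 = farr s 57" "ireg s2 20 = k" using r2 r1 s 1 by simp_all
      let ?t1 = "set_loc (2, 25, 26) ((farr s 54 k j + farr s 55 k j) mod int p) s2"
      let ?t2 = "set_loc (2, 25, 26) (((farr s 54 k j + farr s 55 k j) mod int p + farr s 56 k j) mod int p) ?t1"
      let ?t3 = "set_loc (2, 25, 26) (?g k j) ?t2"
      have 5: "ireg s2 25 = I * m + k" "ireg s2 26 = J * m + j" using 2 by simp_all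
      have x1: "exec p n orc (FAdd (2, 25, 26) (54, 20, 21) (55, 20, 21)) s2 = return_pmf ?t1"
        using 3 4 by (simp del: set_loc.simps)
      have x2: "exec p n orc (FAdd (2, 25, 26) (2, 25, 26) (56, 20, 21)) ?t1 = return_pmf ?t2"
        using 3 4 5 by (simp del: set_loc.simps)
      have x3: "exec p n orc (FAdd (2, 25, 26) (2, 25, 26) (57, 20, 21)) ?t2 = return_pmf ?t3"
        using 3 4 5 by (simp del: set_loc.simps)
      have x4: "exec p n orc (ISucc 26) ?t3 = return_pmf (set_ireg 26 (J * m + Suc j) ?t3)"
        using 5 by (simp del: set_loc.simps)
      have c2: "farr ?t3 2 = (farr s2 2)(I * m + k := (farr s2 2 (I * m + k))(J * m + j := ?g k j))"
        using 5 by (simp del: set_loc.simps)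
      have q: "?Q (Suc j) (set_ireg 26 (J * m + Suc j) ?t3)"
        unfolding outside_def set_ireg_simps c2 using 2 k j
        by (auto simp: outside_def less_Suc_eq simp del: set_loc.simps)
      show "sim ?c s2 (1 + 1 + 1 + 1) (return_pmf ()) (\<lambda>_. ?Q (Suc j))"
        by (rule sim_Do_Seq[OF x1], simp, rule sim_Do_Seq[OF x2], simp, rule sim_Do_Seq[OF x3], simp,
            rule sim_Do_det[OF x4], simp, rule q)
    qed (use 1 r1(1)[of 6] baseD(5)[OF s(1)] in simp_all)
    then have L2: "sim (For 21 6 ?c ;; Do (ISucc 25)) ?s2 (?\<tau> + 1) (return_pmf ())
        (\<lambda>_ s'. outside I J s s' \<and> ?P (Suc k) s' \<and> ireg s' 25 = I * m + Suc k)"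
    proof (rule sim_Seq_det)
      fix s2 :: state assume "?Q m s2"
      then show "sim (Do (ISucc 25)) s2 1 (return_pmf ())
        (\<lambda>_ s'. outside I J s s' \<and> ?P (Suc k) s' \<and> ireg s' 25 = I * m + Suc k)"
        by (intro sim_Do_det[where s'="set_ireg 25 (I * m + Suc k) s2"])
          (auto simp: less_Suc_eq)
    qed
    show "sim ?b s1 (?\<tau> + 1 + 1) (return_pmf ())
        (\<lambda>_ s'. outside I J s s' \<and> ?P (Suc k) s' \<and> ireg s' 25 = I * m + Suc k)"
      by (rule sim_Do_Seq[OF _ _ L2]) (use r1 s baseD[OF s(1)] in simp_all)
  qed (use baseD(5)[OF s(1)] in simp_all)
  have "sim add_block s ((?\<tau> + 1 + 1 + 2) * m + 2 + 1) (return_pmf ())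
     (\<lambda>_ s'. outside I J s s' \<and> ?P m s' \<and> ireg s' 25 = I * m + m)"
    unfolding add_block_def
    by (rule sim_Do_Seq[OF _ _ L1]) (use s baseD[OF s(1)] in simp_all)
  moreover have "(?\<tau> + 1 + 1 + 2) * m + 2 + 1 \<le> 40 * n\<^sup>2"
  proof -
    have "(?\<tau> + 1 + 1 + 2) * m \<le> ((1 + 1 + 1 + 1 + 2) * n + 2 + 1 + 1 + 2) * n"
      using m_le by (intro mult_le_mono) auto
    also have "\<dots> = 6 * (n * n) + 6 * n" by (simp add: algebra_simps)
    finally show ?thesis using n_square unfolding power2_eq_square by linarith
  qed
  ultimately show ?thesis
    by (rule sim_mono) auto
qed

definition round_pmf :: "(nat \<times> nat \<Rightarrow> int) \<Rightarrow> (nat \<times> nat \<Rightarrow> int) \<Rightarrow> nat \<Rightarrow> nat \<Rightarrow> bool option pmf" where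
  "round_pmf A B I J = bind_pmf (Umat n) (\<lambda>X. bind_pmf (Umat n) (\<lambda>Y.
     let x = ext I X; x' = ext I (\<lambda>k. (A k - X k) mod int p);
         y = ext J (transp Y); y' = ext J (transp (\<lambda>k. (B k - Y k) mod int p)) in
     bind_pmf (find_pmf x y) (\<lambda>e1. bind_pmf (find_pmf x y') (\<lambda>e2.
     bind_pmf (find_pmf x' y) (\<lambda>e3. map_pmf (\<lambda>e4. combine e1 e2 e3 e4) (find_pmf x' y'))))))"

lemma holds_mat_cong: "(\<And>i j. i < n \<Longrightarrow> j < n \<Longrightarrow> X (i, j) = Y (i, j)) \<Longrightarrow> holds_mat b X s \<Longrightarrow> holds_mat b Y s"
  by (simp add: holds_mat_def)

lemma sim_round:
  assumes s: "base s" "ireg s 10 = I" "ireg s 11 = J" "I < K" "J < K"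
    and A: "holds_mat 0 A s" and B: "holds_mat 1 B s"
    and e: "e = Some True \<Longrightarrow> block_ok A B I J s"
  shows "sim round s (800 * find_cost) (map_pmf (upd e) (round_pmf A B I J))
     (\<lambda>e s'. (e = Some True \<longrightarrow> block_ok A B I J s') \<and> outside I J s s')"
proof -
  let ?R = "\<lambda>e s'. (e = Some True \<longrightarrow> block_ok A B I J s') \<and> outside I J s s'"
  let ?cond = "Cond (ILess 4 50) (Cond (ILess 4 51) (Cond (ILess 4 52) (Cond (ILess 4 53)
       add_block Skip) Skip) Skip) Skip"
  let ?c8 = "find 51 53 57 53 ;; ?cond"
  let ?c7 = "find 51 52 56 52 ;; ?c8"
  let ?c6 = "find 50 53 55 51 ;; ?c7"
  let ?c5 = "find 50 52 54 50 ;; ?c6"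
  let ?c4 = "subtract 53 1 52 ;; ?c5"
  let ?c3 = "fill 52 ;; ?c4"
  let ?c2 = "subtract 51 0 50 ;; ?c3"
  let ?t8 = "168 * find_cost + (40 * n\<^sup>2 + 1 + 1 + 1 + 1)"
  let ?t7 = "168 * find_cost + ?t8"
  let ?t6 = "168 * find_cost + ?t7"
  let ?t5 = "168 * find_cost + ?t6"
  let ?t4 = "(8 * n\<^sup>2 + 2) + ?t5"
  let ?t3 = "(8 * n\<^sup>2 + 2) + ?t4"
  let ?t2 = "(8 * n\<^sup>2 + 2) + ?t3"
  let ?A' = "\<lambda>X k. (A k - X k) mod int p" and ?B' = "\<lambda>Y k. (B k - Y k) mod int p"
  let ?x = "\<lambda>X. ext I X" and ?y = "\<lambda>Y. ext J (transp Y)"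
  let ?d8 = "\<lambda>X Y e1 e2 e3. bind_pmf (find_pmf (?x (?A' X)) (?y (?B' Y))) (\<lambda>e4. return_pmf (upd e (combine e1 e2 e3 e4)))"
  let ?d7 = "\<lambda>X Y e1 e2. bind_pmf (find_pmf (?x (?A' X)) (?y Y)) (?d8 X Y e1 e2)"
  let ?d6 = "\<lambda>X Y e1. bind_pmf (find_pmf (?x X) (?y (?B' Y))) (?d7 X Y e1)"
  let ?d5 = "\<lambda>X Y. bind_pmf (find_pmf (?x X) (?y Y)) (?d6 X Y)"
  let ?W = "{13, 14, 15, 16, 20, 21, 22, 23, 24, 25, 26, 27, 50, 51, 52, 53}"
  let ?F = "{5, 6, 7, 12, 13, 30, 31, 32, 50, 51, 52, 53, 54, 55, 56, 57}"
  have bb: "base s'" if "frame ?W ?F {} s s'" for s'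
    by (rule base_frame[OF s(1) that]) simp_all
  have "sim round s ((8 * n\<^sup>2 + 2) + ?t2) (bind_pmf (Umat n) (\<lambda>X. bind_pmf (Umat n) (\<lambda>Y. ?d5 X Y))) ?R"
    unfolding round_def
  proof (rule sim_Seq[OF sim_frame[OF sim_fill]])
    fix X s1 assume 1: "holds_mat 50 X s1 \<and> keeps (fill 50) s s1"
    then have f1: "frame {20,21} {50} {} s s1" by simp
    have g1: "frame ?W ?F {} s s1" by (rule frame_mono[OF f1]) auto
    note r1 = frame_ireg[OF g1] and b1 = bb[OF g1]
    show "sim ?c2 s1 ?t2 (bind_pmf (Umat n) (\<lambda>Y. ?d5 X Y)) ?R"
    proof (rule sim_Seq_det[OF sim_frame[OF sim_subtract]])
      fix s2 assume 2: "holds_mat 51 (\<lambda>(i, j). (farr s1 0 i j - farr s1 50 i j) mod int p) s2 \<and> keeps (subtract 51 0 50) s1 s2"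
      then have f2: "frame {20,21} {51} {} s1 s2" by simp
      have g2: "frame ?W ?F {} s s2" by (rule frame_trans[OF g1 frame_mono[OF f2]]) auto
      note b2 = bb[OF g2]
      have X2: "holds_mat 50 X s2" using 1 holds_mat_frame[OF _ f2] by simp
      have X2': "holds_mat 51 (?A' X) s2"
        using conjunct1[OF 2] by (rule holds_mat_cong[rotated])
          (use 1 A frame_farr[OF f1] in \<open>auto simp: holds_mat_def\<close>)
      show "sim ?c3 s2 ?t3 (bind_pmf (Umat n) (\<lambda>Y. ?d5 X Y)) ?R"
      proof (rule sim_Seq[OF sim_frame[OF sim_fill]])
        fix Y s3 assume 3: "holds_mat 52 Y s3 \<and> keeps (fill 52) s2 s3"
        then have f3: "frame {20,21} {52} {} s2 s3" by simp
        have g3: "frame ?W ?F {} s s3" by (rule frame_trans[OF g2 frame_mono[OF f3]]) auto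
        note b3 = bb[OF g3]
        have X3: "holds_mat 50 X s3" "holds_mat 51 (?A' X) s3" using X2 X2' holds_mat_frame[OF _ f3] by simp_all
        show "sim ?c4 s3 ?t4 (?d5 X Y) ?R"
        proof (rule sim_Seq_det[OF sim_frame[OF sim_subtract]])
          fix s4 assume 4: "holds_mat 53 (\<lambda>(i, j). (farr s3 1 i j - farr s3 52 i j) mod int p) s4 \<and> keeps (subtract 53 1 52) s3 s4"
          then have f4: "frame {20,21} {53} {} s3 s4" by simp
          have g4: "frame ?W ?F {} s s4" by (rule frame_trans[OF g3 frame_mono[OF f4]]) auto
          note b4 = bb[OF g4]
          have X4: "holds_mat 50 X s4" "holds_mat 51 (?A' X) s4" "holds_mat 52 Y s4"
            using X3 3 holds_mat_frame[OF _ f4] by simp_all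
          have Y4': "holds_mat 53 (?B' Y) s4"
            using conjunct1[OF 4] by (rule holds_mat_cong[rotated])
              (use 3 B frame_farr[OF g3] in \<open>auto simp: holds_mat_def\<close>)
          show "sim ?c5 s4 ?t5 (?d5 X Y) ?R"
          proof (rule sim_Seq[OF sim_frame[OF sim_find]])
            fix e1 s5 assume 5: "found 54 50 (?x X) (?y Y) e1 s5 \<and> keeps (find 50 52 54 50) s4 s5"
            then have f5: "frame {13, 14, 15, 16, 20, 21, 22, 23, 24, 25, 26, 27, 50} {5, 6, 7, 12, 13, 30, 31, 32, 54} {} s4 s5"
              by simp
            have g5: "frame ?W ?F {} s s5" by (rule frame_trans[OF g4 frame_mono[OF f5]]) auto
            note b5 = bb[OF g5]
            have X5: "holds_mat 50 X s5" "holds_mat 51 (?A' X) s5" "holds_mat 52 Y s5" "holds_mat 53 (?B' Y) s5"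
              using X4 Y4' holds_mat_frame[OF _ f5] by simp_all
            show "sim ?c6 s5 ?t6 (?d6 X Y e1) ?R"
            proof (rule sim_Seq[OF sim_frame[OF sim_find]])
              fix e2 s6 assume 6: "found 55 51 (?x X) (?y (?B' Y)) e2 s6 \<and> keeps (find 50 53 55 51) s5 s6"
              then have f6: "frame {13, 14, 15, 16, 20, 21, 22, 23, 24, 25, 26, 27, 51} {5, 6, 7, 12, 13, 30, 31, 32, 55} {} s5 s6"
                by simp
              have g6: "frame ?W ?F {} s s6" by (rule frame_trans[OF g5 frame_mono[OF f6]]) auto
              note b6 = bb[OF g6]
              have X6: "holds_mat 50 X s6" "holds_mat 51 (?A' X) s6" "holds_mat 52 Y s6" "holds_mat 53 (?B' Y) s6"
                using X5 holds_mat_frame[OF _ f6] by simp_all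
              have F6: "found 54 50 (?x X) (?y Y) e1 s6" using 5 found_frame[OF _ f6] by simp
              show "sim ?c7 s6 ?t7 (?d7 X Y e1 e2) ?R"
              proof (rule sim_Seq[OF sim_frame[OF sim_find]])
                fix e3 s7 assume 7: "found 56 52 (?x (?A' X)) (?y Y) e3 s7 \<and> keeps (find 51 52 56 52) s6 s7"
                then have f7: "frame {13, 14, 15, 16, 20, 21, 22, 23, 24, 25, 26, 27, 52} {5, 6, 7, 12, 13, 30, 31, 32, 56} {} s6 s7"
                  by simp
                have g7: "frame ?W ?F {} s s7" by (rule frame_trans[OF g6 frame_mono[OF f7]]) auto
                note b7 = bb[OF g7]
                have X7: "holds_mat 51 (?A' X) s7" "holds_mat 53 (?B' Y) s7"
                  using X6 holds_mat_frame[OF _ f7] by simp_all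
                have F7: "found 54 50 (?x X) (?y Y) e1 s7" "found 55 51 (?x X) (?y (?B' Y)) e2 s7"
                  using F6 6 found_frame[OF _ f7] by simp_all
                show "sim ?c8 s7 ?t8 (?d8 X Y e1 e2 e3) ?R"
                proof (rule sim_Seq[OF sim_frame[OF sim_find]])
                  fix e4 s8 assume 8: "found 57 53 (?x (?A' X)) (?y (?B' Y)) e4 s8 \<and> keeps (find 51 53 57 53) s7 s8"
                  then have f8: "frame {13, 14, 15, 16, 20, 21, 22, 23, 24, 25, 26, 27, 53} {5, 6, 7, 12, 13, 30, 31, 32, 57} {} s7 s8"
                    by simp
                  have g8: "frame ?W ?F {} s s8" by (rule frame_trans[OF g7 frame_mono[OF f8]]) auto
                  note b8 = bb[OF g8]
                  have F8: "found 54 50 (?x X) (?y Y) e1 s8" "found 55 51 (?x X) (?y (?B' Y)) e2 s8"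
                     "found 56 52 (?x (?A' X)) (?y Y) e3 s8" "found 57 53 (?x (?A' X)) (?y (?B' Y)) e4 s8"
                    using F7 7 8 found_frame[OF _ f8] by simp_all
                  have r8: "ireg s8 10 = I" "ireg s8 11 = J" using frame_ireg[OF g8] s by simp_all
                  have C8: "farr s8 2 = farr s 2" using frame_farr[OF g8] by simp
                  \<comment> \<open>A zero flag excludes \<open>Some True\<close> but not
                    \<open>Some False\<close>; in the latter case only the absence of changes
                    outside the block has to be shown.\<close>
                  have skip: "?R (upd e (combine e1 e2 e3 e4)) s8"
                    if "ireg s8 50 = 0 \<or> ireg s8 51 = 0 \<or> ireg s8 52 = 0 \<or> ireg s8 53 = 0"
                  proof -
                    have "combine e1 e2 e3 e4 \<noteq> Some True"
                      using that F8 by (auto simp: combine_eq_True found_def)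
                    then show ?thesis
                      using e C8 by (cases "combine e1 e2 e3 e4") (auto simp: block_ok_def outside_def)
                  qed
                  have none: "combine e1 e2 e3 e4 \<noteq> None"
                    if "0 < ireg s8 50" "0 < ireg s8 51" "0 < ireg s8 52" "0 < ireg s8 53"
                    using that F8 by (auto simp: combine_eq_None found_def)
                  show "sim ?cond s8 (40 * n\<^sup>2 + 1 + 1 + 1 + 1) (return_pmf (upd e (combine e1 e2 e3 e4))) ?R"
                  proof (intro sim_cond_skip skip)
                    assume pos: "0 < ireg s8 50" "0 < ireg s8 51" "0 < ireg s8 52" "0 < ireg s8 53"
                    from none[OF this] obtain w where w: "combine e1 e2 e3 e4 = Some w" by auto
                    have "sim add_block s8 (40 * n\<^sup>2) (map_pmf (\<lambda>_. Some w) (return_pmf ())) ?R"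
                    proof (rule sim_map, rule sim_mono[OF sim_add_block[OF b8 r8 s(4,5)] order.refl], rule conjI)
                      fix u s9
                      assume 9: "outside I J s8 s9 \<and>
                         (\<forall>u<m. \<forall>v<m. farr s9 2 (I * m + u) (J * m + v) =
                           (((farr s8 54 u v + farr s8 55 u v) mod int p + farr s8 56 u v) mod int p + farr s8 57 u v) mod int p)"
                      show "outside I J s s9" using 9 C8 by (auto simp: outside_def)
                      show "Some w = Some True \<longrightarrow> block_ok A B I J s9"
                        unfolding block_ok_def
                      proof (intro impI allI)
                        fix u v assume "Some w = Some True" and uv: "u < m" "v < m"
                        then have all: "e1 = Some True" "e2 = Some True" "e3 = Some True" "e4 = Some True"
                          using w combine_eq_True[of e1 e2 e3 e4] by simp_all
                        have "farr s9 2 (I * m + u) (J * m + v) =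
                           (((farr s8 54 u v + farr s8 55 u v) mod int p + farr s8 56 u v) mod int p + farr s8 57 u v) mod int p"
                          using 9 uv by blast
                        also have "\<dots> = (\<Sum>l<n. A (I * m + u, l) * B (l, J * m + v)) mod int p"
                          by (rule block_product_split[where a="\<lambda>l. X (I * m + u, l)" and a'="\<lambda>l. ?A' X (I * m + u, l)"
                              and b="\<lambda>l. Y (l, J * m + v)" and b'="\<lambda>l. ?B' Y (l, J * m + v)"])
                            (use F8 all uv in \<open>auto simp: found_def ext_def mod_simps\<close>)
                        finally show "farr s9 2 (I * m + u) (J * m + v) = (\<Sum>l<n. A (I * m + u, l) * B (l, J * m + v)) mod int p" .
                      qed
                    qed
                    then show "sim add_block s8 (40 * n\<^sup>2) (return_pmf (upd e (combine e1 e2 e3 e4))) ?R"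
                      by (simp add: w)
                  qed (use baseD[OF b8] in auto)
                qed (use b7 X7 s frame_ireg[OF g7] in auto)
              qed (use b6 X6 s frame_ireg[OF g6] in auto)
            qed (use b5 X5 s frame_ireg[OF g5] in auto)
          qed (use b4 X4 s frame_ireg[OF g4] in auto)
        qed (use baseD[OF b3] in auto)
      qed (use baseD[OF b2] in auto)
    qed (use baseD[OF b1] in auto)
  qed (use baseD[OF s(1)] in auto)
  moreover have "bind_pmf (Umat n) (\<lambda>X. bind_pmf (Umat n) (\<lambda>Y. ?d5 X Y)) = map_pmf (upd e) (round_pmf A B I J)"
    by (simp add: round_pmf_def Let_def map_pmf_def bind_assoc_pmf bind_return_pmf)
  moreover have "(8 * n\<^sup>2 + 2) + ?t2 \<le> 800 * find_cost"
  proof -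
    have "1 \<le> n\<^sup>2" using n_square by (simp add: power2_eq_square)
    moreover have "tc * 1 \<le> tc * (K * K * K * K * a)"
      using K_pos a_pos by (intro mult_le_mono2) (simp add: Suc_le_eq)
    then have "tc \<le> find_cost" unfolding find_cost_def by (simp add: mult_ac)
    ultimately show ?thesis using tc_ge by linarith
  qed
  ultimately show ?thesis by (auto elim: sim_mono)
qed

definition block_pmf :: "(nat \<times> nat \<Rightarrow> int) \<Rightarrow> (nat \<times> nat \<Rightarrow> int) \<Rightarrow> nat \<Rightarrow> nat \<Rightarrow> bool option pmf" where
  "block_pmf A B I J = foldM (\<lambda>_ e. map_pmf (upd e) (round_pmf A B I J)) [0..<K] None"

definition main_pmf :: "(nat \<times> nat \<Rightarrow> int) \<Rightarrow> (nat \<times> nat \<Rightarrow> int) \<Rightarrow> bool pmf" where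
  "main_pmf A B = foldM (\<lambda>I. foldM (\<lambda>J ok. map_pmf (\<lambda>e. ok \<and> e = Some True) (block_pmf A B I J)) [0..<K]) [0..<K] True"

lemma block_disjoint:
  assumes "I * m \<le> r" "r < I * m + m" "I' * m \<le> r" "r < I' * m + m"
  shows "I = (I' :: nat)"
proof (rule ccontr)
  assume "I \<noteq> I'"
  then consider "Suc I \<le> I'" | "Suc I' \<le> I" by linarith
  then show False
  proof cases
    case 1
    then have "Suc I * m \<le> I' * m" by (rule mult_le_mono1)
    then show False using assms by simp
  next
    case 2
    then have "Suc I' * m \<le> I * m" by (rule mult_le_mono1)
    then show False using assms by simp
  qed
qed

lemma block_ok_outside:
  assumes "block_ok A B I' J' s" "outside I J s s'" "(I', J') \<noteq> (I, J)"
  shows "block_ok A B I' J' s'"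
  unfolding block_ok_def
proof (intro allI impI)
  fix u v assume uv: "u < m" "v < m"
  have "\<not> (I * m \<le> I' * m + u \<and> I' * m + u < I * m + m \<and> J * m \<le> J' * m + v \<and> J' * m + v < J * m + m)"
    using block_disjoint[of I "I' * m + u" I'] block_disjoint[of J "J' * m + v" J'] assms(3) uv by auto
  then have "farr s' 2 (I' * m + u) (J' * m + v) = farr s 2 (I' * m + u) (J' * m + v)"
    using assms(2) unfolding outside_def by blast
  then show "farr s' 2 (I' * m + u) (J' * m + v) = (\<Sum>l<n. A (I' * m + u, l) * B (l, J' * m + v)) mod int p"
    using assms(1) uv unfolding block_ok_def by simp
qed

lemma block_ok_set_ireg [simp]: "block_ok A B I J (set_ireg x u s) = block_ok A B I J s"
  by (simp add: block_ok_def)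

lemma outside_trans: "outside I J s s' \<Longrightarrow> outside I J s' s'' \<Longrightarrow> outside I J s s''"
  by (auto simp: outside_def)

lemma sim_all_blocks:
  assumes s: "base s" and A: "holds_mat 0 A s" and B: "holds_mat 1 B s"
  shows "sim all_blocks s (812 * (find_cost * K * K * K)) (main_pmf A B)
     (\<lambda>ok s'. ok \<longrightarrow> (\<forall>I<K. \<forall>J<K. block_ok A B I J s'))"
proof -
  let ?W = "{12, 13, 14, 15, 16, 20, 21, 22, 23, 24, 25, 26, 27, 50, 51, 52, 53}"
  let ?F = "{2, 5, 6, 7, 12, 13, 30, 31, 32, 50, 51, 52, 53, 54, 55, 56, 57}"
  let ?\<tau> = "(800 * find_cost + 2) * K + 2"
  have "sim all_blocks s (((?\<tau> + 2) * K + 2 + 2) * K + 2) (main_pmf A B)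
     (\<lambda>ok s'. ok \<longrightarrow> (\<forall>I<K. \<forall>J<K. block_ok A B I J s'))"
    unfolding all_blocks_def main_pmf_def
  proof (rule sim_For[where R="\<lambda>k ok s'. ok \<longrightarrow> (\<forall>I<k. \<forall>J<K. block_ok A B I J s')"])
    fix I ok s1
    assume I: "I < K" and 1: "ok \<longrightarrow> (\<forall>I'<I. \<forall>J<K. block_ok A B I' J s1)" "ireg s1 10 = I"
      and f1: "keeps (For 10 5 (For 11 5 (For 12 5 round))) s s1"
    have g1: "frame (insert 10 (insert 11 ?W)) ?F {} s s1" by (rule frame_mono[OF f1]) auto
    have b1: "base s1" by (rule base_frame[OF s g1]) simp_all
    have A1: "holds_mat 0 A s1" "holds_mat 1 B s1" using A B holds_mat_frame[OF _ g1] by simp_all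
    have "sim (For 11 5 (For 12 5 round)) s1 ((?\<tau> + 2) * K + 2)
      (foldM (\<lambda>J ok. map_pmf (\<lambda>e. ok \<and> e = Some True) (block_pmf A B I J)) [0..<K] ok)
      (\<lambda>ok s'. ok \<longrightarrow> (\<forall>I'<I. \<forall>J<K. block_ok A B I' J s') \<and> (\<forall>J<K. block_ok A B I J s'))"
    proof (rule sim_For[where R="\<lambda>k ok s'. ok \<longrightarrow> (\<forall>I'<I. \<forall>J<K. block_ok A B I' J s') \<and> (\<forall>J<k. block_ok A B I J s')"])
      fix J ok s2
      assume J: "J < K" and 2: "ok \<longrightarrow> (\<forall>I'<I. \<forall>J<K. block_ok A B I' J s2) \<and> (\<forall>J'<J. block_ok A B I J' s2)" "ireg s2 11 = J"
        and f2: "keeps (For 11 5 (For 12 5 round)) s1 s2"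
      have g2: "frame (insert 11 ?W) ?F {} s1 s2" by (rule frame_mono[OF f2]) auto
      have b2: "base s2" by (rule base_frame[OF b1 g2]) simp_all
      have A2: "holds_mat 0 A s2" "holds_mat 1 B s2" using A1 holds_mat_frame[OF _ g2] by simp_all
      have I2: "ireg s2 10 = I" using frame_ireg[OF g2] 1 by simp
      have "sim (For 12 5 round) s2 ?\<tau> (block_pmf A B I J)
         (\<lambda>e s'. (e = Some True \<longrightarrow> block_ok A B I J s') \<and> outside I J s2 s')"
        unfolding block_pmf_def
      proof (rule sim_For_frame[where W="?W" and F="?F" and ?s0.0="s2"])
        fix s3 e i assume "frame ?W ?F {} s2 s3" and 3: "(e = Some True \<longrightarrow> block_ok A B I J s3) \<and> outside I J s2 s3"
        note g3 = this(1)
        have b3: "base s3" by (rule base_frame[OF b2 g3]) simp_all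
        have "sim round s3 (800 * find_cost) (map_pmf (upd e) (round_pmf A B I J))
           (\<lambda>e s'. (e = Some True \<longrightarrow> block_ok A B I J s') \<and> outside I J s3 s')"
          by (rule sim_round[OF b3]) (use frame_ireg[OF g3] I2 2 I J A2 holds_mat_frame[OF _ g3] 3 in auto)
        then show "sim round s3 (800 * find_cost) (map_pmf (upd e) (round_pmf A B I J))
           (\<lambda>e s'. (e = Some True \<longrightarrow> block_ok A B I J s') \<and> outside I J s2 s')"
          by (rule sim_mono) (use 3 in \<open>auto intro: outside_trans\<close>)
      qed (use baseD[OF b2] in auto)
      then show "sim (For 12 5 round) s2 ?\<tau> (map_pmf (\<lambda>e. ok \<and> e = Some True) (block_pmf A B I J))
         (\<lambda>ok s'. ok \<longrightarrow> (\<forall>I'<I. \<forall>J<K. block_ok A B I' J s') \<and> (\<forall>J'<Suc J. block_ok A B I J' s'))"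
        by (intro sim_map, elim sim_mono)
          (use 2 in \<open>auto simp: less_Suc_eq intro: block_ok_outside\<close>)
    qed (use baseD[OF b1] 1 in auto)
    then show "sim (For 11 5 (For 12 5 round)) s1 ((?\<tau> + 2) * K + 2)
      (foldM (\<lambda>J ok. map_pmf (\<lambda>e. ok \<and> e = Some True) (block_pmf A B I J)) [0..<K] ok)
      (\<lambda>ok s'. ok \<longrightarrow> (\<forall>I'<Suc I. \<forall>J<K. block_ok A B I' J s'))"
      by (rule sim_mono) (auto simp: less_Suc_eq)
  qed (use baseD[OF s] in auto)
  moreover have "((?\<tau> + 2) * K + 2 + 2) * K + 2 \<le> 812 * (find_cost * K * K * K)"
  proof -
    have 1: "1 \<le> find_cost" "1 \<le> find_cost * K" "1 \<le> find_cost * K * K" using K_pos tc_pos a_pos by (auto simp: find_cost_def Suc_le_eq)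
    note l1 = loop_cost[OF order.refl 1(1) K_pos, of 800]
    note l2 = loop_cost[OF l1 1(2) K_pos]
    note l3 = loop_cost[OF l2 1(3) K_pos]
    show ?thesis using l3 by simp
  qed
  ultimately show ?thesis by (auto elim: sim_mono)
qed

end

section \<open>The whole program\<close>

definition dbl :: "nat \<Rightarrow> com" where
  "dbl x = Do (ICopy 22 x) ;; For 23 22 (Do (ISucc x))"

definition log_loop :: "nat \<Rightarrow> com" where
  "log_loop r = Do (IZero 21) ;; Do (ISucc 21) ;; While (ILess 21 r) (dbl 21 ;; Do (ISucc 5))"

text \<open>The factor 64 is a power of two, reached by six doublings, and large enough for both
  \<open>K_power_bound\<close> and \<open>K_exp_bound\<close>.\<close>

definition setup_K :: com where
  "setup_K = Do (IZero 5) ;; Do (ISucc 5) ;; log_loop 2 ;; log_loop 3 ;;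
     dbl 5 ;; dbl 5 ;; dbl 5 ;; dbl 5 ;; dbl 5 ;; dbl 5"

text \<open>Division by counting: register 21 runs through the residues modulo \<open>K\<close> and
  register 6 counts the wraps.\<close>

definition setup_m :: com where
  "setup_m = Do (IZero 6) ;; Do (IZero 21) ;;
     For 22 0 (Do (ISucc 21) ;; Cond (GNot (ILess 21 5)) (Do (IZero 21) ;; Do (ISucc 6)) Skip)"

text \<open>The final value \<open>K * m\<close>, where the leftover rows and columns begin, is kept
  in register 8.\<close>

definition setup_offsets :: com where
  "setup_offsets = Do (IZero 21) ;;
     For 22 5 (Do (IStore 0 22 21) ;; For 23 6 (Do (ISucc 21))) ;; Do (ICopy 8 21)"

definition entry :: com where
  "entry = dot (0, 20, 22) (1, 22, 21) ;; Do (FCopy (2, 20, 21) (30, 4, 4))"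

text \<open>\<open>entry\<close> reads the row from register 20 and the column from register 21, so
  the order of the arguments decides whether leftover rows or leftover columns are filled.\<close>

definition naive :: "nat \<Rightarrow> nat \<Rightarrow> com" where
  "naive x y = Do (ICopy x 8) ;; ForL x 0 (For y 0 entry)"

definition print :: com where
  "print = For 20 0 (For 21 0 (Do (Output 20 21 (2, 20, 21))))"

definition program :: com where
  "program = setup_K ;; setup_m ;; setup_offsets ;; all_blocks ;; naive 20 21 ;; naive 21 20 ;; print"

lemma write_sets_program [simp]:
  "wreg (dbl x) = {22, 23, x}" "wfar (dbl x) = {}" "wiar (dbl x) = {}"
  "wreg (log_loop r) = {5, 21, 22, 23}" "wfar (log_loop r) = {}" "wiar (log_loop r) = {}"
  "wreg setup_K = {5, 21, 22, 23}" "wfar setup_K = {}" "wiar setup_K = {}"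
  "wreg setup_m = {6, 21, 22}" "wfar setup_m = {}" "wiar setup_m = {}"
  "wreg setup_offsets = {8, 21, 22, 23}" "wfar setup_offsets = {}" "wiar setup_offsets = {0}"
  "wreg entry = {22}" "wfar entry = {2, 30, 31}" "wiar entry = {}"
  "wreg (naive x y) = {x, y, 22}" "wfar (naive x y) = {2, 30, 31}" "wiar (naive x y) = {}"
  by (auto simp: dbl_def log_loop_def setup_K_def setup_m_def setup_offsets_def entry_def naive_def)

definition lg :: "nat \<Rightarrow> nat" where
  "lg v = (LEAST j. v \<le> 2 ^ j)"

lemma lg_ge: "v \<le> 2 ^ lg v"
  unfolding lg_def by (rule LeastI[of _ v]) (use less_exp[of v] in auto)

lemma lg_le: "v \<le> 2 ^ j \<Longrightarrow> lg v \<le> j"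
  unfolding lg_def by (rule Least_le)

lemma power_lg_le: "1 \<le> v \<Longrightarrow> 2 ^ lg v \<le> 2 * v"
proof (cases "lg v")
  case (Suc j)
  then have "\<not> v \<le> 2 ^ j" using lg_le[of v j] by auto
  then show ?thesis using Suc by simp
qed auto

lemma lg_le_double: "1 \<le> v \<Longrightarrow> lg v \<le> 2 * v"
  using power_lg_le[of v] less_exp[of "lg v"] by linarith

context machine
begin

lemma sim_dbl:
  assumes "ireg s x = v" "x \<noteq> 22" "x \<noteq> 23"
  shows "sim (dbl x) s (3 * v + 3) (return_pmf ()) (\<lambda>_ s'. ireg s' x = 2 * v)"
proof -
  have L: "sim (For 23 22 (Do (ISucc x))) (set_ireg 22 v s) ((1 + 2) * v + 2) (return_pmf ()) (\<lambda>_ s'. ireg s' x = v + v)"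
  proof (rule sim_For_det[where R="\<lambda>k s'. ireg s' x = v + k"])
    fix j and s' :: state assume "ireg s' x = v + j"
    then show "sim (Do (ISucc x)) s' 1 (return_pmf ()) (\<lambda>_ s'. ireg s' x = v + Suc j)"
      by (intro sim_Do_det[where s'="set_ireg x (v + Suc j) s'"]) auto
  qed (use assms in auto)
  have "sim (dbl x) s ((1 + 2) * v + 2 + 1) (return_pmf ()) (\<lambda>_ s'. ireg s' x = v + v)"
    unfolding dbl_def by (rule sim_Do_Seq[OF _ _ L]) (use assms in simp_all)
  then show ?thesis by (rule sim_mono) auto
qed

lemma sim_log_loop:
  assumes s: "ireg s r = v" "1 \<le> v" "ireg s 5 = k0" "r \<notin> {5, 21, 22, 23}"
  shows "sim (log_loop r) s (20 * v) (return_pmf ()) (\<lambda>_ s'. ireg s' 5 = k0 + lg v)"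
proof -
  let ?c = "dbl 21 ;; Do (ISucc 5)"
  let ?L = "lg v"
  \<comment> \<open>Cost still to come after \<open>j\<close> doublings. Doubling
    \<open>2 ^ j\<close> costs \<open>3 * 2 ^ j + 3\<close>, and the increment and the guard add 2;
    the leading terms telescope, so the loop is linear in \<open>v\<close> and not of order
    \<open>v\<close> times its logarithm.\<close>
  let ?phi = "\<lambda>j. 3 * (2 ^ ?L - 2 ^ j) + 5 * (?L - j) + 1 :: nat"
  let ?I = "\<lambda>j s'. j \<le> ?L \<and> ireg s' 21 = 2 ^ j \<and> ireg s' 5 = k0 + j \<and> ireg s' r = v"
  let ?s2 = "set_ireg 21 1 (set_ireg 21 0 s)"
  have L: "sim (While (ILess 21 r) ?c) ?s2 (?phi 0) (return_pmf ()) (\<lambda>_ s'. ireg s' 5 = k0 + ?L)"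
  proof (rule sim_While_det[where I="\<lambda>k s'. \<exists>j. ?I j s' \<and> k = ?phi j"])
    show "\<exists>j. ?I j ?s2 \<and> ?phi 0 = ?phi j" using s by (intro exI[of _ 0]) auto
  next
    fix k s1 assume "\<exists>j. ?I j s1 \<and> k = ?phi j" and h: "holds (ILess 21 r) s1"
    then obtain j where j: "?I j s1" "k = ?phi j" by blast
    with h have "2 ^ j < v" by simp
    then have "(2::nat) ^ j < 2 ^ ?L" using lg_ge[of v] by linarith
    then have jL: "j < ?L" by (rule power_less_imp_less_exp[rotated]) simp
    have "sim ?c s1 ((3 * 2 ^ j + 3) + 1) (return_pmf ()) (\<lambda>_. ?I (Suc j))"
    proof (rule sim_Seq_det[OF sim_frame[OF sim_dbl]])
      fix s2 assume 2: "ireg s2 21 = 2 * 2 ^ j \<and> keeps (dbl 21) s1 s2"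
      then have f: "keeps (dbl 21) s1 s2" by simp
      show "sim (Do (ISucc 5)) s2 1 (return_pmf ()) (\<lambda>_. ?I (Suc j))"
        by (rule sim_Do_det[where s'="set_ireg 5 (k0 + Suc j) s2"])
          (use 2 frame_ireg[OF f] j s jL in auto)
    qed (use j in auto)
    then have 3: "sim ?c s1 ((3 * 2 ^ j + 3) + 1) (return_pmf ()) (\<lambda>_ s'. \<exists>i. ?I i s' \<and> ?phi (Suc j) = ?phi i)"
      by (rule sim_mono) blast+
    have "(2::nat) ^ Suc j \<le> 2 ^ ?L" using jL by (intro power_increasing) auto
    then have "?phi (Suc j) + ((3 * 2 ^ j + 3) + 1) + 1 \<le> k" using j jL by simp
    with 3 show "\<exists>\<tau> k'. sim ?c s1 \<tau> (return_pmf ()) (\<lambda>_ s'. \<exists>i. ?I i s' \<and> k' = ?phi i) \<and> k' + \<tau> + 1 \<le> k"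
      by blast
  next
    fix k s1 assume "\<exists>j. ?I j s1 \<and> k = ?phi j" and h: "\<not> holds (ILess 21 r) s1"
    then obtain j where j: "?I j s1" "k = ?phi j" by blast
    with h have "?L = j" using lg_le[of v j] by simp
    then show "1 \<le> k \<and> ireg s1 5 = k0 + ?L" using j by simp
  qed
  have "sim (log_loop r) s (?phi 0 + 1 + 1) (return_pmf ()) (\<lambda>_ s'. ireg s' 5 = k0 + ?L)"
    unfolding log_loop_def
    by (rule sim_Do_Seq[where s'="set_ireg 21 0 s", OF _ _ sim_Do_Seq[OF _ _ L]]) simp_all
  moreover have "?phi 0 + 1 + 1 \<le> 20 * v"
    using power_lg_le[OF s(2)] lg_le_double[OF s(2)] s(2) by simp
  ultimately show ?thesis by (auto elim: sim_mono)
qed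

lemma sim_setup_K:
  assumes s: "ireg s 2 = a" "ireg s 3 = d" "1 \<le> a" "1 \<le> d"
  shows "sim setup_K s (5000 * (a + d)) (return_pmf ()) (\<lambda>_ s'. ireg s' 5 = 64 * (1 + lg a + lg d))"
proof -
  let ?u = "1 + lg a + lg d"
  let ?s2 = "set_ireg 5 1 (set_ireg 5 0 s)"
  let ?d1 = "dbl 5 :: com"
  have d: "sim ?d1 s' (192 * ?u) (return_pmf ()) (\<lambda>_ s'. ireg s' 5 = 2 * w)"
    if "ireg s' 5 = w" "w \<le> 32 * ?u" for s' w
    by (rule sim_mono[OF sim_dbl[OF that(1)]]) (use that in auto)
  have d6: "sim (?d1 ;; ?d1 ;; ?d1 ;; ?d1 ;; ?d1 ;; ?d1) s'
      (192 * ?u + (192 * ?u + (192 * ?u + (192 * ?u + (192 * ?u + 192 * ?u)))))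
      (return_pmf ()) (\<lambda>_ s'. ireg s' 5 = 2 * (32 * ?u))" if "ireg s' 5 = ?u" for s'
    by (rule sim_Seq_det[OF d[of _ ?u]], use that in simp, simp,
        rule sim_Seq_det[OF d[of _ "2 * ?u"]], assumption, simp,
        rule sim_Seq_det[OF d[of _ "4 * ?u"]], simp, simp,
        rule sim_Seq_det[OF d[of _ "8 * ?u"]], simp, simp,
        rule sim_Seq_det[OF d[of _ "16 * ?u"]], simp, simp,
        rule d[of _ "32 * ?u"]) simp_all
  have L: "sim (log_loop 2 ;; log_loop 3 ;; ?d1 ;; ?d1 ;; ?d1 ;; ?d1 ;; ?d1 ;; ?d1) ?s2
      (20 * a + (20 * d + (192 * ?u + (192 * ?u + (192 * ?u + (192 * ?u + (192 * ?u + 192 * ?u)))))))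
      (return_pmf ()) (\<lambda>_ s'. ireg s' 5 = 2 * (32 * ?u))"
  proof (rule sim_Seq_det[OF sim_frame[OF sim_log_loop]])
    fix s3 assume 3: "ireg s3 5 = 1 + lg a \<and> keeps (log_loop 2) ?s2 s3"
    then have f: "keeps (log_loop 2) ?s2 s3" by simp
    show "sim (log_loop 3 ;; ?d1 ;; ?d1 ;; ?d1 ;; ?d1 ;; ?d1 ;; ?d1) s3
      (20 * d + (192 * ?u + (192 * ?u + (192 * ?u + (192 * ?u + (192 * ?u + 192 * ?u))))))
      (return_pmf ()) (\<lambda>_ s'. ireg s' 5 = 2 * (32 * ?u))"
      by (rule sim_Seq_det[OF sim_log_loop d6]) (use 3 frame_ireg[OF f] s in auto)
  qed (use s in auto)
  have "sim setup_K s (20 * a + (20 * d + (192 * ?u + (192 * ?u + (192 * ?u + (192 * ?u + (192 * ?u + 192 * ?u)))))) + 1 + 1)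
      (return_pmf ()) (\<lambda>_ s'. ireg s' 5 = 2 * (32 * ?u))"
    unfolding setup_K_def
    by (rule sim_Do_Seq[where s'="set_ireg 5 0 s", OF _ _ sim_Do_Seq[OF _ _ L]]) simp_all
  moreover have "20 * a + (20 * d + (192 * ?u + (192 * ?u + (192 * ?u + (192 * ?u + (192 * ?u + 192 * ?u)))))) + 1 + 1
      \<le> 5000 * (a + d)"
    using lg_le_double[OF s(3)] lg_le_double[OF s(4)] s by simp
  ultimately show ?thesis by (auto elim: sim_mono)
qed

end

context block_algo
begin

lemma sim_setup_m:
  assumes s: "ireg s 0 = n" "ireg s 5 = K"
  shows "sim setup_m s (6 * n + 4) (return_pmf ()) (\<lambda>_ s'. ireg s' 6 = m)"
proof -
  let ?b = "Do (ISucc 21) ;; Cond (GNot (ILess 21 5)) (Do (IZero 21) ;; Do (ISucc 6)) Skip"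
  let ?s2 = "set_ireg 21 0 (set_ireg 6 0 s)"
  let ?I = "\<lambda>k s'. K * ireg s' 6 + ireg s' 21 = k \<and> ireg s' 21 < K"
  have L: "sim (For 22 0 ?b) ?s2 ((1 + 1 + 1 + 1 + 2) * n + 2) (return_pmf ()) (\<lambda>_. ?I n)"
  proof (rule sim_For_det[where R="?I"])
    fix k s1 assume 1: "?I k s1" and f: "keeps (For 22 0 ?b) ?s2 s1"
    let ?s3 = "set_ireg 21 (ireg s1 21 + 1) s1"
    have K1: "ireg s1 5 = K" using frame_ireg[OF f] s by simp
    have "sim (Cond (GNot (ILess 21 5)) (Do (IZero 21) ;; Do (ISucc 6)) Skip) ?s3 (1 + 1 + 1) (return_pmf ()) (\<lambda>_. ?I (Suc k))"
    proof (rule sim_Cond, cases "ireg s1 21 + 1 < K")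
      case True
      then show "sim (if holds (GNot (ILess 21 5)) ?s3 then Do (IZero 21) ;; Do (ISucc 6) else Skip) ?s3
         (1 + 1) (return_pmf ()) (\<lambda>_. ?I (Suc k))"
        using 1 K1 by (auto intro!: sim_Skip')
    next
      case False
      have "?I (Suc k) (set_ireg 6 (ireg s1 6 + 1) (set_ireg 21 0 ?s3))"
        using False 1 K_pos by (auto simp: algebra_simps)
      then have "sim (Do (IZero 21) ;; Do (ISucc 6)) ?s3 (1 + 1) (return_pmf ()) (\<lambda>_. ?I (Suc k))"
        by (intro sim_Do_Seq[where s'="set_ireg 21 0 ?s3"]
            sim_Do_det[where s'="set_ireg 6 (ireg s1 6 + 1) (set_ireg 21 0 ?s3)"]) simp_all
      then show "sim (if holds (GNot (ILess 21 5)) ?s3 then Do (IZero 21) ;; Do (ISucc 6) else Skip) ?s3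
         (1 + 1) (return_pmf ()) (\<lambda>_. ?I (Suc k))"
        using False K1 by simp
    qed
    note L3 = this
    show "sim ?b s1 (1 + 1 + 1 + 1) (return_pmf ()) (\<lambda>_. ?I (Suc k))"
      by (rule sim_Do_Seq[OF _ _ L3]) simp_all
  qed (use s K_pos in auto)
  have "sim setup_m s ((1 + 1 + 1 + 1 + 2) * n + 2 + 1 + 1) (return_pmf ()) (\<lambda>_. ?I n)"
    unfolding setup_m_def by (rule sim_Do_Seq[OF _ _ sim_Do_Seq[OF _ _ L]]) simp_all
  then show ?thesis
    by (rule sim_mono) (auto simp: m_def intro!: div_nat_eqI[symmetric] simp: algebra_simps)
qed

lemma sim_setup_offsets:
  assumes s: "ireg s 5 = K" "ireg s 6 = m"
  shows "sim setup_offsets s (3 * n + 5 * K + 4) (return_pmf ())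
     (\<lambda>_ s'. (\<forall>t<K. iarr s' 0 t = t * m) \<and> ireg s' 8 = K * m)"
proof -
  let ?c = "Do (ISucc 21)"
  let ?b = "Do (IStore 0 22 21) ;; For 23 6 ?c"
  let ?I = "\<lambda>k s'. (\<forall>t<k. iarr s' 0 t = t * m) \<and> ireg s' 21 = k * m"
  have L: "sim (For 22 5 ?b) (set_ireg 21 0 s) (((1 + 2) * m + 2 + 1 + 2) * K + 2) (return_pmf ()) (\<lambda>_. ?I K)"
  proof (rule sim_For_det[where R="?I"])
    fix k s1 assume 1: "?I k s1" "ireg s1 22 = k" and f: "keeps (For 22 5 ?b) (set_ireg 21 0 s) s1"
    have m1: "ireg s1 6 = m" using frame_ireg[OF f] s by simp
    let ?s2 = "s1\<lparr>iarr := (iarr s1)(0 := (iarr s1 0)(k := k * m))\<rparr>"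
    have L2: "sim (For 23 6 ?c) ?s2 ((1 + 2) * m + 2) (return_pmf ())
       (\<lambda>_ s'. (\<forall>t<Suc k. iarr s' 0 t = t * m) \<and> ireg s' 21 = k * m + m)"
    proof (rule sim_For_det[where R="\<lambda>i s'. (\<forall>t<Suc k. iarr s' 0 t = t * m) \<and> ireg s' 21 = k * m + i"])
      fix j and s' :: state assume "(\<forall>t<Suc k. iarr s' 0 t = t * m) \<and> ireg s' 21 = k * m + j"
      then show "sim ?c s' 1 (return_pmf ()) (\<lambda>_ s'. (\<forall>t<Suc k. iarr s' 0 t = t * m) \<and> ireg s' 21 = k * m + Suc j)"
        by (intro sim_Do_det[where s'="set_ireg 21 (k * m + Suc j) s'"]) auto
    qed (use 1 m1 in \<open>auto simp: less_Suc_eq\<close>)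
    have "sim ?b s1 ((1 + 2) * m + 2 + 1) (return_pmf ())
       (\<lambda>_ s'. (\<forall>t<Suc k. iarr s' 0 t = t * m) \<and> ireg s' 21 = k * m + m)"
      by (rule sim_Do_Seq[OF _ _ L2]) (use 1 in simp_all)
    then show "sim ?b s1 ((1 + 2) * m + 2 + 1) (return_pmf ()) (\<lambda>_. ?I (Suc k))"
      by (rule sim_mono) auto
  qed (use s in auto)
  have L': "sim (For 22 5 ?b ;; Do (ICopy 8 21)) (set_ireg 21 0 s) (((1 + 2) * m + 2 + 1 + 2) * K + 2 + 1) (return_pmf ())
     (\<lambda>_ s'. (\<forall>t<K. iarr s' 0 t = t * m) \<and> ireg s' 8 = K * m)"
  proof (rule sim_Seq_det[OF L])
    fix s1 :: state assume "?I K s1"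
    then show "sim (Do (ICopy 8 21)) s1 1 (return_pmf ()) (\<lambda>_ s'. (\<forall>t<K. iarr s' 0 t = t * m) \<and> ireg s' 8 = K * m)"
      by (intro sim_Do_det[where s'="set_ireg 8 (K * m) s1"]) auto
  qed
  have "sim setup_offsets s (((1 + 2) * m + 2 + 1 + 2) * K + 2 + 1 + 1) (return_pmf ())
     (\<lambda>_ s'. (\<forall>t<K. iarr s' 0 t = t * m) \<and> ireg s' 8 = K * m)"
    unfolding setup_offsets_def by (rule sim_Do_Seq[OF _ _ L']) simp_all
  moreover have "((1 + 2) * m + 2 + 1 + 2) * K + 2 + 1 + 1 \<le> 3 * n + 5 * K + 4"
  proof -
    have "m * K \<le> n" by (simp add: m_def)
    moreover have "((1 + 2) * m + 2 + 1 + 2) * K + 2 + 1 + 1 = 3 * (m * K) + 5 * K + 4"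
      by (simp add: algebra_simps)
    ultimately show ?thesis by linarith
  qed
  ultimately show ?thesis by (auto elim: sim_mono)
qed

definition entry_ok :: "(nat \<times> nat \<Rightarrow> int) \<Rightarrow> (nat \<times> nat \<Rightarrow> int) \<Rightarrow> state \<Rightarrow> nat \<Rightarrow> nat \<Rightarrow> bool" where
  "entry_ok A B s i j \<longleftrightarrow> farr s 2 i j = (\<Sum>l<n. A (i, l) * B (l, j)) mod int p"

lemma entry_ok_set_ireg [simp]: "entry_ok A B (set_ireg x u s) = entry_ok A B s"
  by (simp add: entry_ok_def fun_eq_iff)

text \<open>Recomputing an entry that is already right rewrites the same value. Hence the two naive
  passes may overlap in the lower right corner.\<close>

lemma sim_entry:
  assumes s: "base s" "ireg s 20 = i" "ireg s 21 = j" "i < n" "j < n"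
    and A: "holds_mat 0 A s" and B: "holds_mat 1 B s"
  shows "sim entry s (4 * n + 4) (return_pmf ()) (\<lambda>_ s'. entry_ok A B s' i j \<and>
     (\<forall>i' j'. entry_ok A B s i' j' \<longrightarrow> entry_ok A B s' i' j'))"
proof -
  let ?v = "(\<Sum>l<n. A (i, l) * B (l, j)) mod int p"
  have "sim entry s (4 * n + 3 + 1) (return_pmf ()) (\<lambda>_ s'. entry_ok A B s' i j \<and>
     (\<forall>i' j'. entry_ok A B s i' j' \<longrightarrow> entry_ok A B s' i' j'))"
    unfolding entry_def
  proof (rule sim_Seq_det[OF sim_frame[OF sim_dot]])
    fix s1 assume 1: "farr s1 30 0 0 = (\<Sum>l<n. get_loc (set_ireg 22 l s) (0, 20, 22) *
      get_loc (set_ireg 22 l s) (1, 22, 21)) mod int p \<and> keeps (dot (0, 20, 22) (1, 22, 21)) s s1"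
    then have f: "keeps (dot (0, 20, 22) (1, 22, 21)) s s1" by simp
    have v: "farr s1 30 0 0 = ?v"
      using 1 s A B by (auto simp: holds_mat_def intro!: arg_cong[where f="\<lambda>x. x mod int p"] sum.cong)
    have "farr s1 2 = farr s 2" "ireg s1 4 = 0" "ireg s1 20 = i" "ireg s1 21 = j"
      using frame_farr[OF f] frame_ireg[OF f] s baseD[OF s(1)] by simp_all
    with v show "sim (Do (FCopy (2, 20, 21) (30, 4, 4))) s1 1 (return_pmf ())
      (\<lambda>_ s'. entry_ok A B s' i j \<and> (\<forall>i' j'. entry_ok A B s i' j' \<longrightarrow> entry_ok A B s' i' j'))"
      by (intro sim_Do_det[where s'="set_loc (2, 20, 21) ?v s1"]) (auto simp: entry_ok_def)
  qed (use baseD[OF s(1)] in auto)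
  then show ?thesis by (rule sim_mono) auto
qed

text \<open>There are \<open>n mod K\<close> leftover lines, and each takes \<open>n\<close> inner
  products, that is \<open>O(n\<^sup>2)\<close>, which \<open>tc_ge\<close> charges to one
  call.\<close>

lemma naive_cost: "((4 * n + 4 + 2) * n + 2 + 2) * (n - K * m) + 1 + 1 \<le> 20 * (K * tc)"
proof -
  have "n - K * m = n mod K" by (simp add: m_def minus_mult_div_eq_mod)
  then have "n - K * m \<le> K" using K_pos by (simp add: less_imp_le)
  then have "((4 * n + 4 + 2) * n + 2 + 2) * (n - K * m) \<le> ((4 * n + 4 + 2) * n + 2 + 2) * K"
    by (rule mult_le_mono2)
  also have "\<dots> \<le> (14 * tc) * K"
  proof (rule mult_le_mono1)
    have "(4 * n + 4 + 2) * n + 2 + 2 = 4 * (n * n) + 6 * n + 4" by (simp add: algebra_simps)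
    then show "(4 * n + 4 + 2) * n + 2 + 2 \<le> 14 * tc"
      using n_square tc_ge unfolding power2_eq_square by linarith
  qed
  also have "\<dots> = 14 * (K * tc)" by simp
  finally show ?thesis using mult_le_mono[OF K_pos tc_pos] by linarith
qed

lemma sim_naive:
  assumes xy: "x = 20 \<and> y = 21 \<or> x = 21 \<and> y = 20"
    and s: "base s" "ireg s 8 = K * m" and A: "holds_mat 0 A s" and B: "holds_mat 1 B s"
  shows "sim (naive x y) s (20 * (K * tc)) (return_pmf ()) (\<lambda>_ s'.
     (\<forall>i j. entry_ok A B s i j \<longrightarrow> entry_ok A B s' i j) \<and>
     (\<forall>i\<ge>K * m. \<forall>j<n. i < n \<longrightarrow> (if x = 20 then entry_ok A B s' i j else entry_ok A B s' j i)))"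
proof -
  let ?s1 = "set_ireg x (K * m) s"
  let ?ok = "\<lambda>s' i j. if x = 20 then entry_ok A B s' i j else entry_ok A B s' j i"
  let ?P = "\<lambda>s s'. \<forall>i j. entry_ok A B s i j \<longrightarrow> entry_ok A B s' i j"
  have b1: "base ?s1" using s(1) xy by (auto simp: base_def)
  have AB1: "holds_mat 0 A ?s1" "holds_mat 1 B ?s1" using A B by (simp_all add: holds_mat_def)
  have Kn: "K * m \<le> n" by (simp add: m_def)
  have L: "sim (ForL x 0 (For y 0 entry)) ?s1 (((4 * n + 4 + 2) * n + 2 + 2) * (n - K * m) + 1) (return_pmf ())
     (\<lambda>_ s'. ?P s s' \<and> (\<forall>i\<ge>K * m. \<forall>j<n. i < n \<longrightarrow> ?ok s' i j))"
  proof (rule sim_ForL_det[where R="\<lambda>k s'. ?P s s' \<and> (\<forall>i\<ge>K * m. \<forall>j<n. i < k \<longrightarrow> ?ok s' i j)"])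
    fix i s2 assume i: "K * m \<le> i" "i < n" and 2: "?P s s2 \<and> (\<forall>i'\<ge>K * m. \<forall>j<n. i' < i \<longrightarrow> ?ok s2 i' j)"
        "ireg s2 x = i" and f2: "keeps (ForL x 0 (For y 0 entry)) ?s1 s2"
    have b2: "base s2" by (rule base_frame[OF b1 f2]) (use xy in auto)
    have "sim (For y 0 entry) s2 ((4 * n + 4 + 2) * n + 2) (return_pmf ())
      (\<lambda>_ s'. ?P s2 s' \<and> (\<forall>j<n. ?ok s' i j))"
    proof (rule sim_For_det[where R="\<lambda>k s'. ?P s2 s' \<and> (\<forall>j<k. ?ok s' i j)"])
      fix j s3 assume j: "j < n" and 3: "?P s2 s3 \<and> (\<forall>j'<j. ?ok s3 i j')"
        "ireg s3 y = j" and f3: "keeps (For y 0 entry) s2 s3"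
      have b3: "base s3" by (rule base_frame[OF b2 f3]) (use xy in auto)
      have r3: "ireg s3 x = i" using frame_ireg[OF f3, of x] 2 xy by auto
      have AB3: "holds_mat 0 A s3" "holds_mat 1 B s3"
        using holds_mat_frame[OF holds_mat_frame[OF AB1(1) f2] f3] holds_mat_frame[OF holds_mat_frame[OF AB1(2) f2] f3]
        by simp_all
      show "sim entry s3 (4 * n + 4) (return_pmf ()) (\<lambda>_ s'. ?P s2 s' \<and> (\<forall>j'<Suc j. ?ok s' i j'))"
        using xy
      proof
        assume "x = 20 \<and> y = 21"
        then show ?thesis
          using 3 r3 by (intro sim_mono[OF sim_entry[OF b3 _ _ i(2) j AB3]]) (auto simp: less_Suc_eq)
      next
        assume "x = 21 \<and> y = 20"
        then show ?thesis
          using 3 r3 by (intro sim_mono[OF sim_entry[OF b3 _ _ j i(2) AB3]]) (auto simp: less_Suc_eq)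
      qed
    qed (use baseD[OF b2] xy in auto)
    then show "sim (For y 0 entry) s2 ((4 * n + 4 + 2) * n + 2) (return_pmf ())
      (\<lambda>_ s'. ?P s s' \<and> (\<forall>i'\<ge>K * m. \<forall>j<n. i' < Suc i \<longrightarrow> ?ok s' i' j))"
      by (rule sim_mono) (use 2 in \<open>auto simp: less_Suc_eq\<close>)
  qed (use baseD[OF b1] Kn xy in auto)
  have "sim (naive x y) s (((4 * n + 4 + 2) * n + 2 + 2) * (n - K * m) + 1 + 1) (return_pmf ())
     (\<lambda>_ s'. ?P s s' \<and> (\<forall>i\<ge>K * m. \<forall>j<n. i < n \<longrightarrow> ?ok s' i j))"
    unfolding naive_def by (rule sim_Do_Seq[OF _ _ L]) (use s in simp_all)
  then show ?thesis using naive_cost by (auto elim: sim_mono)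
qed

lemma sim_print:
  assumes s: "ireg s 0 = n"
  shows "sim print s (8 * n\<^sup>2 + 2) (return_pmf ()) (\<lambda>_ s'. \<forall>i<n. \<forall>j<n. outp s' i j = Some (farr s 2 i j))"
proof -
  let ?b = "Do (Output 20 21 (2, 20, 21))"
  let ?g = "\<lambda>i j. Some (farr s 2 i j)"
  have "sim print s ((((1 + 2) * n + 2) + 2) * n + 2) (return_pmf ())
      (\<lambda>_ s'. \<forall>i<n. \<forall>j<n. outp s' i j = ?g i j)"
    unfolding print_def
  proof (rule sim_For_det[where R="\<lambda>i s'. \<forall>i'<i. \<forall>j<n. outp s' i' j = ?g i' j"])
    fix i and s1 :: state
    assume 1: "\<forall>i'<i. \<forall>j<n. outp s1 i' j = ?g i' j" "ireg s1 20 = i" "ireg s1 0 = n"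
      and f1: "keeps (For 20 0 (For 21 0 ?b)) s s1"
    have "sim (For 21 0 ?b) s1 ((1 + 2) * n + 2) (return_pmf ())
        (\<lambda>_ s'. (\<forall>i'<i. \<forall>j<n. outp s' i' j = ?g i' j) \<and> (\<forall>j<n. outp s' i j = ?g i j))"
    proof (rule sim_For_det[where R="\<lambda>j' s'. (\<forall>i'<i. \<forall>j<n. outp s' i' j = ?g i' j) \<and>
        (\<forall>j<j'. outp s' i j = ?g i j)"])
      fix j s'
      assume a: "(\<forall>i'<i. \<forall>j<n. outp s' i' j = ?g i' j) \<and> (\<forall>j'<j. outp s' i j' = ?g i j')"
         "ireg s' 21 = j" "keeps (For 21 0 ?b) s1 s'"
      have "ireg s' 20 = i" using frame_ireg[OF a(3), of 20] 1 by simp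
      moreover have "farr s' 2 = farr s 2"
        using frame_farr[OF a(3)] frame_farr[OF f1] by auto
      ultimately show "sim ?b s' 1 (return_pmf ()) (\<lambda>_ s'. (\<forall>i'<i. \<forall>j<n. outp s' i' j = ?g i' j) \<and>
          (\<forall>j'<Suc j. outp s' i j' = ?g i j'))"
        using a by (intro sim_Do_det) (auto simp: less_Suc_eq)
    qed (use 1 in auto)
    then show "sim (For 21 0 ?b) s1 ((1 + 2) * n + 2) (return_pmf ())
        (\<lambda>_ s'. \<forall>i'<Suc i. \<forall>j<n. outp s' i' j = ?g i' j)"
      by (rule sim_mono) (auto simp: less_Suc_eq)
  qed (use assms in auto)
  moreover have "((((1 + 2) * n + 2) + 2) * n + 2) \<le> 8 * n\<^sup>2 + 2"
  proof -
    have "((((1 + 2) * n + 2) + 2) * n + 2) = 3 * (n * n) + 4 * n + 2" by (simp add: algebra_simps)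
    then show ?thesis using n_square unfolding power2_eq_square by linarith
  qed
  ultimately show ?thesis by (auto elim: sim_mono)
qed

lemma block_ok_entry_ok:
  assumes "\<forall>I<K. \<forall>J<K. block_ok A B I J s" "i < K * m" "j < K * m"
  shows "entry_ok A B s i j"
proof -
  have "0 < m" using assms(2) by (cases m) auto
  then have "i div m < K" "j div m < K" "i mod m < m" "j mod m < m"
    using assms(2,3) by (auto simp: less_mult_imp_div_less)
  then have "farr s 2 (i div m * m + i mod m) (j div m * m + j mod m) =
     (\<Sum>l<n. A (i div m * m + i mod m, l) * B (l, j div m * m + j mod m)) mod int p"
    using assms(1) unfolding block_ok_def by blast
  then show ?thesis unfolding entry_ok_def by (simp only: div_mult_mod_eq)
qed

lemma sim_program:
  assumes s: "ireg s 0 = n" "ireg s 2 = a" "ireg s 3 = d" "ireg s 4 = 0" "1 \<le> d"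
    and K: "K = 64 * (1 + lg a + lg d)"
    and A: "holds_mat 0 A s" and B: "holds_mat 1 B s"
  shows "sim program s (5000 * (a + d) + 1000 * (find_cost * K * K * K)) (main_pmf A B)
     (\<lambda>ok s'. ok \<longrightarrow> output_mat n s' = Some (mat n n (\<lambda>(i, j). (\<Sum>l<n. A (i, l) * B (l, j)) mod int p)))"
proof -
  let ?R = "\<lambda>ok s'. ok \<longrightarrow> output_mat n s' = Some (mat n n (\<lambda>(i, j). (\<Sum>l<n. A (i, l) * B (l, j)) mod int p))"
  have "sim program s (5000 * (a + d) + ((6 * n + 4) + ((3 * n + 5 * K + 4) + (812 * (find_cost * K * K * K) +
     (20 * (K * tc) + (20 * (K * tc) + (8 * n\<^sup>2 + 2))))))) (main_pmf A B) ?R"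
    unfolding program_def
  proof (rule sim_Seq_det[OF sim_frame[OF sim_setup_K[OF s(2,3) a_pos s(5)]]])
    fix s1 assume 1: "ireg s1 5 = 64 * (1 + lg a + lg d) \<and> keeps setup_K s s1"
    then have f1: "frame {5,6,8,21,22,23} {} {0} s s1" by (auto intro: frame_mono)
    show "sim (setup_m ;; setup_offsets ;; all_blocks ;; naive 20 21 ;; naive 21 20 ;; print) s1
       ((6 * n + 4) + ((3 * n + 5 * K + 4) + (812 * (find_cost * K * K * K) + (20 * (K * tc) + (20 * (K * tc) + (8 * n\<^sup>2 + 2))))))
       (main_pmf A B) ?R"
    proof (rule sim_Seq_det[OF sim_frame[OF sim_setup_m]])
      fix s2 assume 2: "ireg s2 6 = m \<and> keeps setup_m s1 s2"
      then have f12: "keeps setup_m s1 s2" by simp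
      have f2: "frame {5,6,8,21,22,23} {} {0} s s2" by (rule frame_trans[OF f1 frame_mono[OF f12]]) auto
      show "sim (setup_offsets ;; all_blocks ;; naive 20 21 ;; naive 21 20 ;; print) s2
         ((3 * n + 5 * K + 4) + (812 * (find_cost * K * K * K) + (20 * (K * tc) + (20 * (K * tc) + (8 * n\<^sup>2 + 2)))))
         (main_pmf A B) ?R"
      proof (rule sim_Seq_det[OF sim_frame[OF sim_setup_offsets]])
        fix s3 assume 3: "((\<forall>t<K. iarr s3 0 t = t * m) \<and> ireg s3 8 = K * m) \<and> keeps setup_offsets s2 s3"
        then have f23: "keeps setup_offsets s2 s3" by simp
        have f3: "frame {5,6,8,21,22,23} {} {0} s s3" by (rule frame_trans[OF f2 frame_mono[OF f23]]) auto
        have b3: "base s3"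
          unfolding base_def using 3 2 1 s K frame_ireg[OF f3] frame_ireg[OF f23] frame_ireg[OF f12] by simp
        have AB3: "holds_mat 0 A s3" "holds_mat 1 B s3" using A B holds_mat_frame[OF _ f3] by simp_all
        show "sim (all_blocks ;; naive 20 21 ;; naive 21 20 ;; print) s3
           (812 * (find_cost * K * K * K) + (20 * (K * tc) + (20 * (K * tc) + (8 * n\<^sup>2 + 2))))
           (main_pmf A B) ?R"
        proof (rule sim_Seq_ret[OF sim_frame[OF sim_all_blocks[OF b3 AB3]]])
          fix ok s4
          assume 4: "(ok \<longrightarrow> (\<forall>I<K. \<forall>J<K. block_ok A B I J s4)) \<and> keeps all_blocks s3 s4"
          then have f4: "keeps all_blocks s3 s4" by simp
          have b4: "base s4" by (rule base_frame[OF b3 f4]) simp_all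
          have AB4: "holds_mat 0 A s4" "holds_mat 1 B s4" using AB3 holds_mat_frame[OF _ f4] by simp_all
          have k4: "ireg s4 8 = K * m" using frame_ireg[OF f4] 3 by simp
          show "sim (naive 20 21 ;; naive 21 20 ;; print) s4
             (20 * (K * tc) + (20 * (K * tc) + (8 * n\<^sup>2 + 2))) (return_pmf ok) ?R"
          proof (rule sim_Seq_det[OF sim_frame[OF sim_naive[OF _ b4 k4 AB4]]])
            fix s5
            assume 5: "((\<forall>i j. entry_ok A B s4 i j \<longrightarrow> entry_ok A B s5 i j) \<and>
              (\<forall>i\<ge>K * m. \<forall>j<n. i < n \<longrightarrow> (if (20::nat) = 20 then entry_ok A B s5 i j else entry_ok A B s5 j i))) \<and>
              keeps (naive 20 21) s4 s5"
            then have f5: "keeps (naive 20 21) s4 s5" by simp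
            have b5: "base s5" by (rule base_frame[OF b4 f5]) simp_all
            have AB5: "holds_mat 0 A s5" "holds_mat 1 B s5" using AB4 holds_mat_frame[OF _ f5] by simp_all
            have k5: "ireg s5 8 = K * m" using frame_ireg[OF f5] k4 by simp
            show "sim (naive 21 20 ;; print) s5 (20 * (K * tc) + (8 * n\<^sup>2 + 2)) (return_pmf ok) ?R"
            proof (rule sim_Seq_det[OF sim_frame[OF sim_naive[OF _ b5 k5 AB5]]])
              fix s6
              assume 6: "((\<forall>i j. entry_ok A B s5 i j \<longrightarrow> entry_ok A B s6 i j) \<and>
                (\<forall>j\<ge>K * m. \<forall>i<n. j < n \<longrightarrow> (if (21::nat) = 20 then entry_ok A B s6 j i else entry_ok A B s6 i j))) \<and>
                keeps (naive 21 20) s5 s6"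
              then have f6: "keeps (naive 21 20) s5 s6" by simp
              have b6: "base s6" by (rule base_frame[OF b5 f6]) simp_all
              have ok: "entry_ok A B s6 i j" if ok "i < n" "j < n" for i j
              proof (cases "i < K * m \<and> j < K * m")
                case True
                have "entry_ok A B s4 i j" using block_ok_entry_ok[of A B s4 i j] True 4 that(1) by blast
                then show ?thesis using 5 6 by blast
              next
                case False
                then show ?thesis using 5 6 that by (cases "i < K * m") (auto simp: not_less)
              qed
              have "sim print s6 (8 * n\<^sup>2 + 2) (map_pmf (\<lambda>_. ok) (return_pmf ())) ?R"
                by (rule sim_map, rule sim_mono[OF sim_print[OF baseD(1)[OF b6]]])
                  (use ok in \<open>auto simp: output_mat_def entry_ok_def intro!: cong_mat\<close>)
              then show "sim print s6 (8 * n\<^sup>2 + 2) (return_pmf ok) ?R" by simp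
            qed simp
          qed simp
        qed
      qed (use 2 1 K frame_ireg[OF f12] in auto)
    qed (use 1 K s frame_ireg[OF f1] in auto)
  qed
  moreover have "5000 * (a + d) + ((6 * n + 4) + ((3 * n + 5 * K + 4) + (812 * (find_cost * K * K * K) +
     (20 * (K * tc) + (20 * (K * tc) + (8 * n\<^sup>2 + 2)))))) \<le> 5000 * (a + d) + 1000 * (find_cost * K * K * K)"
  proof -
    have 1: "1 \<le> K * tc" "K \<le> K * tc" "tc \<le> K * tc" using K_pos tc_pos by (auto simp: Suc_le_eq)
    have "K * tc * 1 \<le> K * tc * (K * K * K * K * K * K * a)"
      using K_pos a_pos by (intro mult_le_mono2) (simp add: Suc_le_eq)
    then have "K * tc \<le> find_cost * K * K * K" unfolding find_cost_def by (simp add: mult_ac)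
    then show ?thesis using 1 n_square tc_ge unfolding power2_eq_square by linarith
  qed
  ultimately show ?thesis by (auto elim: sim_mono)
qed

end

section \<open>Expectations over distributions with finite support\<close>

abbreviation EV :: "'a pmf \<Rightarrow> ('a \<Rightarrow> real) \<Rightarrow> real" where
  "EV D f \<equiv> measure_pmf.expectation D f"

lemma EV_mono:
  assumes "finite (set_pmf D)" "\<And>x. x \<in> set_pmf D \<Longrightarrow> f x \<le> g x"
  shows "EV D f \<le> EV D g"
  using assms by (intro integral_mono_AE integrable_measure_pmf_finite) (auto simp: AE_measure_pmf_iff)

lemma EV_cong: "(\<And>x. x \<in> set_pmf D \<Longrightarrow> f x = g x) \<Longrightarrow> EV D f = EV D g"
  by (intro integral_cong_AE) (auto simp: AE_measure_pmf_iff)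

lemma EV_le_const:
  assumes "finite (set_pmf D)" "\<And>x. x \<in> set_pmf D \<Longrightarrow> f x \<le> c"
  shows "EV D f \<le> c"
  using EV_mono[of D f "\<lambda>_. c"] assms by simp

lemma EV_bind:
  assumes "finite (set_pmf D)" "\<And>x. x \<in> set_pmf D \<Longrightarrow> finite (set_pmf (f x))"
  shows "EV (bind_pmf D f) h = EV D (\<lambda>x. EV (f x) h)"
proof -
  have "EV (bind_pmf D f) h = (\<Sum>a\<in>set_pmf D. pmf D a *\<^sub>R EV (f a) h)"
    using assms by (intro pmf_expectation_bind) auto
  also have "\<dots> = EV D (\<lambda>x. EV (f x) h)"
    using assms by (intro integral_measure_pmf[symmetric]) auto
  finally show ?thesis .
qed

lemma EV_add:
  assumes "finite (set_pmf D)"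
  shows "EV D (\<lambda>x. f x + g x) = EV D f + EV D g"
  using assms by (intro Bochner_Integration.integral_add integrable_measure_pmf_finite)

lemma EV_sum:
  assumes "finite (set_pmf D)"
  shows "EV D (\<lambda>x. \<Sum>i\<in>I. f i x) = (\<Sum>i\<in>I. EV D (f i))"
  using assms by (intro Bochner_Integration.integral_sum integrable_measure_pmf_finite)

lemma EV_of_bool: "EV D (\<lambda>x. of_bool (P x)) = measure_pmf.prob D {x. P x}"
proof -
  have "(\<lambda>x. of_bool (P x) :: real) = indicator {x. P x}"
    by (auto simp: fun_eq_iff)
  then show ?thesis by simp
qed

lemma pmf_bind_le:
  assumes "finite (set_pmf D)" "\<And>x. x \<in> set_pmf D \<Longrightarrow> pmf (f x) y \<le> c"
  shows "pmf (bind_pmf D f) y \<le> c"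
  unfolding pmf_bind using assms by (rule EV_le_const)

lemma pmf_map_Pair: "pmf (map_pmf f D) y = measure_pmf.prob D {x. f x = y}"
  by (simp add: pmf_map vimage_def)

text \<open>
  Either all of the \<open>K\<close> independent components avoid \<open>H\<close>, or some component lies in \<open>H\<close>; in the second
  case success costs at most \<open>\<beta>\<close> per position.
\<close>

lemma direct_product:
  fixes D :: "'a pmf" and W :: "'z pmf"
  assumes fin: "finite (set_pmf D)" "finite (set_pmf W)"
    and resample: "\<And>i. i < K \<Longrightarrow> bind_pmf W (\<lambda>z. map_pmf (pl i z) D) = D"
    and same: "\<And>i z x. i < K \<Longrightarrow> z \<in> set_pmf W \<Longrightarrow> x \<in> set_pmf D \<Longrightarrow> ex i (pl i z x) = z"
    and other: "\<And>i j z x. i < K \<Longrightarrow> j < K \<Longrightarrow> i \<noteq> j \<Longrightarrow> x \<in> set_pmf D \<Longrightarrow> ex j (pl i z x) = ex j x"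
    and G: "\<And>x. 0 \<le> G x" "\<And>x. G x \<le> 1"
    and H: "\<And>z i. z \<in> H \<Longrightarrow> i < K \<Longrightarrow> EV D (\<lambda>x. G (pl i z x)) \<le> \<beta>" and "0 \<le> \<beta>"
  shows "EV D G \<le> (1 - measure_pmf.prob W H) ^ K + K * \<beta>"
proof -
  let ?mu = "measure_pmf.prob W H"
  \<comment> \<open>Resampling a component leaves \<open>D\<close> unchanged, so an expectation may
    be taken by first drawing the component \<open>z\<close> and then planting it.\<close>
  have planted: "EV D f = EV W (\<lambda>z. EV D (\<lambda>x. f (pl i z x)))" if "i < K" for i and f :: "'a \<Rightarrow> real"
  proof -
    have "EV D f = EV (bind_pmf W (\<lambda>z. map_pmf (pl i z) D)) f"
      using resample[OF that] by simp
    also have "\<dots> = EV W (\<lambda>z. EV D (\<lambda>x. f (pl i z x)))"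
      using fin by (simp add: EV_bind)
    finally show ?thesis .
  qed
  \<comment> \<open>Independence of the components is not assumed but derived: component
    \<open>k\<close> is resampled, and planting it does not disturb the components before
    it.\<close>
  have avoid: "EV D (\<lambda>x. of_bool (\<forall>i<k. ex i x \<notin> H)) = (1 - ?mu) ^ k" if "k \<le> K" for k
    using that
  proof (induction k)
    case (Suc k)
    let ?f = "\<lambda>x. of_bool (\<forall>i<k. ex i x \<notin> H) :: real"
    have "EV D (\<lambda>x. of_bool (\<forall>i<Suc k. ex i x \<notin> H)) =
        EV W (\<lambda>z. EV D (\<lambda>x. of_bool (\<forall>i<Suc k. ex i (pl k z x) \<notin> H)))"
      using Suc.prems by (intro planted) simp
    also have "\<dots> = EV W (\<lambda>z. EV D (\<lambda>x. of_bool (z \<notin> H) * ?f x))"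
      using Suc.prems same[of k] other[of k] by (intro EV_cong) (auto simp: less_Suc_eq)
    also have "\<dots> = EV W (\<lambda>z. of_bool (z \<notin> H)) * EV D ?f"
      by simp
    also have "EV W (\<lambda>z. of_bool (z \<notin> H)) = 1 - ?mu"
      using measure_pmf.prob_compl[of H W] by (simp add: EV_of_bool set_diff_eq)
    also have "EV D ?f = (1 - ?mu) ^ k"
      using Suc by simp
    finally show ?case by simp
  qed simp
  have hit: "EV D (\<lambda>x. G x * of_bool (ex i x \<in> H)) \<le> \<beta>" if "i < K" for i
  proof -
    have "EV D (\<lambda>x. G x * of_bool (ex i x \<in> H)) =
        EV W (\<lambda>z. EV D (\<lambda>x. G (pl i z x) * of_bool (ex i (pl i z x) \<in> H)))"
      using that by (rule planted)
    also have "\<dots> \<le> \<beta>"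
    proof (rule EV_le_const[OF fin(2)])
      fix z assume z: "z \<in> set_pmf W"
      have "EV D (\<lambda>x. G (pl i z x) * of_bool (ex i (pl i z x) \<in> H)) = EV D (\<lambda>x. G (pl i z x) * of_bool (z \<in> H))"
        using same[OF that z] by (intro EV_cong) simp
      also have "\<dots> \<le> \<beta>" using H[OF _ that, of z] \<open>0 \<le> \<beta>\<close> by (cases "z \<in> H") auto
      finally show "EV D (\<lambda>x. G (pl i z x) * of_bool (ex i (pl i z x) \<in> H)) \<le> \<beta>" .
    qed
    finally show ?thesis .
  qed
  have "EV D G \<le> EV D (\<lambda>x. of_bool (\<forall>i<K. ex i x \<notin> H) + (\<Sum>i<K. G x * of_bool (ex i x \<in> H)))"
  proof (rule EV_mono[OF fin(1)])
    fix x
    show "G x \<le> of_bool (\<forall>i<K. ex i x \<notin> H) + (\<Sum>i<K. G x * of_bool (ex i x \<in> H))"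
    proof (cases "\<forall>i<K. ex i x \<notin> H")
      case True
      have "0 \<le> (\<Sum>i<K. G x * of_bool (ex i x \<in> H))" using G by (intro sum_nonneg) auto
      then show ?thesis using True G(2)[of x] by simp
    next
      case False
      then obtain i where "i < K" "ex i x \<in> H" by blast
      then have "G x * of_bool (ex i x \<in> H) \<le> (\<Sum>i<K. G x * of_bool (ex i x \<in> H))"
        using G by (intro member_le_sum) auto
      then show ?thesis using \<open>ex i x \<in> H\<close> by simp
    qed
  qed
  also have "\<dots> = (1 - ?mu) ^ K + (\<Sum>i<K. EV D (\<lambda>x. G x * of_bool (ex i x \<in> H)))"
    unfolding EV_add[OF fin(1)] EV_sum[OF fin(1)] avoid[OF order.refl] ..
  also have "(\<Sum>i<K. EV D (\<lambda>x. G x * of_bool (ex i x \<in> H))) \<le> (\<Sum>i<K. \<beta>)"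
    using hit by (intro sum_mono) auto
  finally show ?thesis by simp
qed

section \<open>Repeated trials\<close>

lemma upd_assoc: "upd e (upd e' x) = upd (upd e e') x"
  by (cases x) auto

lemma upd_None [simp]: "upd None x = x"
  by (cases x) auto

definition trials :: "('k \<Rightarrow> bool option pmf) \<Rightarrow> 'k list \<Rightarrow> bool option pmf" where
  "trials T ks = foldM (\<lambda>k e. map_pmf (upd e) (T k)) ks None"

text \<open>\<open>upd\<close> is associative with unit \<open>None\<close>, so the outcome before a
  loop can be factored out. Nested loops of trials thereby become trials whose members are
  themselves trials.\<close>

lemma foldM_upd: "foldM (\<lambda>k e. map_pmf (upd e) (T k)) ks e = map_pmf (upd e) (trials T ks)"
proof (induction ks arbitrary: e)
  case (Cons k ks)
  have "foldM (\<lambda>k e. map_pmf (upd e) (T k)) (k # ks) e =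
      bind_pmf (T k) (\<lambda>x. map_pmf (upd (upd e x)) (trials T ks))"
    by (simp add: bind_map_pmf Cons)
  moreover have "trials T (k # ks) = bind_pmf (T k) (\<lambda>x. map_pmf (upd x) (trials T ks))"
    by (simp add: trials_def[of T "k # ks"] bind_map_pmf Cons)
  ultimately show ?case
    by (simp add: map_bind_pmf map_pmf_comp upd_assoc)
qed (simp add: trials_def)

lemma trials_Nil [simp]: "trials T [] = return_pmf None"
  by (simp add: trials_def)

lemma trials_Cons: "trials T (k # ks) = bind_pmf (T k) (\<lambda>x. map_pmf (upd x) (trials T ks))"
proof -
  have "trials T (k # ks) = bind_pmf (T k) (\<lambda>x. foldM (\<lambda>k e. map_pmf (upd e) (T k)) ks (upd None x))"
    by (simp only: trials_def foldM.simps bind_map_pmf)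
  then show ?thesis by (simp only: foldM_upd upd_None)
qed

lemma trials_None: "pmf (trials T ks) None = (\<Prod>k\<leftarrow>ks. pmf (T k) None)"
proof (induction ks)
  case (Cons k ks)
  have 1: "pmf (map_pmf (upd x) (trials T ks)) None = of_bool (x = None) * pmf (trials T ks) None" for x
  proof -
    have "upd x -` {None} = (if x = None then {None} else {})"
      by (auto elim: upd.elims)
    then show ?thesis by (simp add: pmf_map measure_pmf_single)
  qed
  have "pmf (trials T (k # ks)) None = EV (T k) (\<lambda>x. of_bool (x = None)) * pmf (trials T ks) None"
    by (simp add: trials_Cons pmf_bind 1)
  also have "EV (T k) (\<lambda>x. of_bool (x = None)) = pmf (T k) None"
    unfolding EV_of_bool by (simp add: measure_pmf_single)
  finally show ?case using Cons by simp
qed simp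

text \<open>Union bound: the surviving result comes from a single trial, so a wrong one was already
  wrong there.\<close>

lemma trials_False:
  fixes w :: real
  assumes "\<And>k. k \<in> set ks \<Longrightarrow> pmf (T k) (Some False) \<le> w" "0 \<le> w"
  shows "pmf (trials T ks) (Some False) \<le> length ks * w"
  using assms(1)
proof (induction ks)
  case (Cons k ks)
  have 1: "pmf (map_pmf (upd x) (trials T ks)) (Some False) \<le> of_bool (x = Some False) + pmf (trials T ks) (Some False)" for x
  proof -
    have "upd x -` {Some False} \<subseteq> (if x = Some False then UNIV else {Some False})"
      by (auto elim: upd.elims)
    then have "pmf (map_pmf (upd x) (trials T ks)) (Some False)
        \<le> measure_pmf.prob (trials T ks) (if x = Some False then UNIV else {Some False})"
      unfolding pmf_map by (intro measure_pmf.finite_measure_mono) auto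
    also have "\<dots> \<le> of_bool (x = Some False) + pmf (trials T ks) (Some False)"
      by (auto simp: measure_pmf_single)
    finally show ?thesis .
  qed
  have "pmf (trials T (k # ks)) (Some False)
      \<le> EV (T k) (\<lambda>x. of_bool (x = Some False) + pmf (trials T ks) (Some False))"
    unfolding trials_Cons pmf_bind by (rule EV_mono) (use 1 in auto)
  also have "\<dots> = pmf (T k) (Some False) + pmf (trials T ks) (Some False)"
    by (subst EV_add, simp, unfold EV_of_bool) (simp add: measure_pmf_single)
  also have "\<dots> \<le> w + length ks * w"
    using Cons by (intro add_mono) auto
  finally show ?case by (simp add: algebra_simps)
qed simp

lemma foldM_and:
  "pmf (foldM (\<lambda>_ ok. map_pmf (\<lambda>v. ok \<and> Q v) U) ks True) True = measure_pmf.prob U {v. Q v} ^ length ks"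
proof (induction ks)
  case (Cons k ks)
  have F: "foldM (\<lambda>_ ok. map_pmf (\<lambda>v. ok \<and> Q v) U) ks False = return_pmf False"
    by (induction ks) (simp_all add: bind_return_pmf map_pmf_const)
  have "pmf (foldM (\<lambda>_ ok. map_pmf (\<lambda>v. ok \<and> Q v) U) (k # ks) True) True =
      EV U (\<lambda>v. of_bool (Q v) * pmf (foldM (\<lambda>_ ok. map_pmf (\<lambda>v. ok \<and> Q v) U) ks True) True)"
    unfolding foldM.simps bind_map_pmf pmf_bind
    by (intro EV_cong) (auto simp: F)
  also have "\<dots> = measure_pmf.prob U {v. Q v} * measure_pmf.prob U {v. Q v} ^ length ks"
    using Cons by (simp add: EV_of_bool)
  finally show ?case by simp
qed simp

text \<open>Used for the solutions modulo \<open>p\<close> of a linear equation whose leading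
  coefficient is not divisible by \<open>p\<close>.\<close>

lemma prob_le_inj:
  assumes "\<And>x y. x \<in> S \<Longrightarrow> y \<in> S \<Longrightarrow> x \<in> {0..<int p} \<Longrightarrow> y \<in> {0..<int p} \<Longrightarrow> x = y" "0 < p"
  shows "measure_pmf.prob (pmf_of_set {0..<int p}) S \<le> 1 / p"
proof -
  have "card ({0..<int p} \<inter> S) \<le> 1"
    using assms(1) by (intro card_le_Suc0_iff_eq[THEN iffD2, unfolded One_nat_def[symmetric]]) auto
  then show ?thesis
    using assms(2) by (simp add: measure_pmf_of_set divide_right_mono)
qed

section \<open>Soundness and completeness of Freivalds' test over a prime field\<close>

locale prime_block_algo = block_algo +
  assumes p_prime: "prime p"
begin

lemma finite_unif: "finite (set_pmf unif)"
  using p_pos by (simp add: unif_def set_pmf_of_set)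

text \<open>Exchanging the two summations turns the test into the vanishing modulo \<open>p\<close>
  of a linear form in \<open>v\<close>, whose coefficients form a row of the error matrix
  \<open>Z - X Y\<close>.\<close>

lemma passes_iff:
  "passes X Y Z v i \<longleftrightarrow> int p dvd (\<Sum>j<n. (Z (i, j) - (\<Sum>l<n. X (i, l) * Y (l, j))) * v j)"
proof -
  have "(\<Sum>l<n. X (i, l) * ((\<Sum>j<n. Y (l, j) * v j) mod int p)) mod int p =
      (\<Sum>l<n. (X (i, l) * ((\<Sum>j<n. Y (l, j) * v j) mod int p)) mod int p) mod int p"
    by (rule mod_sum_eq[symmetric])
  also have "\<dots> = (\<Sum>l<n. (X (i, l) * (\<Sum>j<n. Y (l, j) * v j)) mod int p) mod int p"
    by (simp only: mod_mult_right_eq)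
  also have "\<dots> = (\<Sum>l<n. X (i, l) * (\<Sum>j<n. Y (l, j) * v j)) mod int p"
    by (rule mod_sum_eq)
  also have "(\<Sum>l<n. X (i, l) * (\<Sum>j<n. Y (l, j) * v j)) = (\<Sum>l<n. \<Sum>j<n. X (i, l) * Y (l, j) * v j)"
    by (simp add: sum_distrib_left mult.assoc)
  also have "\<dots> = (\<Sum>j<n. \<Sum>l<n. X (i, l) * Y (l, j) * v j)"
    by (rule sum.swap)
  also have "\<dots> = (\<Sum>j<n. (\<Sum>l<n. X (i, l) * Y (l, j)) * v j)"
    by (simp add: sum_distrib_right)
  finally have "passes X Y Z v i \<longleftrightarrow>
      (\<Sum>j<n. Z (i, j) * v j) mod int p = (\<Sum>j<n. (\<Sum>l<n. X (i, l) * Y (l, j)) * v j) mod int p"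
    unfolding passes_def by auto
  also have "\<dots> \<longleftrightarrow> int p dvd (\<Sum>j<n. Z (i, j) * v j) - (\<Sum>j<n. (\<Sum>l<n. X (i, l) * Y (l, j)) * v j)"
    by (rule mod_eq_dvd_iff)
  finally show ?thesis by (simp add: sum_subtractf left_diff_distrib)
qed

text \<open>Some entry \<open>(i, j)\<close> of the error matrix is nonzero modulo \<open>p\<close>.
  Once all coordinates of \<open>v\<close> except the \<open>j\<close>-th are fixed, primality
  leaves at most one value of that coordinate for which row \<open>i\<close> passes, so the
  probability is at most \<open>1 / p\<close>.\<close>

lemma freivalds:
  assumes "\<not> correct X Y Z"
  shows "measure_pmf.prob Uvec {v. \<forall>i<n. passes X Y Z v i} \<le> 1 / 2"
proof -
  let ?D = "\<lambda>i j. Z (i, j) - (\<Sum>l<n. X (i, l) * Y (l, j))"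
  obtain i j where ij: "i < n" "j < n" "Z (i, j) mod int p \<noteq> (\<Sum>l<n. X (i, l) * Y (l, j)) mod int p"
    using assms unfolding correct_def by blast
  then have nd: "\<not> int p dvd ?D i j" by (simp add: mod_eq_dvd_iff)
  have ipr: "prime (int p)" using p_prime by simp
  let ?J = "{..<n} - {j}"
  have U: "Uvec = bind_pmf (Pi_pmf ?J 0 (\<lambda>_. unif)) (\<lambda>f. map_pmf (\<lambda>y. f(j := y)) unif)"
  proof -
    have "Uvec = Pi_pmf (insert j ?J) 0 (\<lambda>_. unif)"
      using ij(2) by (simp add: Uvec_def insert_absorb)
    also have "\<dots> = bind_pmf unif (\<lambda>y. bind_pmf (Pi_pmf ?J 0 (\<lambda>_. unif)) (\<lambda>f. return_pmf (f(j := y))))"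
      by (subst Pi_pmf_insert') auto
    also have "\<dots> = bind_pmf (Pi_pmf ?J 0 (\<lambda>_. unif)) (\<lambda>f. bind_pmf unif (\<lambda>y. return_pmf (f(j := y))))"
      by (rule bind_commute_pmf)
    finally show ?thesis by (simp add: map_pmf_def)
  qed
  have fin: "finite (set_pmf (Pi_pmf ?J 0 (\<lambda>_. unif)))"
  proof -
    have "finite (PiE_dflt ?J 0 (\<lambda>_. set_pmf unif))" by (rule finite_PiE_dflt) (use finite_unif in auto)
    then show ?thesis by (simp add: set_Pi_pmf comp_def)
  qed
  have "measure_pmf.prob Uvec {v. \<forall>i<n. passes X Y Z v i} \<le> measure_pmf.prob Uvec {v. passes X Y Z v i}"
    using ij by (intro measure_pmf.finite_measure_mono) auto
  also have "\<dots> = EV (Pi_pmf ?J 0 (\<lambda>_. unif)) (\<lambda>f. measure_pmf.prob unif {y. passes X Y Z (f(j := y)) i})"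
    unfolding EV_of_bool[symmetric] U using fin finite_unif by (subst EV_bind) auto
  also have "\<dots> \<le> 1 / p"
  proof (rule EV_le_const[OF fin])
    fix f
    let ?r = "\<Sum>l\<in>?J. ?D i l * f l"
    have eq: "passes X Y Z (f(j := y)) i \<longleftrightarrow> int p dvd ?D i j * y + ?r" for y
    proof -
      have "(\<Sum>l<n. ?D i l * (f(j := y)) l) = ?D i j * y + (\<Sum>l\<in>?J. ?D i l * (f(j := y)) l)"
        using ij(2) by (subst sum.remove[of _ j]) auto
      also have "(\<Sum>l\<in>?J. ?D i l * (f(j := y)) l) = ?r" by (intro sum.cong) auto
      finally show ?thesis unfolding passes_iff by simp
    qed
    show "measure_pmf.prob unif {y. passes X Y Z (f(j := y)) i} \<le> 1 / p"
      unfolding unif_def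
    proof (rule prob_le_inj[OF _ p_pos])
      fix x y assume xy': "x \<in> {y. passes X Y Z (f(j := y)) i}" "y \<in> {y. passes X Y Z (f(j := y)) i}"
        and xy: "x \<in> {0..<int p}" "y \<in> {0..<int p}"
      from xy' have "int p dvd (?D i j * x + ?r) - (?D i j * y + ?r)"
        unfolding mem_Collect_eq eq by (rule dvd_diff)
      then have "int p dvd ?D i j * (x - y)" by (simp add: right_diff_distrib)
      then have "int p dvd x - y" using nd prime_dvd_mult_iff[OF ipr] by blast
      then have "x mod int p = y mod int p" by (simp add: mod_eq_dvd_iff)
      then show "x = y" using xy by simp
    qed
  qed
  also have "\<dots> \<le> 1 / 2" using prime_ge_2_nat[OF p_prime] by (simp add: field_simps)
  finally show ?thesis .
qed

lemma check_pmf_True: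
  "pmf (check_pmf X Y Z) True = measure_pmf.prob Uvec {v. \<forall>i<n. passes X Y Z v i} ^ K"
  using foldM_and[of "\<lambda>v. \<forall>i<n. passes X Y Z v i" Uvec "[0..<K]"] by (simp add: check_pmf_def)

lemma check_wrong: "\<not> correct X Y Z \<Longrightarrow> pmf (check_pmf X Y Z) True \<le> (1 / 2) ^ K"
  unfolding check_pmf_True using freivalds by (intro power_mono) auto

lemma check_correct: "correct X Y Z \<Longrightarrow> pmf (check_pmf X Y Z) True = 1"
proof -
  assume c: "correct X Y Z"
  have "passes X Y Z v i" if "i < n" for v i
    unfolding passes_iff using c that
    by (intro dvd_sum dvd_mult2) (simp add: correct_def mod_eq_dvd_iff[symmetric])
  then have "{v. \<forall>i<n. passes X Y Z v i} = UNIV" by auto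
  then show ?thesis unfolding check_pmf_True by simp
qed

definition target :: "(nat \<times> nat \<Rightarrow> int) \<Rightarrow> (nat \<times> nat \<Rightarrow> int) \<Rightarrow> int mat" where
  "target X Y = mat n n (\<lambda>(i, j). (\<Sum>l<n. X (i, l) * Y (l, j)) mod int p)"

definition success :: "(nat \<times> nat \<Rightarrow> int) \<Rightarrow> (nat \<times> nat \<Rightarrow> int) \<Rightarrow> real" where
  "success X Y = pmf (orc (mat n n X) (mat n n Y)) (Some (target X Y))"

lemma trial_False: "pmf (trial X Y) (Some False) \<le> (1 / 2) ^ K"
  unfolding trial_def
proof (rule pmf_bind_le[OF finite_orc])
  fix M
  let ?C = "correct X Y (result M)"
  have "pmf (map_pmf (\<lambda>ok. if ok then Some ?C else None) (check_pmf X Y (result M))) (Some False)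
      = measure_pmf.prob (check_pmf X Y (result M)) {ok. ok \<and> \<not> ?C}"
    unfolding pmf_map_Pair by (intro arg_cong[where f="measure_pmf.prob _"]) auto
  also have "\<dots> \<le> (1 / 2) ^ K"
  proof (cases ?C)
    case False
    then have "{ok. ok \<and> \<not> ?C} = {True}" by auto
    then show ?thesis using check_wrong[OF False] by (simp add: measure_pmf_single)
  qed simp
  finally show "pmf (map_pmf (\<lambda>ok. if ok then Some ?C else None) (check_pmf X Y (result M))) (Some False) \<le> (1 / 2) ^ K" .
qed

text \<open>The right answer passes the test with certainty, so verification costs no success
  probability.\<close>

lemma trial_True: "success X Y \<le> pmf (trial X Y) (Some True)"
proof -
  let ?M = "Some (target X Y)"
  let ?q = "\<lambda>M. pmf (map_pmf (\<lambda>ok. if ok then Some (correct X Y (result M)) else None) (check_pmf X Y (result M))) (Some True)"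
  have c: "correct X Y (result ?M)"
    by (simp add: correct_def result_def target_def arr_of_mat_def)
  have "?q ?M = measure_pmf.prob (check_pmf X Y (result ?M)) {True}"
    unfolding pmf_map_Pair using c by (intro arg_cong[where f="measure_pmf.prob _"]) auto
  then have "?q ?M = 1" using check_correct[OF c] by (simp add: measure_pmf_single)
  then have "of_bool (M = ?M) \<le> ?q M" for M by (cases "M = ?M") auto
  then have "EV (orc (mat n n X) (mat n n Y)) (\<lambda>M. of_bool (M = ?M)) \<le> EV (orc (mat n n X) (mat n n Y)) ?q"
    by (intro EV_mono finite_orc) auto
  then show ?thesis
    by (simp add: EV_of_bool success_def trial_def pmf_bind measure_pmf_single)
qed

section \<open>Uniform matrices\<close>

definition MM :: "nat \<Rightarrow> (nat \<times> nat \<Rightarrow> int) set" where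
  "MM r = PiE_dflt ({..<r} \<times> {..<n}) 0 (\<lambda>_. {0..<int p})"

lemma MM_iff: "X \<in> MM r \<longleftrightarrow> (\<forall>i j. if i < r \<and> j < n then 0 \<le> X (i, j) \<and> X (i, j) < int p else X (i, j) = 0)"
  by (auto simp: MM_def PiE_dflt_def)

lemma finite_MM: "finite (MM r)"
  unfolding MM_def by (rule finite_PiE_dflt) auto

lemma MM_nonempty: "MM r \<noteq> {}"
proof -
  have "(\<lambda>_. 0) \<in> MM r" using p_pos by (auto simp: MM_iff)
  then show ?thesis by blast
qed

lemma Umat_eq: "Umat r = pmf_of_set (MM r)"
  using p_pos by (simp add: Umat_def unif_def MM_def Pi_pmf_of_set)

lemma set_Umat: "set_pmf (Umat r) = MM r"
  by (simp add: Umat_eq set_pmf_of_set finite_MM MM_nonempty)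

lemma finite_Umat: "finite (set_pmf (Umat r))"
  by (simp add: set_Umat finite_MM)

lemma pair_Umat: "pair_pmf (Umat r) (Umat r') = pmf_of_set (MM r \<times> MM r')"
  by (rule pmf_eqI) (auto simp: Umat_eq pmf_pair pmf_of_set finite_MM MM_nonempty indicator_def card_cartesian_product
      split: prod.split)

text \<open>On a finite set a left inverse suffices: an injective self-map is onto.\<close>

lemma map_bij_pmf_of_set:
  assumes "finite S" "S \<noteq> {}" "\<And>x. x \<in> S \<Longrightarrow> f x \<in> S" "\<And>x. x \<in> S \<Longrightarrow> g (f x) = x"
  shows "map_pmf f (pmf_of_set S) = pmf_of_set S"
proof -
  have inj: "inj_on f S" using assms(4) by (metis inj_onI)
  moreover have "f ` S = S" using assms(1,3) inj by (intro endo_inj_surj) auto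
  ultimately have "bij_betw f S S" by (simp add: bij_betw_def)
  then show ?thesis using assms by (intro map_pmf_of_set_bij_betw)
qed

text \<open>Exchanging a fresh block with the \<open>i\<close>-th block of rows is an involution.\<close>

lemma plant_ext:
  assumes "i < K" "X \<in> MM n" "x \<in> MM m"
  shows "plant i x X \<in> MM n" "ext i X \<in> MM m" "plant i (ext i X) (plant i x X) = X" "ext i (plant i x X) = x"
proof -
  have le: "i * m + m \<le> n" using assms(1) by (rule block_le)
  show "plant i x X \<in> MM n"
    unfolding MM_iff
  proof (intro allI)
    fix r c
    show "if r < n \<and> c < n then 0 \<le> plant i x X (r, c) \<and> plant i x X (r, c) < int p else plant i x X (r, c) = 0"
    proof (cases "i * m \<le> r \<and> r < i * m + m \<and> c < n")
      case True
      then have "r - i * m < m" "r < n" using le by auto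
      then show ?thesis using assms(3) True by (auto simp: MM_iff plant_def)
    next
      case False
      then have "plant i x X (r, c) = X (r, c)" by (auto simp: plant_def)
      then show ?thesis using assms(2) by (simp add: MM_iff)
    qed
  qed
  show "ext i X \<in> MM m"
    unfolding MM_iff
  proof (intro allI)
    fix u c
    show "if u < m \<and> c < n then 0 \<le> ext i X (u, c) \<and> ext i X (u, c) < int p else ext i X (u, c) = 0"
      using assms(2) block_less[OF assms(1), of u] by (auto simp: MM_iff ext_def)
  qed
  show "plant i (ext i X) (plant i x X) = X"
    by (rule ext) (auto simp: plant_def ext_def split: prod.split)
  show "ext i (plant i x X) = x"
    using assms(3) by (intro HOL.ext) (auto simp: plant_def ext_def MM_iff split: prod.split)
qed

lemma ext_plant_other:
  assumes "i \<noteq> j"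
  shows "ext j (plant i x X) = ext j X"
proof (rule HOL.ext, clarify)
  fix u c
  show "ext j (plant i x X) (u, c) = ext j X (u, c)"
    using block_disjoint[of i "j * m + u" j] assms by (auto simp: ext_def plant_def)
qed

text \<open>The two marginals of this identity are what is needed: an extracted block is uniform
  (\<open>map_ext_Umat\<close>), and planting a uniform block into a uniform matrix gives a uniform
  matrix (\<open>plant_Umat\<close>).\<close>

lemma swap_Umat:
  assumes "i < K"
  shows "map_pmf (\<lambda>(X, x). (plant i x X, ext i X)) (pair_pmf (Umat n) (Umat m)) = pair_pmf (Umat n) (Umat m)"
  unfolding pair_Umat
proof (rule map_bij_pmf_of_set[where g="\<lambda>(X, x). (plant i x X, ext i X)"])
  show "finite (MM n \<times> MM m)" "MM n \<times> MM m \<noteq> {}" using finite_MM MM_nonempty by auto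
qed (use plant_ext[OF assms] in auto)

lemma map_ext_Umat:
  assumes "i < K"
  shows "map_pmf (ext i) (Umat n) = Umat m"
proof -
  have "Umat m = map_pmf snd (map_pmf (\<lambda>(X, x). (plant i x X, ext i X)) (pair_pmf (Umat n) (Umat m)))"
    by (simp add: swap_Umat[OF assms] map_snd_pair_pmf)
  also have "\<dots> = map_pmf (ext i) (map_pmf fst (pair_pmf (Umat n) (Umat m)))"
    by (simp add: map_pmf_comp case_prod_unfold)
  finally show ?thesis by (simp add: map_fst_pair_pmf)
qed

lemma plant_Umat:
  assumes "i < K"
  shows "bind_pmf (Umat m) (\<lambda>x. map_pmf (plant i x) (Umat n)) = Umat n"
proof -
  have "Umat n = map_pmf fst (map_pmf (\<lambda>(X, x). (plant i x X, ext i X)) (pair_pmf (Umat n) (Umat m)))"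
    by (simp add: swap_Umat[OF assms] map_fst_pair_pmf)
  also have "\<dots> = bind_pmf (Umat n) (\<lambda>X. bind_pmf (Umat m) (\<lambda>x. return_pmf (plant i x X)))"
    by (simp add: pair_pmf_def map_bind_pmf)
  also have "\<dots> = bind_pmf (Umat m) (\<lambda>x. bind_pmf (Umat n) (\<lambda>X. return_pmf (plant i x X)))"
    by (rule bind_commute_pmf)
  finally show ?thesis by (simp add: map_pmf_def)
qed

lemma transp_MM: "X \<in> MM n \<Longrightarrow> transp X \<in> MM n"
  by (auto simp: MM_iff)

lemma map_transp_Umat: "map_pmf transp (Umat n) = Umat n"
  unfolding Umat_eq
  by (rule map_bij_pmf_of_set[where g=transp]) (auto simp: finite_MM MM_nonempty transp_MM)

lemma map_ext_diff_Umat: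
  assumes "I < K"
  shows "map_pmf (\<lambda>X. ext I (\<lambda>k. (A k - X k) mod int p)) (Umat n) = Umat m"
proof -
  \<comment> \<open>Subtraction from \<open>A\<close>, cut off to 0 outside the range so that it
    maps \<open>MM n\<close> to itself, where it is an involution. \<open>ext\<close> reads only
    inside the range and does not notice the cut-off.\<close>
  let ?f = "\<lambda>X (i, j). if i < n \<and> j < n then (A (i, j) - X (i, j)) mod int p else 0"
  have inv: "?f (?f X) = X" if "X \<in> MM n" for X
  proof (rule HOL.ext)
    fix k :: "nat \<times> nat"
    obtain i j where k: "k = (i, j)" by (cases k)
    have "(A (i, j) - (A (i, j) - X (i, j)) mod int p) mod int p = X (i, j) mod int p"
      by (simp add: mod_diff_right_eq)
    then show "?f (?f X) k = X k"
      using that by (auto simp: MM_iff k)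
  qed
  have "map_pmf ?f (Umat n) = Umat n"
    unfolding Umat_eq
    by (rule map_bij_pmf_of_set[where g="?f"]) (use p_pos inv in \<open>auto simp: finite_MM MM_nonempty MM_iff\<close>)
  then have "Umat m = map_pmf (\<lambda>X. ext I (?f X)) (Umat n)"
    using map_ext_Umat[OF assms] by (metis map_pmf_comp)
  moreover have "ext I (?f X) = ext I (\<lambda>k. (A k - X k) mod int p)" for X
    using block_less[OF assms] by (intro HOL.ext) (auto simp: ext_def split: prod.split)
  ultimately show ?thesis by simp
qed

end

lemma foldM_upd':
  "foldM (\<lambda>k e. map_pmf (upd e) (T k)) ks = (\<lambda>e. map_pmf (upd e) (trials T ks))"
  by (rule ext) (rule foldM_upd)

lemma prod_list_le_factor:
  fixes f :: "'k \<Rightarrow> real"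
  assumes "\<And>k. 0 \<le> f k" "\<And>k. f k \<le> 1" "i \<in> set ks" "f i \<le> c"
  shows "(\<Prod>k\<leftarrow>ks. f k) \<le> c"
proof -
  have nn: "0 \<le> (\<Prod>k\<leftarrow>ks. f k)" and le1: "(\<Prod>k\<leftarrow>ks. f k) \<le> 1" for ks
    using assms(1,2) by (induction ks) (auto intro: mult_nonneg_nonneg mult_le_one)
  show ?thesis
    using assms(3)
  proof (induction ks)
    case (Cons k ks)
    show ?case
    proof (cases "k = i")
      case True
      have "f i * (\<Prod>k\<leftarrow>ks. f k) \<le> f i * 1" using assms(1) le1 by (intro mult_left_mono)
      then show ?thesis using True assms(4) by simp
    next
      case False
      then have "(\<Prod>k\<leftarrow>ks. f k) \<le> c" using Cons by simp
      moreover have "f k * (\<Prod>k\<leftarrow>ks. f k) \<le> 1 * (\<Prod>k\<leftarrow>ks. f k)"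
        using assms(2) nn by (intro mult_right_mono)
      ultimately show ?thesis by simp
    qed
  qed simp
qed

lemma pmf_None_le: "pmf D None \<le> 1 - pmf D (Some True)"
proof -
  have "pmf D None + pmf D (Some True) = measure_pmf.prob D {None, Some True}"
    by (subst measure_measure_pmf_finite) auto
  also have "\<dots> \<le> 1" by simp
  finally show ?thesis by simp
qed

lemma combine_cases: "combine e1 e2 e3 e4 = v \<Longrightarrow> v \<noteq> Some True \<Longrightarrow> e1 = v \<or> e2 = v \<or> e3 = v \<or> e4 = v"
  by (cases "(e1, e2, e3, e4)" rule: combine.cases) auto

text \<open>A union bound that covers \<open>None\<close> and \<open>Some False\<close> alike: such
  a combined outcome already occurs among the four partial results.\<close>

lemma pmf_combine_le:
  assumes "v \<noteq> Some True"
  shows "pmf (bind_pmf f1 (\<lambda>e1. bind_pmf f2 (\<lambda>e2. bind_pmf f3 (\<lambda>e3. map_pmf (\<lambda>e4. combine e1 e2 e3 e4) f4)))) v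
     \<le> pmf f1 v + pmf f2 v + (pmf f3 v + pmf f4 v)"
proof -
  let ?Q = "pair_pmf f1 (pair_pmf f2 (pair_pmf f3 f4))"
  have "bind_pmf f1 (\<lambda>e1. bind_pmf f2 (\<lambda>e2. bind_pmf f3 (\<lambda>e3. map_pmf (\<lambda>e4. combine e1 e2 e3 e4) f4)))
      = map_pmf (\<lambda>(e1, e2, e3, e4). combine e1 e2 e3 e4) ?Q"
    by (simp add: pair_pmf_def map_pmf_def bind_assoc_pmf bind_return_pmf)
  then have "pmf (bind_pmf f1 (\<lambda>e1. bind_pmf f2 (\<lambda>e2. bind_pmf f3 (\<lambda>e3. map_pmf (\<lambda>e4. combine e1 e2 e3 e4) f4)))) v
      = measure_pmf.prob ?Q {q. (case q of (e1, e2, e3, e4) \<Rightarrow> combine e1 e2 e3 e4) = v}"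
    by (simp only: pmf_map_Pair)
  also have "\<dots> \<le> measure_pmf.prob ?Q (({q. fst q = v} \<union> {q. fst (snd q) = v}) \<union>
      ({q. fst (snd (snd q)) = v} \<union> {q. snd (snd (snd q)) = v}))"
  proof (intro measure_pmf.finite_measure_mono subsetI)
    fix q assume q: "q \<in> {q. (case q of (e1, e2, e3, e4) \<Rightarrow> combine e1 e2 e3 e4) = v}"
    obtain e1 e2 e3 e4 where "q = (e1, e2, e3, e4)" by (cases q)
    with q combine_cases[OF _ assms, of e1 e2 e3 e4]
    show "q \<in> ({q. fst q = v} \<union> {q. fst (snd q) = v}) \<union> ({q. fst (snd (snd q)) = v} \<union> {q. snd (snd (snd q)) = v})"
      by simp
  qed simp
  also have "\<dots> \<le> measure_pmf.prob ?Q {q. fst q = v} + measure_pmf.prob ?Q {q. fst (snd q) = v} +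
      (measure_pmf.prob ?Q {q. fst (snd (snd q)) = v} + measure_pmf.prob ?Q {q. snd (snd (snd q)) = v})"
    by (intro order.trans[OF measure_Un_le] add_mono order.trans[OF measure_Un_le]) auto
  also have "measure_pmf.prob ?Q {q. fst q = v} = pmf f1 v"
    unfolding pmf_map_Pair[symmetric] by (simp add: map_fst_pair_pmf)
  also have "measure_pmf.prob ?Q {q. fst (snd q) = v} = pmf f2 v"
    unfolding pmf_map_Pair[symmetric] map_pmf_comp[symmetric, of fst snd] map_snd_pair_pmf
    by (simp add: map_fst_pair_pmf)
  also have "measure_pmf.prob ?Q {q. fst (snd (snd q)) = v} = pmf f3 v"
    unfolding pmf_map_Pair[symmetric] map_pmf_comp[symmetric, of fst "\<lambda>q. snd (snd q)"]
      map_pmf_comp[symmetric, of snd snd] map_snd_pair_pmf by (simp add: map_fst_pair_pmf)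
  also have "measure_pmf.prob ?Q {q. snd (snd (snd q)) = v} = pmf f4 v"
    unfolding pmf_map_Pair[symmetric] map_pmf_comp[symmetric, of snd "\<lambda>q. snd (snd q)"]
      map_pmf_comp[symmetric, of snd snd] map_snd_pair_pmf by simp
  finally show ?thesis .
qed

lemma foldM_all_True:
  fixes \<eta> :: real
  assumes "\<And>k. k \<in> set ks \<Longrightarrow> 1 - pmf (T k) (Some True) \<le> \<eta>"
  shows "1 - pmf (foldM (\<lambda>k ok. map_pmf (\<lambda>e. ok \<and> e = Some True) (T k)) ks True) True \<le> length ks * \<eta>"
  using assms
proof (induction ks)
  case (Cons k ks)
  let ?F = "foldM (\<lambda>k ok. map_pmf (\<lambda>e. ok \<and> e = Some True) (T k)) ks"
  let ?q = "pmf (?F True) True"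
  have "pmf (foldM (\<lambda>k ok. map_pmf (\<lambda>e. ok \<and> e = Some True) (T k)) (k # ks) True) True
      = EV (T k) (\<lambda>e. pmf (?F (e = Some True)) True)"
    by (simp add: bind_map_pmf pmf_bind)
  also have "\<dots> \<ge> EV (T k) (\<lambda>e. of_bool (e = Some True) * ?q)"
    by (rule EV_mono) auto
  also have "EV (T k) (\<lambda>e. of_bool (e = Some True) * ?q) = pmf (T k) (Some True) * ?q"
    by (simp add: EV_of_bool measure_pmf_single)
  finally have 1: "pmf (T k) (Some True) * ?q \<le>
      pmf (foldM (\<lambda>k ok. map_pmf (\<lambda>e. ok \<and> e = Some True) (T k)) (k # ks) True) True" .
  have "(1 - pmf (T k) (Some True)) * (1 - ?q) \<ge> 0" by (intro mult_nonneg_nonneg) (auto simp: pmf_le_1)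
  then have 2: "pmf (T k) (Some True) + ?q - 1 \<le> pmf (T k) (Some True) * ?q" by (simp add: algebra_simps)
  have "1 - pmf (T k) (Some True) \<le> \<eta>" "1 - ?q \<le> length ks * \<eta>" using Cons by auto
  with 1 2 have "1 - pmf (foldM (\<lambda>k ok. map_pmf (\<lambda>e. ok \<and> e = Some True) (T k)) (k # ks) True) True \<le> \<eta> + length ks * \<eta>"
    by linarith
  then show ?case by (simp add: algebra_simps)
qed simp

section \<open>Success probability of the whole algorithm\<close>

context prime_block_algo
begin

abbreviation U2 where "U2 \<equiv> pair_pmf (Umat n) (Umat n)"

lemma finite_U2: "finite (set_pmf U2)"
  by (simp add: finite_Umat)

definition plant2 :: "nat \<Rightarrow> (nat \<times> nat \<Rightarrow> int) \<times> (nat \<times> nat \<Rightarrow> int) \<Rightarrow>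
    (nat \<times> nat \<Rightarrow> int) \<times> (nat \<times> nat \<Rightarrow> int) \<Rightarrow> (nat \<times> nat \<Rightarrow> int) \<times> (nat \<times> nat \<Rightarrow> int)" where
  "plant2 i z = (\<lambda>(X, Y). (plant i (fst z) X, transp (plant i (snd z) (transp Y))))"

definition ext2 :: "nat \<Rightarrow> (nat \<times> nat \<Rightarrow> int) \<times> (nat \<times> nat \<Rightarrow> int) \<Rightarrow>
    (nat \<times> nat \<Rightarrow> int) \<times> (nat \<times> nat \<Rightarrow> int)" where
  "ext2 i = (\<lambda>(X, Y). (ext i X, ext i (transp Y)))"

lemma attempt_pmf_eq: "attempt_pmf i x y = bind_pmf U2 (\<lambda>XY. case plant2 i (x, y) XY of (X, Y) \<Rightarrow> trial X Y)"
  by (simp add: attempt_pmf_def pair_pmf_def plant2_def bind_assoc_pmf bind_return_pmf)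

lemma attempt_False: "pmf (attempt_pmf i x y) (Some False) \<le> (1 / 2) ^ K"
  unfolding attempt_pmf_eq
  by (rule pmf_bind_le[OF finite_U2]) (auto split: prod.split intro: trial_False)

lemma attempt_True:
  "EV U2 (\<lambda>XY. case_prod success (plant2 i (x, y) XY)) \<le> pmf (attempt_pmf i x y) (Some True)"
  unfolding attempt_pmf_eq pmf_bind
  by (rule EV_mono[OF finite_U2]) (auto split: prod.split intro: trial_True)

lemma plant_cols_Umat:
  assumes "i < K"
  shows "bind_pmf (Umat m) (\<lambda>y. map_pmf (\<lambda>Y. transp (plant i y (transp Y))) (Umat n)) = Umat n"
proof -
  have "bind_pmf (Umat m) (\<lambda>y. map_pmf (\<lambda>Y. transp (plant i y (transp Y))) (Umat n))
      = map_pmf transp (bind_pmf (Umat m) (\<lambda>y. map_pmf (plant i y) (map_pmf transp (Umat n))))"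
    by (simp add: map_bind_pmf map_pmf_comp)
  then show ?thesis unfolding map_transp_Umat plant_Umat[OF assms] .
qed

text \<open>The resampling premise of \<open>direct_product\<close>. The planting on the left and on
  the right act on independent factors, so the product distribution splits.\<close>

lemma plant2_U2:
  assumes "i < K"
  shows "bind_pmf (pair_pmf (Umat m) (Umat m)) (\<lambda>z. map_pmf (plant2 i z) U2) = U2"
proof -
  have "bind_pmf (pair_pmf (Umat m) (Umat m)) (\<lambda>z. map_pmf (plant2 i z) U2) =
     bind_pmf (Umat m) (\<lambda>x. bind_pmf (Umat m) (\<lambda>y. bind_pmf (Umat n) (\<lambda>X. bind_pmf (Umat n) (\<lambda>Y.
       return_pmf (plant i x X, transp (plant i y (transp Y)))))))"
    by (simp add: pair_pmf_def plant2_def map_pmf_def bind_assoc_pmf bind_return_pmf)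
  also have "\<dots> = bind_pmf (Umat m) (\<lambda>x. bind_pmf (Umat n) (\<lambda>X. bind_pmf (Umat m) (\<lambda>y. bind_pmf (Umat n) (\<lambda>Y.
       return_pmf (plant i x X, transp (plant i y (transp Y)))))))"
    by (intro bind_pmf_cong refl bind_commute_pmf)
  also have "\<dots> = pair_pmf (bind_pmf (Umat m) (\<lambda>x. map_pmf (plant i x) (Umat n)))
     (bind_pmf (Umat m) (\<lambda>y. map_pmf (\<lambda>Y. transp (plant i y (transp Y))) (Umat n)))"
    by (simp add: pair_pmf_def map_pmf_def bind_assoc_pmf bind_return_pmf)
  also have "\<dots> = U2" unfolding plant_Umat[OF assms] plant_cols_Umat[OF assms] ..
  finally show ?thesis .
qed

text \<open>The exceptional set \<open>H\<close> of the overview, for the threshold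
  \<open>\<beta> = \<alpha> / (2 * K)\<close>.\<close>

definition bad :: "real \<Rightarrow> ((nat \<times> nat \<Rightarrow> int) \<times> (nat \<times> nat \<Rightarrow> int)) set" where
  "bad \<beta> = {(x, y). \<forall>i<K. pmf (attempt_pmf i x y) (Some True) \<le> \<beta>}"

text \<open>If the measure exceeded 1/16, \<open>direct_product\<close> would bound the average
  success by \<open>(15 / 16) ^ K + \<alpha> / 2\<close>, which is less than
  \<open>\<alpha>\<close>. The divisor \<open>2 * K\<close> of the threshold makes all positions
  together contribute only \<open>\<alpha> / 2\<close>.\<close>

lemma prob_bad:
  assumes avg: "\<alpha> \<le> EV U2 (case_prod success)" and K: "(15 / 16) ^ K < \<alpha> / 2" and "0 < \<alpha>"
  shows "measure_pmf.prob (pair_pmf (Umat m) (Umat m)) (bad (\<alpha> / (2 * K))) \<le> 1 / 16"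
proof (rule ccontr)
  let ?mu = "measure_pmf.prob (pair_pmf (Umat m) (Umat m)) (bad (\<alpha> / (2 * K)))"
  assume "\<not> ?mu \<le> 1 / 16"
  then have "(1 - ?mu) ^ K \<le> (15 / 16) ^ K" by (intro power_mono) auto
  have "EV U2 (case_prod success) \<le> (1 - ?mu) ^ K + K * (\<alpha> / (2 * K))"
  proof (rule direct_product[where pl="plant2" and ex="ext2"])
    show "finite (set_pmf U2)" by (rule finite_U2)
    show "finite (set_pmf (pair_pmf (Umat m) (Umat m)))" by (simp add: finite_Umat)
    show "bind_pmf (pair_pmf (Umat m) (Umat m)) (\<lambda>z. map_pmf (plant2 i z) U2) = U2" if "i < K" for i
      using that by (rule plant2_U2)
    show "ext2 i (plant2 i z XY) = z"
      if "i < K" "z \<in> set_pmf (pair_pmf (Umat m) (Umat m))" "XY \<in> set_pmf U2" for i z XY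
      using that plant_ext(4)[OF that(1)] by (auto simp: ext2_def plant2_def set_Umat transp_MM)
    show "ext2 j (plant2 i z XY) = ext2 j XY" if "i \<noteq> j" for i j z XY
      using ext_plant_other[OF that] by (auto simp: ext2_def plant2_def split: prod.split)
    show "0 \<le> (case XY of (X, Y) \<Rightarrow> success X Y)" "(case XY of (X, Y) \<Rightarrow> success X Y) \<le> 1" for XY
      by (auto simp: success_def pmf_le_1 split: prod.split)
    show "EV U2 (\<lambda>XY. case_prod success (plant2 i z XY)) \<le> \<alpha> / (2 * K)" if "z \<in> bad (\<alpha> / (2 * K))" "i < K" for z i
      using that attempt_True[of i "fst z" "snd z"] by (fastforce simp: bad_def)
    show "0 \<le> \<alpha> / (2 * K)" using \<open>0 < \<alpha>\<close> by simp
  qed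
  also have "K * (\<alpha> / (2 * K)) = \<alpha> / 2" using K_pos by simp
  finally show False using avg K \<open>(1 - ?mu) ^ K \<le> (15 / 16) ^ K\<close> by linarith
qed

lemma find_pmf_eq:
  "find_pmf x y = trials (\<lambda>_. trials (\<lambda>_. trials (\<lambda>_. trials (\<lambda>i. attempt_pmf i x y)
     [0..<K]) [0..<K]) [0..<K]) [0..<a]"
  unfolding find_pmf_def foldM_upd' by (simp add: map_pmf_idI)

lemma find_False: "pmf (find_pmf x y) (Some False) \<le> a * K ^ 3 * (1 / 2) ^ K"
proof -
  have 1: "pmf (trials (\<lambda>i. attempt_pmf i x y) [0..<K]) (Some False) \<le> length [0..<K] * (1 / 2) ^ K"
    by (rule trials_False) (auto intro: attempt_False)
  have 2: "pmf (trials (\<lambda>_. trials (\<lambda>i. attempt_pmf i x y) [0..<K]) [0..<K]) (Some False)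
      \<le> length [0..<K] * (length [0..<K] * (1 / 2) ^ K)"
    by (rule trials_False) (use 1 in auto)
  have 3: "pmf (trials (\<lambda>_. trials (\<lambda>_. trials (\<lambda>i. attempt_pmf i x y) [0..<K]) [0..<K]) [0..<K]) (Some False)
      \<le> length [0..<K] * (length [0..<K] * (length [0..<K] * (1 / 2) ^ K))"
    by (rule trials_False) (use 2 in auto)
  have "pmf (find_pmf x y) (Some False)
      \<le> length [0..<a] * (length [0..<K] * (length [0..<K] * (length [0..<K] * (1 / 2) ^ K)))"
    unfolding find_pmf_eq by (rule trials_False) (use 3 in auto)
  then show ?thesis by (simp add: power3_eq_cube mult_ac)
qed

lemma prod_list_const: "(\<Prod>k\<leftarrow>[0..<j]. c) = (c :: real) ^ j"
  by (induction j) auto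

text \<open>Outside \<open>bad\<close>, one position succeeds with probability above
  \<open>\<beta>\<close>, so a sweep over all positions comes back empty with probability at most
  \<open>1 - \<beta> \<le> exp (- \<beta>)\<close>; the \<open>K * K * a\<close> sweeps are
  independent.\<close>

lemma find_None:
  fixes \<beta> :: real
  assumes "(x, y) \<notin> bad \<beta>" "0 \<le> \<beta>"
  shows "pmf (find_pmf x y) None \<le> exp (- (\<beta> * (K * K * a)))"
proof -
  obtain i where i: "i < K" "\<beta> < pmf (attempt_pmf i x y) (Some True)"
    using assms(1) by (auto simp: bad_def not_le)
  let ?s = "pmf (trials (\<lambda>i. attempt_pmf i x y) [0..<K]) None"
  have "?s \<le> 1 - \<beta>"
    unfolding trials_None
    by (rule prod_list_le_factor[of _ i]) (use i pmf_None_le[of "attempt_pmf i x y"] in \<open>auto simp: pmf_le_1\<close>)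
  also have "\<dots> \<le> exp (- \<beta>)" using exp_ge_add_one_self[of "- \<beta>"] by simp
  finally have "?s ^ (K * K * a) \<le> exp (- \<beta>) ^ (K * K * a)" by (intro power_mono) auto
  also have "\<dots> = exp (- (\<beta> * (K * K * a)))"
    by (simp add: exp_of_nat_mult[symmetric] mult_ac)
  finally show ?thesis
    unfolding find_pmf_eq trials_None[of "\<lambda>_. _"] prod_list_const by (simp add: power_mult)
qed

text \<open>The four pairs of a round are each uniform but not jointly independent. Since their
  failure probabilities are merely added, uniformity of the single pairs is enough.\<close>

lemma EV_blocks:
  assumes "map_pmf f (Umat n) = Umat m" "map_pmf g (Umat n) = Umat m"
  shows "EV U2 (\<lambda>(X, Y). h (f X) (g Y)) = EV (pair_pmf (Umat m) (Umat m)) (\<lambda>(x, y). h x y)"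
proof -
  have "pair_pmf (map_pmf f (Umat n)) (map_pmf g (Umat n)) = map_pmf (\<lambda>(X, Y). (f X, g Y)) U2"
    unfolding pair_map_pmf2 pair_map_pmf1 by (simp add: map_pmf_comp case_prod_unfold)
  then have "pair_pmf (Umat m) (Umat m) = map_pmf (\<lambda>(X, Y). (f X, g Y)) U2"
    unfolding assms .
  then show ?thesis by (simp add: case_prod_unfold)
qed

text \<open>A pair yields nothing either because it lies in \<open>bad\<close> or because all sweeps
  fail, with probability at most \<open>exp (- 4) \<le> 1 / 16\<close>. That is 1/8 per pair and 1/2
  for the four pairs. For wrong results the bound of \<open>find_False\<close> holds for every pair,
  so it is just multiplied by 4.\<close>

lemma round_bound:
  fixes \<beta> :: real
  assumes bad: "measure_pmf.prob (pair_pmf (Umat m) (Umat m)) (bad \<beta>) \<le> 1 / 16"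
    and \<beta>: "0 \<le> \<beta>" "4 \<le> \<beta> * (K * K * a)" and IJ: "I < K" "J < K"
  shows "pmf (round_pmf A B I J) None \<le> 1 / 2"
    and "pmf (round_pmf A B I J) (Some False) \<le> 4 * (a * K ^ 3 * (1 / 2) ^ K)"
proof -
  let ?f = "\<lambda>X. ext I X" and ?f' = "\<lambda>X. ext I (\<lambda>k. (A k - X k) mod int p)"
  let ?g = "\<lambda>Y. ext J (transp Y)" and ?g' = "\<lambda>Y. ext J (transp (\<lambda>k. (B k - Y k) mod int p))"
  let ?S = "\<lambda>v X Y. pmf (find_pmf (?f X) (?g Y)) v + pmf (find_pmf (?f X) (?g' Y)) v +
      (pmf (find_pmf (?f' X) (?g Y)) v + pmf (find_pmf (?f' X) (?g' Y)) v)"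
  have eq: "round_pmf A B I J = bind_pmf U2 (\<lambda>(X, Y).
     bind_pmf (find_pmf (?f X) (?g Y)) (\<lambda>e1. bind_pmf (find_pmf (?f X) (?g' Y)) (\<lambda>e2.
     bind_pmf (find_pmf (?f' X) (?g Y)) (\<lambda>e3. map_pmf (\<lambda>e4. combine e1 e2 e3 e4) (find_pmf (?f' X) (?g' Y))))))"
    by (simp add: round_pmf_def Let_def pair_pmf_def bind_assoc_pmf bind_return_pmf)
  have le: "pmf (round_pmf A B I J) v \<le> EV U2 (\<lambda>(X, Y). ?S v X Y)" if "v \<noteq> Some True" for v
    unfolding eq pmf_bind[of U2]
    by (rule EV_mono[OF finite_U2]) (auto intro: pmf_combine_le[OF that])
  show "pmf (round_pmf A B I J) (Some False) \<le> 4 * (a * K ^ 3 * (1 / 2) ^ K)"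
  proof (rule order.trans[OF le EV_le_const[OF finite_U2]])
    fix XY
    show "(case XY of (X, Y) \<Rightarrow> ?S (Some False) X Y) \<le> 4 * (a * K ^ 3 * (1 / 2) ^ K)"
    proof (cases XY)
      case (Pair X Y)
      show ?thesis
        using find_False[of "?f X" "?g Y"] find_False[of "?f X" "?g' Y"] find_False[of "?f' X" "?g Y"]
          find_False[of "?f' X" "?g' Y"] unfolding Pair prod.case by linarith
    qed
  qed simp
  have tr: "map_pmf (\<lambda>Y. h (transp Y)) (Umat n) = map_pmf h (Umat n)" for h :: "_ \<Rightarrow> nat \<times> nat \<Rightarrow> int"
    using map_pmf_comp[of h transp "Umat n"] by (simp add: map_transp_Umat)
  have mf: "map_pmf ?f (Umat n) = Umat m" "map_pmf ?f' (Umat n) = Umat m"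
    using IJ by (auto intro: map_ext_Umat map_ext_diff_Umat)
  have mg: "map_pmf ?g (Umat n) = Umat m"
    unfolding tr using IJ(2) by (rule map_ext_Umat)
  have "transp (\<lambda>k. (B k - Y k) mod int p) = (\<lambda>k. (transp B k - transp Y k) mod int p)" for Y
    by (auto simp: transp_def)
  then have mg': "map_pmf ?g' (Umat n) = Umat m"
    using tr[of "\<lambda>Y. ext J (\<lambda>k. (transp B k - Y k) mod int p)"] map_ext_diff_Umat[OF IJ(2), of "transp B"]
    by simp
  have one: "EV U2 (\<lambda>(X, Y). pmf (find_pmf (f X) (g Y)) None) \<le> 1 / 8"
    if "map_pmf f (Umat n) = Umat m" "map_pmf g (Umat n) = Umat m" for f g
  proof -
    let ?W = "pair_pmf (Umat m) (Umat m)"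
    have fin: "finite (set_pmf ?W)" by (simp add: finite_Umat)
    have e16: "exp (- (\<beta> * (K * K * a))) \<le> 1 / 16"
    proof -
      have "(2::real) \<le> exp 1" using exp_ge_add_one_self[of 1] by simp
      have "exp (- (\<beta> * (K * K * a))) \<le> exp (- 4 :: real)" using \<beta>(2) by simp
      also have "exp (- 4 :: real) = inverse (exp 1 ^ 4)" by (simp add: exp_minus exp_of_nat_mult[symmetric])
      also have "\<dots> \<le> inverse (2 ^ 4)"
        using \<open>2 \<le> exp 1\<close> by (intro le_imp_inverse_le power_mono) auto
      also have "\<dots> = 1 / (16 :: real)" by simp
      finally show ?thesis .
    qed
    have "EV U2 (\<lambda>(X, Y). pmf (find_pmf (f X) (g Y)) None) = EV ?W (\<lambda>(x, y). pmf (find_pmf x y) None)"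
      using that by (rule EV_blocks)
    also have "\<dots> \<le> EV ?W (\<lambda>z. of_bool (z \<in> bad \<beta>) + 1 / 16)"
    proof (rule EV_mono[OF fin])
      fix z :: "(nat \<times> nat \<Rightarrow> int) \<times> (nat \<times> nat \<Rightarrow> int)"
      obtain x y where z: "z = (x, y)" by (cases z)
      show "(case z of (x, y) \<Rightarrow> pmf (find_pmf x y) None) \<le> of_bool (z \<in> bad \<beta>) + 1 / 16"
      proof (cases "z \<in> bad \<beta>")
        case True
        then show ?thesis using pmf_le_1[of "find_pmf x y" None] by (simp add: z)
      next
        case False
        then show ?thesis using order.trans[OF find_None[of x y \<beta>] e16] \<beta>(1) by (simp add: z)
      qed
    qed
    also have "\<dots> = measure_pmf.prob ?W (bad \<beta>) + 1 / 16"
      by (subst EV_add[OF fin]) (simp add: EV_of_bool)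
    finally show ?thesis using bad by simp
  qed
  have "pmf (round_pmf A B I J) None \<le> EV U2 (\<lambda>(X, Y). ?S None X Y)" by (rule le) simp
  also have "\<dots> = EV U2 (\<lambda>(X, Y). pmf (find_pmf (?f X) (?g Y)) None) + EV U2 (\<lambda>(X, Y). pmf (find_pmf (?f X) (?g' Y)) None) +
      (EV U2 (\<lambda>(X, Y). pmf (find_pmf (?f' X) (?g Y)) None) + EV U2 (\<lambda>(X, Y). pmf (find_pmf (?f' X) (?g' Y)) None))"
    unfolding case_prod_unfold EV_add[OF finite_U2] ..
  also have "\<dots> \<le> 1 / 8 + 1 / 8 + (1 / 8 + 1 / 8)"
    by (intro add_mono one mf mg mg')
  finally show "pmf (round_pmf A B I J) None \<le> 1 / 2" by simp
qed

text \<open>A block is lost if all \<open>K\<close> rounds yield nothing, which contributes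
  \<open>(1 / 2) ^ K\<close>, or if a wrong result is accepted, which contributes
  \<open>4 * a * K ^ 4 * (1 / 2) ^ K\<close>. Summing over \<open>K * K\<close> blocks gives at most
  \<open>5 * a * K ^ 6 * (1 / 2) ^ K\<close>; the premise on \<open>d\<close> is this quantity
  compared with \<open>1 / d\<close>.\<close>

lemma main_bound:
  fixes \<beta> :: real
  assumes bad: "measure_pmf.prob (pair_pmf (Umat m) (Umat m)) (bad \<beta>) \<le> 1 / 16"
    and \<beta>: "0 \<le> \<beta>" "4 \<le> \<beta> * (K * K * a)" and d: "5 * a * d * K ^ 6 \<le> 2 ^ K" "1 \<le> d"
  shows "1 - 1 / d \<le> pmf (main_pmf A B) True"
proof -
  let ?w = "(1 / 2) ^ K :: real"
  let ?\<eta> = "?w + K * (4 * (a * K ^ 3 * ?w))"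
  have block: "1 - pmf (block_pmf A B I J) (Some True) \<le> ?\<eta>" if IJ: "I < K" "J < K" for I J
  proof -
    note rb = round_bound[OF bad \<beta> IJ, of A B]
    have eq: "block_pmf A B I J = trials (\<lambda>_. round_pmf A B I J) [0..<K]"
      by (simp add: block_pmf_def trials_def)
    have "pmf (block_pmf A B I J) None \<le> ?w"
      unfolding eq trials_None[of "\<lambda>_. _"] prod_list_const by (rule power_mono[OF rb(1)]) simp
    moreover have "pmf (block_pmf A B I J) (Some False) \<le> length [0..<K] * (4 * (a * K ^ 3 * ?w))"
      unfolding eq by (rule trials_False) (use rb(2) in auto)
    moreover have "(\<Sum>e\<in>(UNIV :: bool option set). pmf (block_pmf A B I J) e) = 1"
      by (rule sum_pmf_eq_1) auto
    then have "pmf (block_pmf A B I J) None + pmf (block_pmf A B I J) (Some False) + pmf (block_pmf A B I J) (Some True) = 1"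
      by (simp add: UNIV_option_conv UNIV_bool)
    ultimately show ?thesis by simp
  qed
  have flat: "main_pmf A B = foldM (\<lambda>k ok. map_pmf (\<lambda>e. ok \<and> e = Some True) (case k of (I, J) \<Rightarrow> block_pmf A B I J))
      (List.product [0..<K] [0..<K]) True"
    unfolding main_pmf_def foldM_product[symmetric] by simp
  have "1 - pmf (main_pmf A B) True \<le> length (List.product [0..<K] [0..<K]) * ?\<eta>"
    unfolding flat by (rule foldM_all_True) (use block in auto)
  also have "\<dots> = (K * K + 4 * a * K ^ 6) * ?w"
    by (simp add: algebra_simps power_numeral_reduce)
  also have "\<dots> \<le> (5 * a * K ^ 6) * ?w"
  proof -
    have "K * K * 1 \<le> K * K * (K * K * K * K * a)"
      using K_pos a_pos by (intro mult_le_mono2) (simp add: Suc_le_eq)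
    then have "K * K + 4 * a * K ^ 6 \<le> 5 * a * K ^ 6" by (simp add: power_numeral_reduce algebra_simps)
    then have "real (K * K + 4 * a * K ^ 6) \<le> real (5 * a * K ^ 6)" by (simp only: of_nat_le_iff)
    then show ?thesis by (intro mult_right_mono) auto
  qed
  also have "\<dots> \<le> 1 / d"
  proof -
    have "real (5 * a * d * K ^ 6) \<le> real (2 ^ K)" using d(1) by (simp only: of_nat_le_iff)
    then have "real (5 * a * K ^ 6) * d \<le> 2 ^ K" by (simp add: mult_ac)
    then show ?thesis using d(2) by (simp add: field_simps power_one_over)
  qed
  finally show ?thesis by simp
qed

end

section \<open>Lower bound on the running time\<close>

definition cells :: "state \<Rightarrow> (nat \<times> nat) set" where
  "cells s = {(i, j). outp s i j \<noteq> None}"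

context machine
begin

text \<open>An instruction that writes an output cell costs 1, and a call, whatever its price
  \<open>tc\<close>, writes none.\<close>

lemma exec_cells:
  assumes "s' \<in> set_pmf (exec p n orc i s)" "finite (cells s)"
  shows "finite (cells s') \<and> card (cells s') \<le> card (cells s) + cost tc i"
proof (cases i)
  case (Output x y u)
  have "cells s' \<subseteq> insert (ireg s x, ireg s y) (cells s)"
    using assms(1) Output by (auto simp: cells_def split: if_splits)
  moreover have "card (insert (ireg s x, ireg s y) (cells s)) \<le> card (cells s) + 1"
    using card_insert_le_m1[of "card (cells s) + 1" "cells s"] by simp
  ultimately show ?thesis
    using assms(2) Output card_mono[of "insert (ireg s x, ireg s y) (cells s)" "cells s'"]
    by (auto intro: finite_subset)
next
  case (IStore a x y)
  then have "cells s' = cells s" using assms(1) by (auto simp: cells_def)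
  then show ?thesis using assms(2) by simp
next
  case (Call a b c)
  then have "cells s' = cells s" using assms(1) by (auto simp: cells_def set_mat_arr_def)
  then show ?thesis using assms(2) by simp
qed (use assms in \<open>auto simp: cells_def\<close>)

lemma step_cells:
  assumes "(cs', s', t') \<in> set_pmf (st (cs, s, t))" "finite (cells s)" "card (cells s) \<le> t"
  shows "finite (cells s') \<and> card (cells s') \<le> t'"
proof (cases cs)
  case Nil
  then show ?thesis using assms by simp
next
  case (Cons e es)
  show ?thesis
  proof (cases e)
    case (Do i)
    then have "s' \<in> set_pmf (exec p n orc i s)" "t' = t + cost tc i" using assms(1) Cons by auto
    with exec_cells[OF this(1) assms(2)] assms(3) show ?thesis by linarith
  qed (use assms Cons in \<open>auto split: if_splits\<close>)
qed

lemma steps_cells: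
  assumes "(cs', s', t') \<in> set_pmf (rr N (cs, s, t))" "finite (cells s)" "card (cells s) \<le> t"
  shows "card (cells s') \<le> t'"
  using assms
proof (induction N arbitrary: cs s t)
  case (Suc N)
  then obtain ds u v where 1: "(ds, u, v) \<in> set_pmf (st (cs, s, t))"
    and 2: "(cs', s', t') \<in> set_pmf (rr N (ds, u, v))"
    by (auto simp: steps_Suc)
  from step_cells[OF 1 Suc.prems(2,3)] Suc.IH[OF 2] show ?case by blast
qed simp

lemma finite_output_dist: "finite (set_pmf (output_dist p n tc orc c s))"
  unfolding output_dist_def run_eq_steps by (simp add: finite_rn)

lemma output_time:
  assumes "runs_in_time p n tc orc c (init_state xs A B) (real \<tau>)"
    and "Some M \<in> set_pmf (output_dist p n tc orc c (init_state xs A B))"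
  shows "n\<^sup>2 \<le> \<tau>"
proof -
  let ?s = "init_state xs A B"
  obtain N where N: "\<forall>(cs, s', t) \<in> set_pmf (rr N ([c], ?s, 0)). cs = [] \<and> real t \<le> real \<tau>"
    using assms(1) unfolding runs_in_time_def run_eq_steps by blast
  then have "halted (rr N ([c], ?s, 0))" by (auto simp: halted_def)
  with assms(2) obtain cs s' t where x: "(cs, s', t) \<in> set_pmf (rr N ([c], ?s, 0))" "output_mat n s' = Some M"
    by (auto simp: output_dist_halted)
  have "cells ?s = {}" by (simp add: cells_def init_state_def)
  then have "card (cells s') \<le> t" using steps_cells[OF x(1)] by simp
  moreover have "{..<n} \<times> {..<n} \<subseteq> cells s'"
    using x(2) by (auto simp: output_mat_def cells_def split: if_splits)
  moreover have "finite (cells s')"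
  proof -
    have "finite (cells u)" if "(ds, u, v) \<in> set_pmf (rr N (es, w, k))" "finite (cells w)" for ds u v es w k N
      using that
    proof (induction N arbitrary: es w k)
      case (Suc N)
      then obtain es' w' k' where 1: "(es', w', k') \<in> set_pmf (st (es, w, k))"
        and 2: "(ds, u, v) \<in> set_pmf (rr N (es', w', k'))"
        by (auto simp: steps_Suc)
      \<comment> \<open>Finiteness is wanted without any bound of the cells by the cost so far;
        moving the clock ahead by their number supplies that premise of
        \<open>step_cells\<close>.\<close>
      have "(es', w', k' + card (cells w)) \<in> set_pmf (st (es, w, k + card (cells w)))"
        unfolding step_cost_shift using 1 by force
      from step_cells[OF this Suc.prems(2)] Suc.IH[OF 2] show ?case by simp
    qed simp
    from this[OF x(1)] \<open>cells ?s = {}\<close> show ?thesis by simp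
  qed
  ultimately have "card ({..<n} \<times> {..<n}) \<le> t" using card_mono by (meson order.trans)
  moreover have "t \<le> \<tau>" using N x(1) by auto
  ultimately show ?thesis by (simp add: power2_eq_square)
qed

end

text \<open>Positive average success yields one input on which a complete matrix is output with
  positive probability, and the time bound holds for every input and every run.\<close>

lemma average_case_time:
  assumes "average_case_mult p n c \<tau> \<alpha>" "0 < \<alpha>" "0 < p"
  shows "n\<^sup>2 \<le> \<tau>"
proof -
  interpret machine p n 0 no_box using assms(3) by unfold_locales (auto simp: no_box_def)
  let ?D = "do {A \<leftarrow> pmf_of_set (Fp_mats p n); B \<leftarrow> pmf_of_set (Fp_mats p n);
    M \<leftarrow> alg_dist p n c A B; return_pmf (M = Some (Fp_mult p A B))}"
  have "0 < pmf ?D True"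
    using assms(1,2) by (simp add: average_case_mult_def measure_pmf_single)
  then have "True \<in> set_pmf ?D" unfolding set_pmf_iff by linarith
  then obtain A B where AB: "A \<in> Fp_mats p n" "B \<in> Fp_mats p n" "Some (Fp_mult p A B) \<in> set_pmf (alg_dist p n c A B)"
    using finite_Fp_mats[of p n] Fp_mats_nonempty[OF assms(3), of n] by (auto simp: set_pmf_of_set)
  then show ?thesis
    using assms(1) unfolding average_case_mult_def alg_dist_def by (intro output_time) auto
qed

context prime_block_algo
begin

lemma map_mat_Umat: "map_pmf (mat n n) (Umat n) = pmf_of_set (Fp_mats p n)"
  unfolding Umat_eq
proof (rule map_pmf_of_set_bij_betw)
  show "bij_betw (mat n n) (MM n) (Fp_mats p n)"
  proof (rule bij_betw_byWitness[where f'="\<lambda>A (i, j). if i < n \<and> j < n then A $$ (i, j) else 0"])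
    show "\<forall>X\<in>MM n. (\<lambda>(i, j). if i < n \<and> j < n then mat n n X $$ (i, j) else 0) = X"
      by (auto simp: MM_iff fun_eq_iff)
    show "\<forall>A\<in>Fp_mats p n. mat n n (\<lambda>(i, j). if i < n \<and> j < n then A $$ (i, j) else 0) = A"
      by (auto simp: Fp_mats_def intro!: eq_matI)
    show "mat n n ` MM n \<subseteq> Fp_mats p n"
      by (auto simp: Fp_mats_def MM_iff elements_mat_def)
    show "(\<lambda>A (i, j). if i < n \<and> j < n then A $$ (i, j) else 0) ` Fp_mats p n \<subseteq> MM n"
      by (force simp: Fp_mats_def MM_iff elements_mat_def)
  qed
qed (simp_all add: finite_MM MM_nonempty)

lemma Fp_mult_eq: "Fp_mult p (mat n n X) (mat n n Y) = target X Y"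
  by (rule eq_matI) (auto simp: Fp_mult_def target_def scalar_prod_def atLeast0LessThan)

text \<open>Carries the hypothesis on the algorithm from random elements of \<open>Fp_mats\<close>
  to the function representation, the form in which \<open>prob_bad\<close> uses it.\<close>

lemma success_average:
  "measure_pmf.prob (do {A \<leftarrow> pmf_of_set (Fp_mats p n); B \<leftarrow> pmf_of_set (Fp_mats p n);
      M \<leftarrow> orc A B; return_pmf (M = Some (Fp_mult p A B))}) {True} = EV U2 (case_prod success)"
proof -
  have "pmf (bind_pmf (orc (mat n n X) (mat n n Y)) (\<lambda>M. return_pmf (M = Some (target X Y)))) True = success X Y" for X Y
    unfolding map_pmf_def[symmetric] pmf_map_Pair by (simp add: success_def measure_pmf_single)
  then have s: "success = (\<lambda>X Y. pmf (bind_pmf (orc (mat n n X) (mat n n Y)) (\<lambda>M. return_pmf (M = Some (target X Y)))) True)"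
    by (intro HOL.ext) simp
  have "EV U2 (case_prod success) = pmf (bind_pmf U2 (\<lambda>(X, Y).
     bind_pmf (orc (mat n n X) (mat n n Y)) (\<lambda>M. return_pmf (M = Some (target X Y))))) True"
    unfolding pmf_bind[of U2] s by (simp add: case_prod_unfold)
  also have "bind_pmf U2 (\<lambda>(X, Y). bind_pmf (orc (mat n n X) (mat n n Y)) (\<lambda>M. return_pmf (M = Some (target X Y))))
      = do {A \<leftarrow> pmf_of_set (Fp_mats p n); B \<leftarrow> pmf_of_set (Fp_mats p n);
      M \<leftarrow> orc A B; return_pmf (M = Some (Fp_mult p A B))}"
    unfolding map_mat_Umat[symmetric] pair_pmf_def
    by (simp add: bind_map_pmf bind_assoc_pmf bind_return_pmf Fp_mult_eq)
  finally show ?thesis by (simp add: measure_pmf_single)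
qed

end

section \<open>Numerical estimates\<close>

lemma K_power_bound:
  assumes "K = 64 * (1 + lg a + lg d)" "1 \<le> a" "1 \<le> d"
  shows "5 * a * d * K ^ 6 \<le> 2 ^ K"
proof -
  define u where "u = 1 + lg a + lg d"
  have "a * d \<le> 2 ^ lg a * 2 ^ lg d" by (intro mult_le_mono lg_ge)
  also have "\<dots> \<le> 2 ^ u" by (simp add: u_def power_add)
  finally have ad: "a * d \<le> 2 ^ u" .
  have "u ^ 6 \<le> (2 ^ u) ^ 6" using less_exp[of u] by (intro power_mono) auto
  then have u6: "u ^ 6 \<le> 2 ^ (6 * u)" by (simp add: power_mult[symmetric] mult.commute)
  have Ku: "K = 64 * u" by (simp add: assms(1) u_def)
  have "5 * a * d * K ^ 6 = (5 * 64 ^ 6) * ((a * d) * u ^ 6)"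
    unfolding Ku power_mult_distrib by simp
  \<comment> \<open>\<open>5 * 64 ^ 6\<close> is below \<open>2 ^ 39\<close>, and
    \<open>39 + 7 * u \<le> 64 * u\<close> because \<open>u\<close> is at least 1.\<close>
  also have "\<dots> \<le> 2 ^ 39 * (2 ^ u * 2 ^ (6 * u))"
    using ad u6 by (intro mult_le_mono) auto
  also have "\<dots> = 2 ^ (39 + 7 * u)"
    by (simp only: power_add[symmetric]) simp
  also have "\<dots> \<le> 2 ^ K"
    unfolding Ku by (intro power_increasing) (auto simp: u_def)
  finally show ?thesis .
qed

lemma K_exp_bound:
  fixes \<alpha> :: real
  assumes "K = 64 * (1 + lg a + lg d)" "1 / \<alpha> \<le> a" "0 < \<alpha>"
  shows "(15 / 16) ^ K < \<alpha> / 2"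
proof -
  define u where "u = 1 + lg a + lg d"
  have a0: "0 < real a" using assms(2,3) by (meson less_le_trans zero_less_divide_1_iff)
  \<comment> \<open>1/4 is a crude bound; its use is that the comparison with
    \<open>(1 / 2) ^ u\<close> becomes strict, as the contradiction in \<open>prob_bad\<close>
    requires.\<close>
  have "((15 / 16) ^ 64) ^ u \<le> (1 / 4 :: real) ^ u" by (intro power_mono) (simp_all add: power_divide)
  also have "\<dots> < (1 / 2) ^ u" by (rule power_strict_mono) (auto simp: u_def)
  also have "\<dots> = 1 / 2 ^ u" by (simp add: power_one_over)
  also have "\<dots> \<le> 1 / (2 * a)"
  proof -
    have "real a \<le> real (2 ^ lg a)" by (simp only: of_nat_le_iff lg_ge)
    also have "real (2 ^ lg a) * 2 \<le> 2 ^ u" by (simp add: u_def power_add)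
    finally have "2 * real a \<le> 2 ^ u" by simp
    then show ?thesis using a0 by (intro divide_left_mono) auto
  qed
  also have "\<dots> \<le> \<alpha> / 2" using assms(2,3) a0 by (simp add: field_simps)
  finally show ?thesis unfolding assms(1) u_def[symmetric] power_mult .
qed

text \<open>Absorbs the polylogarithmic overhead into \<open>a * d\<close>. From
  \<open>x \<le> exp x\<close> at \<open>x = u / 14\<close> follows
  \<open>(u / 14) ^ 7 \<le> exp (u / 2) \<le> 2 ^ u\<close>, and rounding the two logarithms up
  gives \<open>2 ^ u \<le> 8 * a * d\<close>. The constant 896 is \<open>64 * 14\<close>.\<close>

lemma K7_bound:
  assumes "K = 64 * (1 + lg a + lg d)" "1 \<le> a" "1 \<le> d"
  shows "real K ^ 7 \<le> 8 * 896 ^ 7 * (real a * real d)"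
proof -
  define u where "u = 1 + lg a + lg d"
  have "real u / 14 \<le> exp (real u / 14)" using exp_ge_add_one_self[of "real u / 14"] by linarith
  then have "(real u / 14) ^ 7 \<le> exp (real u / 14) ^ 7" by (intro power_mono) auto
  also have "\<dots> = exp (real u / 2)" by (simp add: exp_of_nat_mult[symmetric])
  also have "\<dots> \<le> exp (real u * ln 2)"
    using ln2_ge_two_thirds mult_left_mono[of "1/2" "ln 2 :: real" "real u"] by simp
  also have "\<dots> = 2 ^ u" by (simp add: exp_of_nat_mult)
  also have "(2::real) ^ u = real (2 * (2 ^ lg a * 2 ^ lg d))" by (simp add: u_def power_add)
  also have "\<dots> \<le> real (2 * ((2 * a) * (2 * d)))"
    unfolding of_nat_le_iff using power_lg_le[OF assms(2)] power_lg_le[OF assms(3)]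
    by (intro mult_le_mono) auto
  finally have "(real u / 14) ^ 7 \<le> 8 * (real a * real d)" by simp
  then have "896 ^ 7 * (real u / 14) ^ 7 \<le> 896 ^ 7 * (8 * (real a * real d))"
    by (rule mult_left_mono) simp
  moreover have "real K = 896 * (real u / 14)" using assms(1) by (simp add: u_def)
  then have "real K ^ 7 = 896 ^ 7 * (real u / 14) ^ 7" by (simp only: power_mult_distrib)
  ultimately show ?thesis by linarith
qed

text \<open>The outer 8 is the loss from rounding up \<open>1 / \<alpha>\<close> twice and
  \<open>1 / \<delta>\<close> once, a factor 2 each. Inside, 10000 pays for computing
  \<open>K\<close> in unary, and the rest is 1000 times the constant of
  \<open>K7_bound\<close>.\<close>

definition cost_const :: real where
  "cost_const = 8 * (10000 + 8000 * 896 ^ 7)"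

lemma ceiling_recip:
  fixes x :: real
  assumes "0 < x" "x \<le> 1"
  shows "1 / x \<le> nat \<lceil>1 / x\<rceil>" "nat \<lceil>1 / x\<rceil> \<le> 2 / x" "1 \<le> nat \<lceil>1 / x\<rceil>"
proof -
  have 1: "1 \<le> 1 / x" using assms by simp
  then show "1 \<le> nat \<lceil>1 / x\<rceil>" by linarith
  show "1 / x \<le> nat \<lceil>1 / x\<rceil>" by (rule real_nat_ceiling_ge)
  have "real (nat \<lceil>1 / x\<rceil>) \<le> 1 / x + 1" using 1 by linarith
  also have "\<dots> \<le> 2 / x" using 1 by simp
  finally show "nat \<lceil>1 / x\<rceil> \<le> 2 / x" .
qed

text \<open>One factor \<open>1 / \<alpha>\<close> is the loop bound \<open>a\<close> in
  \<open>find\<close>; the other, together with \<open>1 / \<delta>\<close>, is what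
  \<open>K ^ 7\<close> is traded for.\<close>

lemma total_cost:
  fixes \<alpha> \<delta> :: real
  assumes \<alpha>: "0 < \<alpha>" "\<alpha> \<le> 1" and \<delta>: "0 < \<delta>" "\<delta> \<le> 1" and T: "1 \<le> T"
    and a: "a = nat \<lceil>1 / \<alpha>\<rceil>" and d: "d = nat \<lceil>1 / \<delta>\<rceil>" and K: "K = 64 * (1 + lg a + lg d)"
  shows "real (5000 * (a + d) + 1000 * (T * K ^ 7 * a)) \<le> cost_const / (\<delta> * \<alpha>\<^sup>2) * T"
proof -
  have a1: "1 \<le> a" "1 \<le> d" using ceiling_recip(3)[OF \<alpha>] ceiling_recip(3)[OF \<delta>] a d by auto
  have a2: "real a \<le> 2 / \<alpha>" "real d \<le> 2 / \<delta>" using ceiling_recip(2)[OF \<alpha>] ceiling_recip(2)[OF \<delta>] a d by auto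
  have q: "1 * 1 \<le> a * d" "a * 1 \<le> a * d" "1 * d \<le> a * d" using a1 by (intro mult_le_mono; simp)+
  have q2: "a * d * 1 \<le> a * d * (a * T)" using a1 T by (intro mult_le_mono2) (simp add: Suc_le_eq)
  have "a + d \<le> 2 * (a * d * (a * T))" using q q2 by linarith
  then have s1: "real (a + d) \<le> 2 * (real a ^ 2 * real d * T)"
    unfolding of_nat_le_iff[symmetric, where 'a=real] by (simp add: power2_eq_square mult_ac)
  have "real K ^ 7 * (real T * a) \<le> (8 * 896 ^ 7 * (real a * real d)) * (real T * a)"
    using K7_bound[OF K a1] by (rule mult_right_mono) simp
  then have s2: "real (T * K ^ 7 * a) \<le> 8 * 896 ^ 7 * (real a ^ 2 * real d * T)"
    by (simp add: power2_eq_square mult_ac)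
  have "real (5000 * (a + d) + 1000 * (T * K ^ 7 * a)) = 5000 * real (a + d) + 1000 * real (T * K ^ 7 * a)"
    by simp
  also have "\<dots> \<le> (10000 + 8000 * 896 ^ 7) * (real a ^ 2 * real d * T)"
  proof -
    have "5000 * x + 1000 * y \<le> (10000 + 8000 * c) * z" if "x \<le> 2 * z" "y \<le> 8 * c * z" for x y z c :: real
      using that by (simp add: algebra_simps)
    from this[OF s1 s2] show ?thesis .
  qed
  also have "\<dots> \<le> (10000 + 8000 * 896 ^ 7) * ((2 / \<alpha>) ^ 2 * (2 / \<delta>) * T)"
    using a2 \<alpha> \<delta> by (intro mult_left_mono mult_mono power_mono) auto
  also have "\<dots> = cost_const / (\<delta> * \<alpha>\<^sup>2) * T"
    by (simp add: cost_const_def power2_eq_square)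
  finally show ?thesis .
qed

lemma runs_in_time_mono:
  assumes "runs_in_time p n tc orc c s \<tau>" "\<tau> \<le> \<tau>'"
  shows "runs_in_time p n tc orc c s \<tau>'"
proof -
  obtain N where N: "\<forall>(cs, s', t) \<in> set_pmf (run p n tc orc c s N). cs = [] \<and> real t \<le> \<tau>"
    using assms(1) unfolding runs_in_time_def by blast
  have "\<forall>(cs, s', t) \<in> set_pmf (run p n tc orc c s N). cs = [] \<and> real t \<le> \<tau>'"
    using N assms(2) by fastforce
  then show ?thesis unfolding runs_in_time_def by blast
qed

lemma worst_case_program:
  fixes \<alpha> \<delta> :: real
  assumes p: "prime p" and n: "1 \<le> n" and \<alpha>: "0 < \<alpha>" "\<alpha> \<le> 1" and \<delta>: "0 < \<delta>" "\<delta> \<le> 1"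
    and avg: "average_case_mult p n c T \<alpha>"
  shows "worst_case_mult p n c T program \<alpha> \<delta> (cost_const / (\<delta> * \<alpha>\<^sup>2) * T)"
proof -
  define a where "a = nat \<lceil>1 / \<alpha>\<rceil>"
  define d where "d = nat \<lceil>1 / \<delta>\<rceil>"
  define K where "K = 64 * (1 + lg a + lg d)"
  have p0: "0 < p" using p by (rule prime_gt_0_nat)
  have a1: "1 \<le> a" "1 \<le> d" "1 / \<alpha> \<le> a" "1 / \<delta> \<le> d"
    using ceiling_recip[OF \<alpha>] ceiling_recip[OF \<delta>] by (auto simp: a_def d_def)
  have T: "n\<^sup>2 \<le> T" using average_case_time[OF avg \<alpha>(1) p0] .
  interpret M0: machine p n 0 no_box using p0 by unfold_locales (auto simp: no_box_def)
  \<comment> \<open>The black box is the output distribution of the given algorithm at this size,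
    charged at \<open>T\<close>; \<open>M0\<close> is the machine on which that algorithm itself
    runs.\<close>
  interpret prime_block_algo p n T "alg_dist p n c" K a
    using p0 n a1 T p by unfold_locales (auto simp: alg_dist_def M0.finite_output_dist K_def)
  have \<alpha>_avg: "\<alpha> \<le> EV U2 (case_prod success)"
    using avg unfolding average_case_mult_def success_average[symmetric] by blast
  note bad = prob_bad[OF \<alpha>_avg K_exp_bound[OF K_def a1(3) \<alpha>(1)] \<alpha>(1)]
  \<comment> \<open>The product is at least 32, as \<open>\<alpha> * a \<ge> 1\<close> by rounding
    up and \<open>K \<ge> 64\<close>.\<close>
  have "4 \<le> \<alpha> / (2 * K) * (K * K * a)"
  proof -
    have "\<alpha> / (2 * K) * (K * K * a) = (\<alpha> * a) * (K / 2)" using K_pos by simp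
    moreover have "1 \<le> \<alpha> * a" using a1(3) \<alpha>(1) by (simp add: field_simps)
    moreover have "4 \<le> real K / 2" by (simp add: K_def)
    ultimately show ?thesis using mult_mono[of 1 "\<alpha> * a" 4 "real K / 2"] by (simp add: mult_ac)
  qed
  moreover have "0 \<le> \<alpha> / (2 * K)" using \<alpha> by simp
  ultimately have mb: "1 - 1 / d \<le> pmf (main_pmf A B) True" for A B
    using main_bound[OF bad _ _ K_power_bound[OF K_def a1(1,2)] a1(2)] by blast
  have "1 / d \<le> \<delta>" using a1(2,4) \<delta>(1) by (simp add: field_simps)
  show ?thesis
    unfolding worst_case_mult_def Let_def a_def[symmetric] d_def[symmetric]
  proof (intro ballI)
    fix A B assume AB: "A \<in> Fp_mats p n" "B \<in> Fp_mats p n"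
    let ?s = "init_state [n, p, a, d] A B"
    let ?A = "\<lambda>ij. A $$ ij" and ?B = "\<lambda>ij. B $$ ij"
    have dim: "A \<in> carrier_mat n n" "B \<in> carrier_mat n n" using AB by (auto simp: Fp_mats_def)
    have "sim program ?s (5000 * (a + d) + 1000 * (find_cost * K * K * K)) (main_pmf ?A ?B)
      (\<lambda>ok s'. ok \<longrightarrow> output_mat n s' = Some (mat n n (\<lambda>(i, j). (\<Sum>l<n. ?A (i, l) * ?B (l, j)) mod int p)))"
      by (rule sim_program[where d=d])
        (use dim a1 in \<open>auto simp: init_state_def K_def holds_mat_def arr_of_mat_def nth_Cons'\<close>)
    moreover have "mat n n (\<lambda>(i, j). (\<Sum>l<n. ?A (i, l) * ?B (l, j)) mod int p) = Fp_mult p A B"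
      using dim by (intro eq_matI) (auto simp: Fp_mult_def scalar_prod_def atLeast0LessThan)
    moreover have "find_cost * K * K * K = T * K ^ 7 * a" by (simp add: find_cost_def power_numeral_reduce mult_ac)
    ultimately have S: "sim program ?s (5000 * (a + d) + 1000 * (T * K ^ 7 * a)) (main_pmf ?A ?B)
      (\<lambda>ok s'. ok \<longrightarrow> output_mat n s' = Some (Fp_mult p A B))" by simp
    have cost: "real (5000 * (a + d) + 1000 * (T * K ^ 7 * a)) \<le> cost_const / (\<delta> * \<alpha>\<^sup>2) * T"
      using \<alpha> \<delta> tc_pos a_def d_def K_def by (rule total_cost)
    have "runs_in_time p n T (alg_dist p n c) program ?s (cost_const / (\<delta> * \<alpha>\<^sup>2) * T)"
      using sim_output(1)[OF S] cost by (rule runs_in_time_mono)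
    moreover have "1 - \<delta> \<le> measure_pmf.prob (output_dist p n T (alg_dist p n c) program ?s) {Some (Fp_mult p A B)}"
      using sim_output(2)[OF S] mb[of ?A ?B] \<open>1 / d \<le> \<delta>\<close> by linarith
    ultimately show "runs_in_time p n T (alg_dist p n c) program ?s (cost_const / (\<delta> * \<alpha>\<^sup>2) * T) \<and>
      1 - \<delta> \<le> measure_pmf.prob (output_dist p n T (alg_dist p n c) program ?s) {Some (Fp_mult p A B)}" ..
  qed
qed

lemma worst_case_mult_mono:
  "worst_case_mult p n c T c' \<alpha> \<delta> \<tau> \<Longrightarrow> \<tau> \<le> \<tau>' \<Longrightarrow> worst_case_mult p n c T c' \<alpha> \<delta> \<tau>'"
  unfolding worst_case_mult_def Let_def using runs_in_time_mono by blast

text \<open>The constants precede all data, and \<open>ALG'\<close> precedes \<open>n\<close> and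
  \<open>\<delta>\<close>, so one program serves all sizes and error bounds; \<open>program\<close>
  is the witness in both cases. The 1 added to the fifth power gives the O-notation its meaning at
  \<open>\<alpha> = 1\<close>, where the logarithm vanishes.\<close>

theorem theorem1:
  shows
    "(\<exists>K > 0. \<forall>(p :: nat) (\<alpha> :: nat \<Rightarrow> real) (T :: nat \<Rightarrow> nat) (ALG :: com). prime p \<longrightarrow>
        (\<exists>ALG' :: com. \<forall>n \<ge> 1.
           0 < \<alpha> n \<and> \<alpha> n \<le> 1 \<and> average_case_mult p n ALG (T n) (\<alpha> n) \<and>
           real p \<le> 2 / \<alpha> n \<longrightarrow>
           (\<forall>\<delta>::real. 0 < \<delta> \<and> \<delta> \<le> 1 \<longrightarrow>
              worst_case_mult p n ALG (T n) ALG' (\<alpha> n) \<delta>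
                (exp (K * (1 + ln (1 / \<alpha> n) ^ 5)) / \<delta> * real (T n)))))
     \<and>
     (\<exists>K > 0. \<forall>(p :: nat) (\<alpha> :: nat \<Rightarrow> real) (T :: nat \<Rightarrow> nat) (ALG :: com). prime p \<longrightarrow>
        (\<exists>ALG' :: com. \<forall>n \<ge> 1.
           0 < \<alpha> n \<and> \<alpha> n \<le> 1 \<and> average_case_mult p n ALG (T n) (\<alpha> n) \<and>
           real p \<ge> 2 / \<alpha> n \<longrightarrow>
           (\<forall>\<delta>::real. 0 < \<delta> \<and> \<delta> \<le> 1 \<longrightarrow>
              worst_case_mult p n ALG (T n) ALG' (\<alpha> n) \<delta>
                (K * (1 / (\<delta> * \<alpha> n ^ 4) * real (T n))))))"
proof (rule conjI, goal_cases)
  case 1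
  have C: "1 \<le> cost_const" by (simp add: cost_const_def)
  \<comment> \<open>\<open>cost_const / \<alpha>\<^sup>2\<close> is
    \<open>exp (ln cost_const + 2 * L)\<close> for \<open>L = ln (1 / \<alpha>)\<close>, and
    \<open>L \<le> 1 + L ^ 5\<close>: the 2 pays for \<open>\<alpha>\<^sup>2\<close>, the logarithm
    for the constant.\<close>
  let ?K = "2 + ln cost_const"
  have exp_bound: "cost_const / (\<delta> * \<alpha>\<^sup>2) * T \<le> exp (?K * (1 + ln (1 / \<alpha>) ^ 5)) / \<delta> * T"
    if "0 < \<alpha>" "\<alpha> \<le> 1" "0 < \<delta>" for \<alpha> \<delta> :: real and T :: nat
  proof -
    let ?L = "ln (1 / \<alpha>)"
    have L: "0 \<le> ?L" using that by simp
    have "x \<le> 1 + x ^ 5" if "0 \<le> x" for x :: real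
    proof (cases "x \<le> 1")
      case True
      then show ?thesis using zero_le_power[OF that, of 5] by linarith
    next
      case False
      then have "x ^ 1 \<le> x ^ 5" by (intro power_increasing) auto
      then show ?thesis by simp
    qed
    from this[OF L] have "?L \<le> 1 + ?L ^ 5" .
    moreover have "0 \<le> ln cost_const" "0 \<le> ?L ^ 5" using C L by auto
    then have "ln cost_const \<le> ln cost_const * (1 + ?L ^ 5)" by (simp add: distrib_left)
    ultimately have "ln cost_const + 2 * ?L \<le> ?K * (1 + ?L ^ 5)" by (simp add: distrib_right)
    then have "exp (ln cost_const + 2 * ?L) \<le> exp (?K * (1 + ?L ^ 5))" by simp
    moreover have "exp (ln cost_const + 2 * ?L) = cost_const / \<alpha>\<^sup>2"
    proof -
      have "exp (2 * ?L) = exp ?L ^ 2" using exp_of_nat_mult[of 2 ?L] by simp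
      then show ?thesis using C that by (simp add: exp_add power_divide)
    qed
    ultimately have "cost_const / \<alpha>\<^sup>2 / \<delta> * T \<le> exp (?K * (1 + ?L ^ 5)) / \<delta> * T"
      using that by (intro mult_right_mono divide_right_mono) auto
    then show ?thesis by (simp add: mult.commute)
  qed
  show ?case
  proof (intro exI[of _ ?K] conjI allI impI exI[of _ program])
    show "0 < ?K" using ln_ge_zero[OF C] by linarith
    fix p n :: nat and \<alpha> :: "nat \<Rightarrow> real" and T :: "nat \<Rightarrow> nat" and ALG :: com and \<delta> :: real
    assume "prime p" "1 \<le> n" "0 < \<delta> \<and> \<delta> \<le> 1"
      "0 < \<alpha> n \<and> \<alpha> n \<le> 1 \<and> average_case_mult p n ALG (T n) (\<alpha> n) \<and> real p \<le> 2 / \<alpha> n"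
    then show "worst_case_mult p n ALG (T n) program (\<alpha> n) \<delta> (exp (?K * (1 + ln (1 / \<alpha> n) ^ 5)) / \<delta> * real (T n))"
      by (intro worst_case_mult_mono[OF worst_case_program exp_bound]) blast+
  qed
next
  case 2
  have C: "1 \<le> cost_const" by (simp add: cost_const_def)
  show ?case
  proof (intro exI[of _ cost_const] conjI allI impI exI[of _ program])
    show "0 < cost_const" using C by linarith
    fix p n :: nat and \<alpha> :: "nat \<Rightarrow> real" and T :: "nat \<Rightarrow> nat" and ALG :: com and \<delta> :: real
    assume "prime p" "1 \<le> n" and \<delta>: "0 < \<delta> \<and> \<delta> \<le> 1"
      and \<alpha>: "0 < \<alpha> n \<and> \<alpha> n \<le> 1 \<and> average_case_mult p n ALG (T n) (\<alpha> n) \<and> 2 / \<alpha> n \<le> real p"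
    then have w: "worst_case_mult p n ALG (T n) program (\<alpha> n) \<delta> (cost_const / (\<delta> * (\<alpha> n)\<^sup>2) * T n)"
      by (intro worst_case_program) auto
    have "\<alpha> n ^ 4 \<le> (\<alpha> n)\<^sup>2" using \<alpha> by (intro power_decreasing) auto
    then have "cost_const / (\<delta> * (\<alpha> n)\<^sup>2) * T n \<le> cost_const / (\<delta> * \<alpha> n ^ 4) * T n"
      using \<alpha> \<delta> C by (intro mult_right_mono divide_left_mono mult_left_mono mult_pos_pos) auto
    also have "\<dots> = cost_const * (1 / (\<delta> * \<alpha> n ^ 4) * T n)" by simp
    finally show "worst_case_mult p n ALG (T n) program (\<alpha> n) \<delta> (cost_const * (1 / (\<delta> * \<alpha> n ^ 4) * real (T n)))"
      using w by (rule worst_case_mult_mono[rotated])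
  qed
qed

end
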